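(* Assume (A1), (A2), (A3) (see context). Let the parameters satisfy $\theta_i\in(0,2)$, $\alpha_i>0$, $\gamma_i>0$ and $0<\gamma_i\beta<1/\lambda_{\max}(L)$ for all $i=1,\dots,m$, and let the precisions satisfy $\sum_{k=0}^\infty\varepsilon_i^k<\infty$ for all $i$. Let $\{\xi^k\}_{k\ge0}$, $\{\widehat\xi^k\}_{k\ge0}$ and $\{V^k\}_{k\ge0}$ be generated by the inexact DPMM algorithm described in the context. Then: (a) for every $\xi^*=\mathrm{col}(\mathrm{x}^*,\mathrm{Y}^*,\mathrm{Z}^* )\in\Phi^{-1}(0)$ and every $k\ge0$, $$\|\xi^{k+1}-\xi^*\|_{\mathbf H}^2\le\|\xi^k-\xi^*\|_{\mathbf H}^2-\|\xi^k-\widehat\xi^k\|_{\mathbf D}^2+2\langle\widehat\xi^k-\xi^*,V^k\rangle;$$ (b) the sequence $\{\xi^k\}_{k\ge0}$ is bounded; (c) $\{\xi^k\}_{k\ge0}$ converges to some $\xi^\infty=\mathrm{col}(\mathrm{x}^\infty,\mathrm{Y}^\infty,\mathrm{Z}^\infty)\in\Phi^{-1}(0)$; in particular $\mathrm{x}^\infty$ is an optimal solution of (P), $\mathrm{Y}^\infty=\mathbf 1_m\otimes\mathrm{y}^\infty$ for some $\mathrm{y}^\infty\in\mathbb R^{p+q}$, and $\mathrm{y}^\infty$ is an optimal solution of (D).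
   Context: Problem. Let $m\ge2$, $n_1,\dots,n_m\ge1$, $p,q\ge0$ be integers, $n=\sum_i n_i$, $\mathcal V=\{1,\dots,m\}$. For $i\in\mathcal V$ let $f_i:\mathbb R^{n_i}\to\mathbb R$, $A_i\in\mathbb R^{p\times n_i}$, $b_i\in\mathbb R^p$, $g_i:\mathbb R^{n_i}\to\mathbb R^q$, $\Omega_i\subseteq\mathbb R^{n_i}$, and $G_i(\mathrm x_i)=\mathrm{col}(A_i\mathrm x_i-b_i,\,g_i(\mathrm x_i))\in\mathbb R^{p+q}$. Let $\mathcal K=\{0_p\}\times\mathbb R^q_-$ and $\mathcal K^\circ=\mathbb R^p\times\mathbb R^q_+$. Problem (P): minimize $F(\mathrm x)=\sum_i f_i(\mathrm x_i)$ over $\mathrm x=\mathrm{col}(\mathrm x_1,\dots,\mathrm x_m)\in\mathbb R^n$ subject to $\sum_iG_i(\mathrm x_i)\in\mathcal K$ and $\mathrm x_i\in\Omega_i$ for all $i$. With $\delta_S$ the indicator function of a set $S$ ($0$ on $S$, $+\infty$ off $S$), put $\ell_i(\mathrm x_i,\mathrm y)=f_i(\mathrm x_i)+\mathrm y^\top G_i(\mathrm x_i)+\delta_{\Omega_i}(\mathrm x_i)-\delta_{\mathcal K^\circ}(\mathrm y)$ for $\mathrm y\in\mathbb R^{p+q}$. Dual problem (D): maximize $\varphi(\mathrm y)=\sum_i\inf_{\mathrm x_i}\ell_i(\mathrm x_i,\mathrm y)$ over $\mathrm y\in\mathbb R^{p+q}$. Assumptions. (A1) $\mathcal G=(\mathcal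 V,\mathcal E)$ is a connected undirected graph; $L\in\mathbb R^{m\times m}$ is symmetric and compatible with $\mathcal G$ (i.e. $L_{ij}=0$ whenever $i\ne j$ and $(i,j)\notin\mathcal E$, and $\mathrm{null}(L)=\mathrm{span}\{\mathbf 1_m\}$), and $L=U^\top U$ for a full-row-rank matrix $U\in\mathbb R^{r\times m}$ with $U\mathbf 1_m=0$. (A2) each $f_i$ and each component of $g_i$ is a proper closed convex function, each $\Omega_i$ is a nonempty closed convex set, and the optimal solution set of (P) is nonempty. (A3) (Slater) there is $\bar{\mathrm x}$ with $\bar{\mathrm x}_i\in\mathrm{int}(\Omega_i)$ for all $i$, $\sum_i(A_i\bar{\mathrm x}_i-b_i)=0$ and $\sum_ig_i(\bar{\mathrm x}_i)<0$ componentwise. Operator. $\mathbf L=L\otimes I_{p+q}$, $\mathbf U=U\otimes I_{p+q}\in\mathbb R^{r(p+q)\times m(p+q)}$. For $\mathrm x\in\mathbb R^n$ and $\mathrm Y=\mathrm{col}(\mathrm y_1,\dots,\mathrm y_m)$, $\mathrm y_i\in\mathbb R^{p+q}$, let $\mathcal L(\mathrm x,\mathrm Y)=\sum_i\ell_i(\mathrm x_i,\mathrm y_i)$; $\partial_{\mathrm x}\mathcal L$ is the convex subdifferential in $\mathrm x$ and $\partial_{\mathrm Y}\mathcal L(\mathrm x,\mathrm Y):=-\partial_{\mathrm Y}[-\mathcal L(\mathrm x,\mathrm Y)]$. For $\mathrm Z\in\mathbb R^{r(p+q)}$ define the set-valued map $\Phi(\mathrm x,\mathrm Y,\mathrm Z)=\partial_{\mathrm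 x}\mathcal L(\mathrm x,\mathrm Y)\times\big(-\partial_{\mathrm Y}\mathcal L(\mathrm x,\mathrm Y)+\mathbf U^\top\mathrm Z\big)\times\{-\mathbf U\mathrm Y\}$, and $\Phi^{-1}(0)$ its zero set. Matrices. Parameters $\theta_i,\alpha_i,\gamma_i>0$ ($i\in\mathcal V$) and $\beta>0$; $\Theta=\mathrm{diag}(\theta_iI_{n_i})_i$, $\Upsilon=\mathrm{diag}(\alpha_iI_{n_i})_i$, $\Gamma=\mathrm{diag}(\gamma_iI_{p+q})_i$; $Q=\begin{pmatrix}\Upsilon^{-1}&0&0\\0&\Gamma^{-1}&-\mathbf U^\top\\0&0&\frac1\beta I\end{pmatrix}$, $M=\begin{pmatrix}\Theta&0&0\\0&I&-\Gamma\mathbf U^\top\\0&0&I\end{pmatrix}$ (identities of sizes $m(p+q)$ and $r(p+q)$ as appropriate), $\mathbf H=QM^{-1}$, $\mathbf D=Q^\top+Q-M^\top\mathbf HM$, $\|v\|_{\mathbf H}=\sqrt{\langle v,\mathbf Hv\rangle}$. Algorithm (inexact DPMM). $\mathcal P_{\mathcal K^\circ}(u_1,u_2)=(u_1,\max(u_2,0))$ for $(u_1,u_2)\in\mathbb R^p\times\mathbb R^q$. Initialize $\mathrm x_i^0\in\Omega_i$, $\mathrm y_i^0\in\mathcal K^\circ$, $\lambda_i^0=0\in\mathbb R^{p+q}$. At iteration $k$, each agent $i$ chooses $\varepsilon_i^k\ge0$, sets $\phi_i^k(\mathrm x_i,\mathrm y_i)=f_i(\mathrm x_i)+\frac1{2\gamma_i}(\|\mathcal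 P_{\mathcal K^\circ}(\mathrm y_i+\gamma_iG_i(\mathrm x_i))\|^2-\|\mathrm y_i\|^2)+\frac1{2\alpha_i}\|\mathrm x_i-\mathrm x_i^k\|^2+\delta_{\Omega_i}(\mathrm x_i)$, computes $\widehat{\mathrm x}_i^k$ and $v_i^k\in\partial_{\mathrm x_i}\phi_i^k(\widehat{\mathrm x}_i^k,\mathrm y_i^k-\gamma_i\lambda_i^k)$ with $\|v_i^k\|\le\varepsilon_i^k$, and sets $\widehat{\mathrm y}_i^k=\mathcal P_{\mathcal K^\circ}(\mathrm y_i^k-\gamma_i\lambda_i^k+\gamma_iG_i(\widehat{\mathrm x}_i^k))$, $\mathrm x_i^{k+1}=(1-\theta_i)\mathrm x_i^k+\theta_i\widehat{\mathrm x}_i^k$, $\lambda_i^{k+1}=\lambda_i^k+\beta\sum_jL_{ij}\widehat{\mathrm y}_j^k$, $\mathrm y_i^{k+1}=\widehat{\mathrm y}_i^k+\gamma_i(\lambda_i^k-\lambda_i^{k+1})$. Stack $\mathrm x^k,\mathrm Y^k,\Lambda^k=\mathrm{col}(\lambda_i^k)_i,\widehat{\mathrm x}^k,\widehat{\mathrm Y}^k$. Let $\mathrm Z^k\in\mathbb R^{r(p+q)}$ be the (unique) vector with $\Lambda^k=\mathbf U^\top\mathrm Z^k$ and $\widehat{\mathrm Z}^k$ the one with $\Lambda^{k+1}=\mathbf U^\top\widehat{\mathrm Z}^k$; $\xi^k=\mathrm{col}(\mathrm x^k,\mathrm Y^k,\mathrm Z^k)$, $\widehat\xi^k=\mathrm{col}(\widehat{\mathrm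 x}^k,\widehat{\mathrm Y}^k,\widehat{\mathrm Z}^k)$, $V^k=\mathrm{col}(v_1^k,\dots,v_m^k,0,0)$. *)

theory Defs
  imports "Jordan_Normal_Form.Char_Poly" "HOL-Library.Extended_Real" "HOL-Library.Liminf_Limsup"
begin

(* Vectors of R^d are represented as JNF vectors in carrier_vec d.
   Agents are indexed by 0..m-1 (instead of 1..m). *)

definition vnorm :: "real vec \<Rightarrow> real" where
  "vnorm v = sqrt (v \<bullet> v)"

definition vconv :: "(nat \<Rightarrow> real vec) \<Rightarrow> real vec \<Rightarrow> bool" where
  "vconv s l \<longleftrightarrow> (\<forall>k. dim_vec (s k) = dim_vec l) \<and> (\<lambda>k. vnorm (s k - l)) \<longlonglongrightarrow> 0"

definition vclosed :: "nat \<Rightarrow> real vec set \<Rightarrow> bool" where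
  "vclosed d S \<longleftrightarrow> S \<subseteq> carrier_vec d \<and> (\<forall>s l. (\<forall>k. s k \<in> S) \<longrightarrow> vconv s l \<longrightarrow> l \<in> S)"

definition vinterior :: "nat \<Rightarrow> real vec set \<Rightarrow> real vec set" where
  "vinterior d S = {x \<in> carrier_vec d. \<exists>e>0. \<forall>y\<in>carrier_vec d. vnorm (y - x) < e \<longrightarrow> y \<in> S}"

definition vconvex_set :: "nat \<Rightarrow> real vec set \<Rightarrow> bool" where
  "vconvex_set d S \<longleftrightarrow> S \<subseteq> carrier_vec d \<and>
     (\<forall>x\<in>S. \<forall>y\<in>S. \<forall>t::real. 0 \<le> t \<and> t \<le> 1 \<longrightarrow> t \<cdot>\<^sub>v x + (1 - t) \<cdot>\<^sub>v y \<in> S)"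

definition vconvex_fun :: "nat \<Rightarrow> (real vec \<Rightarrow> real) \<Rightarrow> bool" where
  "vconvex_fun d f \<longleftrightarrow> (\<forall>x\<in>carrier_vec d. \<forall>y\<in>carrier_vec d. \<forall>t::real. 0 \<le> t \<and> t \<le> 1 \<longrightarrow>
       f (t \<cdot>\<^sub>v x + (1 - t) \<cdot>\<^sub>v y) \<le> t * f x + (1 - t) * f y)"

definition vlsc :: "nat \<Rightarrow> (real vec \<Rightarrow> real) \<Rightarrow> bool" where
  "vlsc d f \<longleftrightarrow> (\<forall>s x. (\<forall>k. s k \<in> carrier_vec d) \<longrightarrow> x \<in> carrier_vec d \<longrightarrow> vconv s x \<longrightarrow>
       ereal (f x) \<le> liminf (\<lambda>k. ereal (f (s k))))"

(* a real-valued function R^d -> R is automatically proper *)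
definition proper_closed_convex :: "nat \<Rightarrow> (real vec \<Rightarrow> real) \<Rightarrow> bool" where
  "proper_closed_convex d f \<longleftrightarrow> vconvex_fun d f \<and> vlsc d f"

definition esubdiff :: "nat \<Rightarrow> (real vec \<Rightarrow> ereal) \<Rightarrow> real vec \<Rightarrow> real vec set" where
  "esubdiff d F x = {v \<in> carrier_vec d. x \<in> carrier_vec d \<and> F x \<noteq> \<infinity> \<and> F x \<noteq> -\<infinity> \<and>
       (\<forall>y\<in>carrier_vec d. F x + ereal (v \<bullet> (y - x)) \<le> F y)}"

definition ind :: "'a set \<Rightarrow> 'a \<Rightarrow> ereal" where
  "ind S x = (if x \<in> S then 0 else \<infinity>)"

definition offs :: "(nat \<Rightarrow> nat) \<Rightarrow> nat \<Rightarrow> nat" where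
  "offs ds i = (\<Sum>j<i. ds j)"

definition blk :: "(nat \<Rightarrow> nat) \<Rightarrow> nat \<Rightarrow> real vec \<Rightarrow> real vec" where
  "blk ds i x = vec (ds i) (\<lambda>j. x $ (offs ds i + j))"

fun stack :: "nat \<Rightarrow> (nat \<Rightarrow> real vec) \<Rightarrow> real vec" where
  "stack 0 vs = vec 0 (\<lambda>_. 0)"
| "stack (Suc k) vs = stack k vs @\<^sub>v vs k"

definition vsum :: "nat \<Rightarrow> nat \<Rightarrow> (nat \<Rightarrow> real vec) \<Rightarrow> real vec" where
  "vsum d m F = vec d (\<lambda>c. \<Sum>i<m. F i $ c)"

definition Kcone :: "nat \<Rightarrow> nat \<Rightarrow> real vec set" where
  "Kcone p q = {y \<in> carrier_vec (p + q). (\<forall>c<p. y $ c = 0) \<and> (\<forall>c. p \<le> c \<and> c < p + q \<longrightarrow> y $ c \<le> 0)}"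

definition Kpol :: "nat \<Rightarrow> nat \<Rightarrow> real vec set" where
  "Kpol p q = {y \<in> carrier_vec (p + q). \<forall>c. p \<le> c \<and> c < p + q \<longrightarrow> 0 \<le> y $ c}"

definition projK :: "nat \<Rightarrow> nat \<Rightarrow> real vec \<Rightarrow> real vec" where
  "projK p q u = vec (p + q) (\<lambda>c. if c < p then u $ c else max (u $ c) 0)"

definition Gfun :: "(nat \<Rightarrow> real mat) \<Rightarrow> (nat \<Rightarrow> real vec) \<Rightarrow> (nat \<Rightarrow> real vec \<Rightarrow> real vec)
    \<Rightarrow> nat \<Rightarrow> real vec \<Rightarrow> real vec" where
  "Gfun A b g i x = (A i *\<^sub>v x - b i) @\<^sub>v g i x"

definition ell :: "(nat \<Rightarrow> real vec \<Rightarrow> real) \<Rightarrow> (nat \<Rightarrow> real mat) \<Rightarrow> (nat \<Rightarrow> real vec)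
    \<Rightarrow> (nat \<Rightarrow> real vec \<Rightarrow> real vec) \<Rightarrow> (nat \<Rightarrow> real vec set) \<Rightarrow> nat \<Rightarrow> nat
    \<Rightarrow> nat \<Rightarrow> real vec \<Rightarrow> real vec \<Rightarrow> ereal" where
  "ell f A b g \<Omega> p q i x y =
     ereal (f i x + y \<bullet> Gfun A b g i x) + ind (\<Omega> i) x - ind (Kpol p q) y"

definition Lag :: "nat \<Rightarrow> (nat \<Rightarrow> nat) \<Rightarrow> (nat \<Rightarrow> real vec \<Rightarrow> real) \<Rightarrow> (nat \<Rightarrow> real mat)
    \<Rightarrow> (nat \<Rightarrow> real vec) \<Rightarrow> (nat \<Rightarrow> real vec \<Rightarrow> real vec) \<Rightarrow> (nat \<Rightarrow> real vec set)
    \<Rightarrow> nat \<Rightarrow> nat \<Rightarrow> real vec \<Rightarrow> real vec \<Rightarrow> ereal" where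
  "Lag m nd f A b g \<Omega> p q x Y =
     (\<Sum>i<m. ell f A b g \<Omega> p q i (blk nd i x) (blk (\<lambda>_. p + q) i Y))"

definition feasibleP :: "nat \<Rightarrow> (nat \<Rightarrow> nat) \<Rightarrow> (nat \<Rightarrow> real mat)
    \<Rightarrow> (nat \<Rightarrow> real vec) \<Rightarrow> (nat \<Rightarrow> real vec \<Rightarrow> real vec) \<Rightarrow> (nat \<Rightarrow> real vec set)
    \<Rightarrow> nat \<Rightarrow> nat \<Rightarrow> real vec \<Rightarrow> bool" where
  "feasibleP m nd A b g \<Omega> p q x \<longleftrightarrow>
     x \<in> carrier_vec (\<Sum>i<m. nd i) \<and>
     vsum (p + q) m (\<lambda>i. Gfun A b g i (blk nd i x)) \<in> Kcone p q \<and>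
     (\<forall>i<m. blk nd i x \<in> \<Omega> i)"

definition optimalP :: "nat \<Rightarrow> (nat \<Rightarrow> nat) \<Rightarrow> (nat \<Rightarrow> real vec \<Rightarrow> real) \<Rightarrow> (nat \<Rightarrow> real mat)
    \<Rightarrow> (nat \<Rightarrow> real vec) \<Rightarrow> (nat \<Rightarrow> real vec \<Rightarrow> real vec) \<Rightarrow> (nat \<Rightarrow> real vec set)
    \<Rightarrow> nat \<Rightarrow> nat \<Rightarrow> real vec \<Rightarrow> bool" where
  "optimalP m nd f A b g \<Omega> p q x \<longleftrightarrow>
     feasibleP m nd A b g \<Omega> p q x \<and>
     (\<forall>x'. feasibleP m nd A b g \<Omega> p q x' \<longrightarrow>
        (\<Sum>i<m. f i (blk nd i x)) \<le> (\<Sum>i<m. f i (blk nd i x')))"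

definition dualfun :: "nat \<Rightarrow> (nat \<Rightarrow> nat) \<Rightarrow> (nat \<Rightarrow> real vec \<Rightarrow> real) \<Rightarrow> (nat \<Rightarrow> real mat)
    \<Rightarrow> (nat \<Rightarrow> real vec) \<Rightarrow> (nat \<Rightarrow> real vec \<Rightarrow> real vec) \<Rightarrow> (nat \<Rightarrow> real vec set)
    \<Rightarrow> nat \<Rightarrow> nat \<Rightarrow> real vec \<Rightarrow> ereal" where
  "dualfun m nd f A b g \<Omega> p q y =
     (\<Sum>i<m. INF xi\<in>carrier_vec (nd i). ell f A b g \<Omega> p q i xi y)"

definition optimalD :: "nat \<Rightarrow> (nat \<Rightarrow> nat) \<Rightarrow> (nat \<Rightarrow> real vec \<Rightarrow> real) \<Rightarrow> (nat \<Rightarrow> real mat)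
    \<Rightarrow> (nat \<Rightarrow> real vec) \<Rightarrow> (nat \<Rightarrow> real vec \<Rightarrow> real vec) \<Rightarrow> (nat \<Rightarrow> real vec set)
    \<Rightarrow> nat \<Rightarrow> nat \<Rightarrow> real vec \<Rightarrow> bool" where
  "optimalD m nd f A b g \<Omega> p q y \<longleftrightarrow>
     y \<in> carrier_vec (p + q) \<and>
     (\<forall>y'\<in>carrier_vec (p + q). dualfun m nd f A b g \<Omega> p q y' \<le> dualfun m nd f A b g \<Omega> p q y)"

definition kron :: "real mat \<Rightarrow> real mat \<Rightarrow> real mat" where
  "kron A B = mat (dim_row A * dim_row B) (dim_col A * dim_col B)
     (\<lambda>(i, j). A $$ (i div dim_row B, j div dim_col B) * B $$ (i mod dim_row B, j mod dim_col B))"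

definition minv :: "real mat \<Rightarrow> real mat" where
  "minv M = (THE B. B \<in> carrier_mat (dim_row M) (dim_row M) \<and> inverts_mat M B \<and> inverts_mat B M)"

definition bdiag :: "nat \<Rightarrow> (nat \<Rightarrow> nat) \<Rightarrow> (nat \<Rightarrow> real) \<Rightarrow> real mat" where
  "bdiag m ds cs = diag_block_mat (map (\<lambda>i. cs i \<cdot>\<^sub>m 1\<^sub>m (ds i)) [0..<m])"

definition lam_max :: "real mat \<Rightarrow> real" where
  "lam_max L = Max {c. eigenvalue L c}"

definition full_row_rank :: "real mat \<Rightarrow> bool" where
  "full_row_rank U \<longleftrightarrow> (\<forall>c\<in>carrier_vec (dim_row U).
      (\<forall>j<dim_col U. (\<Sum>i<dim_row U. c $ i * U $$ (i, j)) = 0) \<longrightarrow> c = 0\<^sub>v (dim_row U))"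

definition qn :: "real mat \<Rightarrow> real vec \<Rightarrow> real" where
  "qn H v = v \<bullet> (H *\<^sub>v v)"

definition PhiZero :: "nat \<Rightarrow> (nat \<Rightarrow> nat) \<Rightarrow> (nat \<Rightarrow> real vec \<Rightarrow> real) \<Rightarrow> (nat \<Rightarrow> real mat)
    \<Rightarrow> (nat \<Rightarrow> real vec) \<Rightarrow> (nat \<Rightarrow> real vec \<Rightarrow> real vec) \<Rightarrow> (nat \<Rightarrow> real vec set)
    \<Rightarrow> nat \<Rightarrow> nat \<Rightarrow> real mat \<Rightarrow> real vec set" where
  "PhiZero m nd f A b g \<Omega> p q U =
    (let N = (\<Sum>i<m. nd i); MY = m * (p + q); RZ = dim_row U * (p + q);
         bU = kron U (1\<^sub>m (p + q)) in
     {\<xi> \<in> carrier_vec (N + MY + RZ).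
       let x = vec_first \<xi> N; Y = vec_first (vec_last \<xi> (MY + RZ)) MY; Z = vec_last \<xi> RZ in
       0\<^sub>v N \<in> esubdiff N (\<lambda>x'. Lag m nd f A b g \<Omega> p q x' Y) x \<and>
       0\<^sub>v MY \<in> (\<lambda>s. s + bU\<^sup>T *\<^sub>v Z) `
                 ((\<lambda>s. - s) ` ((\<lambda>s. - s) ` esubdiff MY (\<lambda>Y'. - Lag m nd f A b g \<Omega> p q x Y') Y)) \<and>
       0\<^sub>v RZ = - (bU *\<^sub>v Y)})"

end

theory Submission
  imports Defs "HOL-Analysis.L2_Norm" "HOL-Analysis.Elementary_Metric_Spaces"
begin

text \<open>Write \<open>\<xi>\<^sup>k\<^sup>+\<^sup>1 = \<xi>\<^sup>k - M d\<close> with \<open>d = \<xi>\<^sup>k - \<xi>h\<^sup>k\<close>. Since \<open>H M = Q\<close> and \<open>H\<close> turns out to be the diagonal matrix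
  \<open>diag(1/(\<alpha>\<theta>), 1/\<gamma>, 1/\<beta>)\<close>, expanding \<open>\<parallel>\<xi>\<^sup>k\<^sup>+\<^sup>1 - \<xi>\<^sup>*\<parallel>\<^sub>H\<close> reduces (a) to \<open>\<langle>\<xi>h\<^sup>k - \<xi>\<^sup>*, Q d + V\<^sup>k\<rangle> \<ge> 0\<close>, which is monotonicity of
  \<open>\<Phi>\<close> because the inexact prox step says \<open>Q d + V\<^sup>k \<in> \<Phi>(\<xi>h\<^sup>k)\<close>. The matrix
  \<open>D = diag((2 - \<theta>)/\<alpha>, 1/\<gamma>, I/\<beta> - U \<Gamma> U\<^sup>T)\<close> is positive definite by the bound on \<open>\<gamma> \<beta>\<close>. Bounding \<open>xh\<^sup>k - x\<^sup>*\<close> by the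
  distances of \<open>x\<^sup>k\<close> and \<open>x\<^sup>k\<^sup>+\<^sup>1\<close> to \<open>x\<^sup>*\<close> turns (a) into \<open>a\<^sub>k\<^sub>+\<^sub>1 \<le> a\<^sub>k + C \<epsilon>\<^sub>k\<close> for \<open>a\<^sub>k = \<parallel>\<xi>\<^sup>k - \<xi>\<^sup>*\<parallel>\<^sub>H\<close>, so \<open>a\<^sub>k\<close> converges and
  \<open>d\<close> tends to 0; every cluster point is then a zero of \<open>\<Phi>\<close>, and applying the same argument to such a cluster point gives
  convergence. A zero exists because normalised multipliers of penalty problems accumulate at a Lagrange multiplier \<open>y\<close> of (P)
  under Slater's condition, and the consensus multiplier can be chosen with
  \<open>\<lambda>\<^sub>i = G\<^sub>i(x\<^sub>i) - (1/m) \<Sum>\<^sub>j G\<^sub>j(x\<^sub>j)\<close>, which lies in the range of \<open>U\<^sup>T \<otimes> I\<close>.\<close>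

section \<open>Vectors\<close>

lemma scalar_prod_lessThan: "x \<bullet> y = (\<Sum>c<dim_vec y. x $ c * y $ c)"
  by (simp add: scalar_prod_def atLeast0LessThan)

lemma scalar_prod_add_left:
  "dim_vec y = dim_vec z \<Longrightarrow> (x + y) \<bullet> z = x \<bullet> z + y \<bullet> (z :: 'a :: semiring_0 vec)"
  by (simp add: scalar_prod_lessThan distrib_right sum.distrib)

lemma scalar_prod_add_right:
  "dim_vec y = dim_vec z \<Longrightarrow> x \<bullet> (y + z) = x \<bullet> y + x \<bullet> (z :: 'a :: semiring_0 vec)"
  by (simp add: scalar_prod_lessThan distrib_left sum.distrib)

lemma scalar_prod_diff_left:
  "dim_vec y = dim_vec z \<Longrightarrow> (x - y) \<bullet> z = x \<bullet> z - y \<bullet> (z :: 'a :: ring vec)"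
  by (simp add: scalar_prod_lessThan left_diff_distrib sum_subtractf)

lemma scalar_prod_diff_right:
  "dim_vec y = dim_vec z \<Longrightarrow> x \<bullet> (y - z) = x \<bullet> y - x \<bullet> (z :: 'a :: ring vec)"
  by (simp add: scalar_prod_lessThan right_diff_distrib sum_subtractf)

lemmas scalar_prod_distribs =
  scalar_prod_add_left scalar_prod_add_right scalar_prod_diff_left scalar_prod_diff_right

lemma scalar_prod_commute: "dim_vec x = dim_vec y \<Longrightarrow> x \<bullet> y = y \<bullet> (x :: 'a :: comm_semiring_0 vec)"
  by (rule comm_scalar_prod[OF carrier_vecI]) auto

lemma scalar_prod_self_nonneg [simp]: "0 \<le> x \<bullet> (x :: 'a :: linordered_idom vec)"
  by (simp add: scalar_prod_lessThan sum_nonneg)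

lemma scalar_prod_self_eq_0_iff: "x \<bullet> x = 0 \<longleftrightarrow> x = 0\<^sub>v (dim_vec (x :: 'a :: linordered_idom vec))"
  by (auto simp: scalar_prod_lessThan sum_nonneg_eq_0_iff vec_eq_iff)

lemma mult_mat_zero_vec: "A \<in> carrier_mat n k \<Longrightarrow> A *\<^sub>v 0\<^sub>v k = (0\<^sub>v n :: 'a :: semiring_0 vec)"
  by (intro eq_vecI) (simp_all add: scalar_prod_lessThan)

lemma vec_eq_iff_diff_eq_0:
  fixes x y :: "'a :: ab_group_add vec"
  assumes "x \<in> carrier_vec n" "y \<in> carrier_vec n"
  shows "x = y \<longleftrightarrow> x - y = 0\<^sub>v n"
  using assms by (auto simp: vec_eq_iff)

lemma diff_self_vec: "x - x = 0\<^sub>v (dim_vec (x :: 'a :: ab_group_add vec))"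
  by (auto simp: vec_eq_iff)

lemma diff_carrier_vec [simp]: "y \<in> carrier_vec n \<Longrightarrow> x - y \<in> carrier_vec n"
  by (intro carrier_vecI) simp

lemma diff_diff_cancel_vec:
  fixes x y :: "'a :: ab_group_add vec"
  shows "dim_vec x = dim_vec y \<Longrightarrow> x - (x - y) = y"
  by (auto simp: vec_eq_iff)

lemma vnorm_eq_L2_set: "vnorm x = L2_set (($) x) {..<dim_vec x}"
  by (simp add: vnorm_def L2_set_def scalar_prod_lessThan power2_eq_square)

lemma vnorm_nonneg [simp]: "0 \<le> vnorm x"
  by (simp add: vnorm_def)

lemma vnorm_zero [simp]: "vnorm (0\<^sub>v n) = 0"
  by (simp add: vnorm_def)

lemma vnorm_diff_self [simp]: "vnorm (x - x) = 0"
  by (simp add: diff_self_vec)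

lemma vnorm_power2: "(vnorm x)\<^sup>2 = x \<bullet> x"
  by (simp add: vnorm_def)

lemma abs_index_le_vnorm: "c < dim_vec x \<Longrightarrow> \<bar>x $ c\<bar> \<le> vnorm x"
  using member_le_L2_set[of "{..<dim_vec x}" c "\<lambda>c. \<bar>x $ c\<bar>"]
  by (simp add: vnorm_eq_L2_set L2_set_def)

lemma scalar_prod_le_vnorm:
  assumes "dim_vec x = dim_vec y"
  shows "x \<bullet> y \<le> vnorm x * vnorm y"
proof -
  have "x \<bullet> y \<le> (\<Sum>c<dim_vec y. \<bar>x $ c\<bar> * \<bar>y $ c\<bar>)"
    unfolding scalar_prod_lessThan by (intro sum_mono) (metis abs_ge_self abs_mult)
  also have "\<dots> \<le> vnorm x * vnorm y"
    unfolding vnorm_eq_L2_set assms by (rule L2_set_mult_ineq)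
  finally show ?thesis .
qed

lemma vnorm_smult: "vnorm (a \<cdot>\<^sub>v x) = \<bar>a\<bar> * vnorm x"
  by (simp add: vnorm_def real_sqrt_mult flip: mult.assoc power2_eq_square)

lemma vnorm_triangle_ineq:
  assumes "dim_vec x = dim_vec y"
  shows "vnorm (x + y) \<le> vnorm x + vnorm y"
proof -
  have "vnorm (x + y) = L2_set (\<lambda>c. x $ c + y $ c) {..<dim_vec y}"
    using assms by (auto simp: vnorm_eq_L2_set intro: L2_set_cong)
  also have "\<dots> \<le> vnorm x + vnorm y"
    using assms L2_set_triangle_ineq by (simp add: vnorm_eq_L2_set)
  finally show ?thesis .
qed

lemma vnorm_le_vnorm_diff_add:
  assumes "dim_vec x = dim_vec y"
  shows "vnorm x \<le> vnorm (x - y) + vnorm y"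
proof -
  have "x = (x - y) + y" using assms by (auto simp: vec_eq_iff)
  then show ?thesis using vnorm_triangle_ineq[of "x - y" y] by simp
qed

section \<open>Convergence and compactness\<close>

lemma vconv_iff_index:
  "vconv s l \<longleftrightarrow> (\<forall>k. dim_vec (s k) = dim_vec l) \<and> (\<forall>c<dim_vec l. (\<lambda>k. s k $ c) \<longlonglongrightarrow> l $ c)"
proof (cases "\<forall>k. dim_vec (s k) = dim_vec l")
  case dims: True
  have "(\<lambda>k. s k $ c) \<longlonglongrightarrow> l $ c" if lim: "(\<lambda>k. vnorm (s k - l)) \<longlonglongrightarrow> 0" and c: "c < dim_vec l" for c
  proof (rule LIM_zero_cancel[OF tendsto_rabs_zero_cancel])
    have "\<bar>s k $ c - l $ c\<bar> \<le> vnorm (s k - l)" for k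
      using abs_index_le_vnorm[of c "s k - l"] c dims by simp
    then show "(\<lambda>k. \<bar>s k $ c - l $ c\<bar>) \<longlonglongrightarrow> 0"
      by (intro tendsto_sandwich[OF _ _ tendsto_const lim]) auto
  qed
  moreover have "(\<lambda>k. vnorm (s k - l)) \<longlonglongrightarrow> 0" if "\<forall>c<dim_vec l. (\<lambda>k. s k $ c) \<longlonglongrightarrow> l $ c"
  proof -
    have "(\<lambda>k. sqrt (\<Sum>c<dim_vec l. (s k $ c - l $ c) * (s k $ c - l $ c)))
        \<longlonglongrightarrow> sqrt (\<Sum>c<dim_vec l. (l $ c - l $ c) * (l $ c - l $ c))"
      using that by (intro tendsto_intros) auto
    then show ?thesis using dims by (simp add: vnorm_def scalar_prod_lessThan)
  qed
  ultimately show ?thesis using dims unfolding vconv_def by blast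
qed (auto simp: vconv_def)

lemma vconv_index: "vconv s l \<Longrightarrow> c < dim_vec l \<Longrightarrow> (\<lambda>k. s k $ c) \<longlonglongrightarrow> l $ c"
  by (simp add: vconv_iff_index)

lemma vconv_unique: "vconv s x \<Longrightarrow> vconv s y \<Longrightarrow> x = y"
  by (rule eq_vecI; force simp: vconv_iff_index intro: LIMSEQ_unique)

lemma vconv_carrier: "vconv s l \<Longrightarrow> s k \<in> carrier_vec n \<Longrightarrow> l \<in> carrier_vec n"
  by (metis carrier_vecD carrier_vecI vconv_def)

lemma vconv_subseq: "vconv s l \<Longrightarrow> strict_mono \<rho> \<Longrightarrow> vconv (\<lambda>k. s (\<rho> k)) l"
  by (auto simp: vconv_iff_index intro: LIMSEQ_subseq_LIMSEQ[unfolded o_def])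

lemma vconv_const: "vconv (\<lambda>_. x) x"
  by (simp add: vconv_iff_index)

lemma vconv_diff: "vconv s x \<Longrightarrow> vconv t y \<Longrightarrow> dim_vec x = dim_vec y \<Longrightarrow> vconv (\<lambda>k. s k - t k) (x - y)"
  by (auto simp: vconv_iff_index intro!: tendsto_diff)

lemma vconv_add: "vconv s x \<Longrightarrow> vconv t y \<Longrightarrow> dim_vec x = dim_vec y \<Longrightarrow> vconv (\<lambda>k. s k + t k) (x + y)"
  by (auto simp: vconv_iff_index intro!: tendsto_add)

lemma vconv_smult: "vconv s x \<Longrightarrow> vconv (\<lambda>k. a \<cdot>\<^sub>v s k) (a \<cdot>\<^sub>v x)"
  by (auto simp: vconv_iff_index intro!: tendsto_mult)

lemma vconv_mult_mat_vec:
  "A \<in> carrier_mat n l \<Longrightarrow> vconv s x \<Longrightarrow> x \<in> carrier_vec l \<Longrightarrow> vconv (\<lambda>k. A *\<^sub>v s k) (A *\<^sub>v x)"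
  by (auto simp: vconv_iff_index scalar_prod_lessThan intro!: tendsto_sum tendsto_mult)

lemma tendsto_scalar_prod: "vconv s x \<Longrightarrow> vconv t y \<Longrightarrow> dim_vec x = dim_vec y \<Longrightarrow> (\<lambda>k. s k \<bullet> t k) \<longlonglongrightarrow> x \<bullet> y"
  by (auto simp: vconv_iff_index scalar_prod_lessThan intro!: tendsto_sum tendsto_mult)

lemma tendsto_vnorm: "vconv s x \<Longrightarrow> (\<lambda>k. vnorm (s k)) \<longlonglongrightarrow> vnorm x"
  unfolding vnorm_def by (intro tendsto_real_sqrt tendsto_scalar_prod) auto

lemma vconv_zero_iff:
  assumes "\<And>k. s k \<in> carrier_vec n"
  shows "vconv s (0\<^sub>v n) \<longleftrightarrow> (\<lambda>k. vnorm (s k)) \<longlonglongrightarrow> 0"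
proof -
  have "s k - 0\<^sub>v n = s k" for k using assms[of k] by auto
  then show ?thesis using assms by (auto simp: vconv_def)
qed

lemma vconv_appendD:
  assumes lim: "vconv (\<lambda>k. s k @\<^sub>v t k) (x @\<^sub>v y)" and dim: "\<And>k. dim_vec (s k) = dim_vec x"
  shows "vconv s x" "vconv t y"
proof -
  have dims: "dim_vec (s k @\<^sub>v t k) = dim_vec (x @\<^sub>v y)" for k
    using lim by (simp only: vconv_iff_index)
  have index: "(\<lambda>k. (s k @\<^sub>v t k) $ c) \<longlonglongrightarrow> (x @\<^sub>v y) $ c" if "c < dim_vec x + dim_vec y" for c
    using that by (intro vconv_index[OF lim]) simp
  show "vconv s x" unfolding vconv_iff_index
  proof (intro conjI allI impI)
    fix c assume "c < dim_vec x"
    then show "(\<lambda>k. s k $ c) \<longlonglongrightarrow> x $ c" using index[of c] dim dims by simp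
  qed (rule dim)
  show "vconv t y" unfolding vconv_iff_index
  proof (intro conjI allI impI)
    show "dim_vec (t k) = dim_vec y" for k using dims[of k] dim[of k] by simp
    fix c assume "c < dim_vec y"
    then show "(\<lambda>k. t k $ c) \<longlonglongrightarrow> y $ c" using index[of "dim_vec x + c"] dim dims by simp
  qed
qed

lemma vclosedD: "vclosed d S \<Longrightarrow> vconv s l \<Longrightarrow> (\<And>k. s k \<in> S) \<Longrightarrow> l \<in> S"
  unfolding vclosed_def by blast

lemma vclosed_carrier: "vclosed d S \<Longrightarrow> x \<in> S \<Longrightarrow> x \<in> carrier_vec d"
  by (auto simp: vclosed_def)

lemma bounded_vec_convergent_subseq:
  fixes s :: "nat \<Rightarrow> real vec"
  assumes carrier: "\<And>k. s k \<in> carrier_vec d" and bounded: "\<And>k. vnorm (s k) \<le> B"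
  obtains \<rho> l where "strict_mono \<rho>" "l \<in> carrier_vec d" "vconv (\<lambda>k. s (\<rho> k)) l"
proof -
  have "bounded ((\<lambda>x. x c) ` range (\<lambda>k. ($) (s k)))" if "c < d" for c
  proof (rule boundedI)
    fix a assume "a \<in> (\<lambda>x. x c) ` range (\<lambda>k. ($) (s k))"
    then obtain k where "a = s k $ c" by auto
    then show "norm a \<le> B"
      using that carrier[of k] order_trans[OF abs_index_le_vnorm bounded, of c k] by simp
  qed
  then have "\<exists>l \<rho>. strict_mono \<rho> \<and> (\<forall>e>0. \<forall>\<^sub>F k in sequentially. \<forall>c\<in>{..<d}. dist (s (\<rho> k) $ c) (l c) < e)"
    using compact_lemma_general[where basis = "{..<d}" and proj = "\<lambda>x c. x c" and f = "\<lambda>k. ($) (s k)" and unproj = "\<lambda>x. x"]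
    by auto
  then obtain l \<rho> where \<rho>: "strict_mono \<rho>"
    and lim: "\<And>e. e > 0 \<Longrightarrow> \<forall>\<^sub>F k in sequentially. \<forall>c\<in>{..<d}. dist (s (\<rho> k) $ c) (l c) < e" by blast
  have "(\<lambda>k. s (\<rho> k) $ c) \<longlonglongrightarrow> l c" if "c < d" for c
    by (rule tendstoI, rule eventually_mono[OF lim]) (use that in auto)
  then have "vconv (\<lambda>k. s (\<rho> k)) (vec d l)" using carrier by (auto simp: vconv_iff_index)
  then show ?thesis using that[OF \<rho> vec_carrier] by blast
qed

section \<open>Lower semicontinuity and convexity\<close>

definition liminf_ge :: "(nat \<Rightarrow> real) \<Rightarrow> real \<Rightarrow> bool" where
  "liminf_ge u a \<longleftrightarrow> ereal a \<le> liminf (\<lambda>k. ereal (u k))"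

lemma liminf_ge_iff: "liminf_ge u a \<longleftrightarrow> (\<forall>y<a. \<forall>\<^sub>F k in sequentially. y < u k)"
proof
  assume "liminf_ge u a"
  then have "\<forall>\<^sub>F k in sequentially. ereal y < ereal (u k)" if "y < a" for y
    using that unfolding liminf_ge_def le_Liminf_iff by (metis ereal_less_eq(3) not_le)
  then show "\<forall>y<a. \<forall>\<^sub>F k in sequentially. y < u k" by simp
next
  assume ev: "\<forall>y<a. \<forall>\<^sub>F k in sequentially. y < u k"
  have "\<forall>\<^sub>F k in sequentially. y < ereal (u k)" if "y < ereal a" for y
    using that ev by (cases y) auto
  then show "liminf_ge u a" unfolding liminf_ge_def le_Liminf_iff by blast
qed

lemma liminf_ge_if_tendsto: "u \<longlonglongrightarrow> a \<Longrightarrow> liminf_ge u a"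
  by (simp add: liminf_ge_iff order_tendstoD(1))

lemma liminf_ge_add:
  assumes "liminf_ge u a" "liminf_ge v b"
  shows "liminf_ge (\<lambda>k. u k + v k) (a + b)"
  unfolding liminf_ge_iff
proof (intro allI impI)
  fix y assume "y < a + b"
  define e where "e = (a + b - y) / 2"
  have "e > 0" using \<open>y < a + b\<close> by (simp add: e_def)
  then have "\<forall>\<^sub>F k in sequentially. a - e < u k" "\<forall>\<^sub>F k in sequentially. b - e < v k"
    using assms by (auto simp: liminf_ge_iff)
  then show "\<forall>\<^sub>F k in sequentially. y < u k + v k"
    by eventually_elim (simp add: e_def field_simps)
qed

lemma liminf_ge_cmult:
  assumes "liminf_ge u a" "0 \<le> c"
  shows "liminf_ge (\<lambda>k. c * u k) (c * a)"
proof (cases "c = 0")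
  case False
  then have "0 < c" using \<open>0 \<le> c\<close> by simp
  show ?thesis unfolding liminf_ge_iff
  proof (intro allI impI)
    fix y assume "y < c * a"
    then have "y / c < a" using \<open>0 < c\<close> by (simp add: pos_divide_less_eq mult.commute)
    then have "\<forall>\<^sub>F k in sequentially. y / c < u k" using assms(1) by (simp add: liminf_ge_iff)
    then show "\<forall>\<^sub>F k in sequentially. y < c * u k"
      by eventually_elim (use \<open>0 < c\<close> in \<open>simp add: pos_divide_less_eq mult.commute\<close>)
  qed
qed (simp add: liminf_ge_if_tendsto)

lemma liminf_ge_mono: "liminf_ge u a \<Longrightarrow> (\<And>k. u k \<le> v k) \<Longrightarrow> liminf_ge v a"
  unfolding liminf_ge_iff by (meson eventually_mono less_le_trans)

lemma le_if_liminf_ge: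
  assumes "liminf_ge u a" "\<And>k. u k \<le> v k" "v \<longlonglongrightarrow> b"
  shows "a \<le> b"
proof -
  have "ereal a \<le> liminf (\<lambda>k. ereal (v k))"
    using liminf_ge_mono[OF assms(1,2)] by (simp add: liminf_ge_def)
  also have "\<dots> = ereal b"
    using assms(3) by (intro lim_imp_Liminf) auto
  finally show ?thesis by simp
qed

lemma tendsto_if_liminf_ge: "liminf_ge u a \<Longrightarrow> (\<And>k. u k \<le> a) \<Longrightarrow> u \<longlonglongrightarrow> a"
  by (rule order_tendstoI) (auto simp: liminf_ge_iff intro!: always_eventually intro: le_less_trans)

lemma vlscD:
  assumes "vlsc d f" "\<And>k. s k \<in> carrier_vec d" "vconv s x"
  shows "liminf_ge (\<lambda>k. f (s k)) (f x)"
  using assms vconv_carrier[OF assms(3) assms(2)] by (simp add: vlsc_def liminf_ge_def)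

lemma vlscI:
  assumes "\<And>s x. (\<And>k. s k \<in> carrier_vec d) \<Longrightarrow> x \<in> carrier_vec d \<Longrightarrow> vconv s x \<Longrightarrow> liminf_ge (\<lambda>k. f (s k)) (f x)"
  shows "vlsc d f"
  using assms by (simp add: vlsc_def liminf_ge_def)

lemma lsc_attains_min:
  assumes nonempty: "B \<noteq> {}" and closed: "vclosed d B" and bounded: "\<And>x. x \<in> B \<Longrightarrow> vnorm x \<le> R"
    and lsc: "\<And>s x. (\<And>k. s k \<in> B) \<Longrightarrow> x \<in> B \<Longrightarrow> vconv s x \<Longrightarrow> liminf_ge (\<lambda>k. \<psi> (s k)) (\<psi> x)"
  obtains x where "x \<in> B" "\<And>y. y \<in> B \<Longrightarrow> \<psi> x \<le> \<psi> y"
proof -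
  define I where "I = (INF x\<in>B. ereal (\<psi> x))"
  obtain u where "decseq u" "range u \<subseteq> (\<lambda>x. ereal (\<psi> x)) ` B" "I = (INF k. u k)"
    using Inf_countable_INF[of "(\<lambda>x. ereal (\<psi> x)) ` B"] nonempty by (auto simp: I_def)
  then have u: "\<And>k. u k \<in> (\<lambda>x. ereal (\<psi> x)) ` B" "u \<longlonglongrightarrow> I"
    using LIMSEQ_INF[of u] by auto
  then obtain s where s: "\<And>k. s k \<in> B" "\<And>k. u k = ereal (\<psi> (s k))" by (auto simp: image_iff) metis
  have "s k \<in> carrier_vec d" "vnorm (s k) \<le> R" for k
    using s(1) bounded vclosed_carrier[OF closed] by auto
  then obtain \<rho> x where \<rho>: "strict_mono \<rho>" "vconv (\<lambda>k. s (\<rho> k)) x"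
    by (rule bounded_vec_convergent_subseq)
  have x: "x \<in> B" using closed \<rho>(2) s(1) by (rule vclosedD)
  have "(\<lambda>k. ereal (\<psi> (s (\<rho> k)))) \<longlonglongrightarrow> I"
    using LIMSEQ_subseq_LIMSEQ[OF u(2) \<rho>(1)] by (simp add: o_def s(2))
  then have min: "ereal (\<psi> x) \<le> I"
    using lsc[OF s(1) x \<rho>(2)] lim_imp_Liminf[of sequentially] by (metis liminf_ge_def sequentially_bot)
  show ?thesis
  proof (rule that[OF x])
    fix y assume "y \<in> B"
    then have "I \<le> ereal (\<psi> y)" unfolding I_def by (rule INF_lower)
    with min have "ereal (\<psi> x) \<le> ereal (\<psi> y)" by (rule order_trans)
    then show "\<psi> x \<le> \<psi> y" by simp
  qed
qed

lemma vconvex_setD: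
  "vconvex_set d S \<Longrightarrow> x \<in> S \<Longrightarrow> y \<in> S \<Longrightarrow> 0 \<le> t \<Longrightarrow> t \<le> 1 \<Longrightarrow> t \<cdot>\<^sub>v x + (1 - t) \<cdot>\<^sub>v y \<in> S"
  by (simp add: vconvex_set_def)

lemma vconvex_funD:
  "vconvex_fun d f \<Longrightarrow> x \<in> carrier_vec d \<Longrightarrow> y \<in> carrier_vec d \<Longrightarrow> 0 \<le> t \<Longrightarrow> t \<le> 1 \<Longrightarrow>
    f (t \<cdot>\<^sub>v x + (1 - t) \<cdot>\<^sub>v y) \<le> t * f x + (1 - t) * f y"
  by (simp add: vconvex_fun_def)

lemma convex_comb_diff_vec:
  fixes x y z :: "real vec"
  assumes "dim_vec x = dim_vec z" "dim_vec y = dim_vec z"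
  shows "t \<cdot>\<^sub>v x + (1 - t) \<cdot>\<^sub>v y - z = t \<cdot>\<^sub>v (x - z) + (1 - t) \<cdot>\<^sub>v (y - z)"
  using assms by (auto simp: vec_eq_iff algebra_simps)

lemma convex_comb_diff_end_vec:
  fixes x y :: "real vec"
  shows "dim_vec x = dim_vec y \<Longrightarrow> t \<cdot>\<^sub>v x + (1 - t) \<cdot>\<^sub>v y - y = t \<cdot>\<^sub>v (x - y)"
  by (auto simp: vec_eq_iff algebra_simps)

lemma proper_closed_convex_cong:
  "proper_closed_convex d f \<Longrightarrow> (\<And>x. x \<in> carrier_vec d \<Longrightarrow> g x = f x) \<Longrightarrow> proper_closed_convex d g"
  by (simp add: proper_closed_convex_def vconvex_fun_def vlsc_def)

lemma proper_closed_convex_const: "proper_closed_convex d (\<lambda>_. c)"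
  by (auto simp: proper_closed_convex_def vconvex_fun_def algebra_simps
      intro!: vlscI liminf_ge_if_tendsto)

lemma proper_closed_convex_add:
  assumes "proper_closed_convex d f" "proper_closed_convex d h"
  shows "proper_closed_convex d (\<lambda>x. f x + h x)"
  unfolding proper_closed_convex_def
proof
  have convex: "vconvex_fun d f" "vconvex_fun d h" and lsc: "vlsc d f" "vlsc d h"
    using assms by (simp_all add: proper_closed_convex_def)
  show "vconvex_fun d (\<lambda>x. f x + h x)"
    unfolding vconvex_fun_def
  proof (intro ballI allI impI)
    fix x y :: "real vec" and t :: real
    assume "x \<in> carrier_vec d" "y \<in> carrier_vec d" "0 \<le> t \<and> t \<le> 1"
    then show "f (t \<cdot>\<^sub>v x + (1 - t) \<cdot>\<^sub>v y) + h (t \<cdot>\<^sub>v x + (1 - t) \<cdot>\<^sub>v y) \<le> t * (f x + h x) + (1 - t) * (f y + h y)"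
      using convex[THEN vconvex_funD, of x y t] by (simp add: algebra_simps)
  qed
  show "vlsc d (\<lambda>x. f x + h x)"
    by (intro vlscI liminf_ge_add vlscD[OF lsc(1)] vlscD[OF lsc(2)])
qed

lemma proper_closed_convex_sum:
  "(\<And>i. i \<in> I \<Longrightarrow> proper_closed_convex d (h i)) \<Longrightarrow> proper_closed_convex d (\<lambda>x. \<Sum>i\<in>I. h i x)"
  by (induction I rule: infinite_finite_induct) (auto intro: proper_closed_convex_const proper_closed_convex_add)

lemma proper_closed_convex_cmult:
  assumes "proper_closed_convex d h" "0 \<le> c"
  shows "proper_closed_convex d (\<lambda>x. c * h x)"
  unfolding proper_closed_convex_def
proof
  have convex: "vconvex_fun d h" and lsc: "vlsc d h"
    using assms(1) by (simp_all add: proper_closed_convex_def)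
  show "vconvex_fun d (\<lambda>x. c * h x)"
    unfolding vconvex_fun_def
  proof (intro ballI allI impI)
    fix x y :: "real vec" and t :: real
    assume "x \<in> carrier_vec d" "y \<in> carrier_vec d" "0 \<le> t \<and> t \<le> 1"
    then have "c * h (t \<cdot>\<^sub>v x + (1 - t) \<cdot>\<^sub>v y) \<le> c * (t * h x + (1 - t) * h y)"
      using vconvex_funD[OF convex] \<open>0 \<le> c\<close> by (intro mult_left_mono) auto
    then show "c * h (t \<cdot>\<^sub>v x + (1 - t) \<cdot>\<^sub>v y) \<le> t * (c * h x) + (1 - t) * (c * h y)"
      by (simp add: algebra_simps)
  qed
  show "vlsc d (\<lambda>x. c * h x)"
    by (intro vlscI liminf_ge_cmult vlscD[OF lsc] assms(2))
qed

lemma proper_closed_convex_affine: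
  assumes "a \<in> carrier_vec d"
  shows "proper_closed_convex d (\<lambda>x. a \<bullet> x + \<mu>)"
  unfolding proper_closed_convex_def
proof
  show "vconvex_fun d (\<lambda>x. a \<bullet> x + \<mu>)"
    using assms by (auto simp: vconvex_fun_def scalar_prod_distribs algebra_simps)
  show "vlsc d (\<lambda>x. a \<bullet> x + \<mu>)"
    using assms by (intro vlscI liminf_ge_if_tendsto tendsto_intros tendsto_scalar_prod vconv_const) auto
qed

lemma le_if_le_add_quadratic:
  fixes a b c :: real
  assumes "\<And>t. 0 < t \<Longrightarrow> t \<le> 1 \<Longrightarrow> t * a \<le> t * b + t\<^sup>2 * c"
  shows "a \<le> b"
proof (rule tendsto_lowerbound)
  show "((\<lambda>t. b + t * c) \<longlongrightarrow> b) (at_right 0)" by (auto intro!: tendsto_eq_intros)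
  have "a \<le> b + t * c" if "0 < t" "t < 1" for t
  proof -
    have "t * a \<le> t * (b + t * c)" using assms[of t] that by (simp add: power2_eq_square algebra_simps)
    then show ?thesis using that by simp
  qed
  then show "\<forall>\<^sub>F t in at_right 0. a \<le> b + t * c"
    by (auto simp: eventually_at_right_less eventually_at_right[of 0 1] intro!: exI[of _ 1])
qed simp

section \<open>The constraint cone and its polar\<close>

lemma dim_projK [simp]: "dim_vec (projK p q u) = p + q"
  by (simp add: projK_def)

lemma projK_carrier [simp]: "projK p q u \<in> carrier_vec (p + q)"
  by (simp add: projK_def)

lemma projK_Kpol [simp]: "projK p q u \<in> Kpol p q"
  by (auto simp: projK_def Kpol_def)

lemma Kpol_carrier: "y \<in> Kpol p q \<Longrightarrow> y \<in> carrier_vec (p + q)"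
  by (simp add: Kpol_def)

lemma dim_Kpol: "y \<in> Kpol p q \<Longrightarrow> dim_vec y = p + q"
  by (auto simp: Kpol_def)

lemma zero_Kpol: "0\<^sub>v (p + q) \<in> Kpol p q"
  by (simp add: Kpol_def)

lemma Kpol_add: "y \<in> Kpol p q \<Longrightarrow> w \<in> Kpol p q \<Longrightarrow> y + w \<in> Kpol p q"
  by (auto simp: Kpol_def)

lemma Kpol_smult: "y \<in> Kpol p q \<Longrightarrow> 0 \<le> a \<Longrightarrow> a \<cdot>\<^sub>v y \<in> Kpol p q"
  by (auto simp: Kpol_def)

lemma vclosed_Kpol: "vclosed (p + q) (Kpol p q)"
  unfolding vclosed_def
proof (intro conjI allI impI)
  show "Kpol p q \<subseteq> carrier_vec (p + q)" by (auto simp: Kpol_def)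
  fix s l assume s: "\<forall>k. s k \<in> Kpol p q" and lim: "vconv s l"
  have l: "l \<in> carrier_vec (p + q)" using vconv_carrier[OF lim Kpol_carrier] s by blast
  have "0 \<le> l $ c" if "p \<le> c" "c < p + q" for c
  proof (rule LIMSEQ_le_const[OF vconv_index[OF lim]])
    show "\<exists>N. \<forall>n\<ge>N. 0 \<le> s n $ c" using s that by (auto simp: Kpol_def)
  qed (use that l in simp)
  then show "l \<in> Kpol p q" using l by (simp add: Kpol_def)
qed

lemma Kpol_Kcone_nonpos: "y \<in> Kpol p q \<Longrightarrow> u \<in> Kcone p q \<Longrightarrow> y \<bullet> u \<le> 0"
  unfolding scalar_prod_lessThan
proof (intro sum_nonpos)
  fix c assume "y \<in> Kpol p q" "u \<in> Kcone p q" "c \<in> {..<dim_vec u}"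
  then show "y $ c * u $ c \<le> 0"
    by (cases "c < p") (auto simp: Kpol_def Kcone_def not_less mult_nonneg_nonpos)
qed

lemma Kpol_scalar_prod_mono:
  assumes "y \<in> Kpol p q" "u - v \<in> Kcone p q" "dim_vec u = dim_vec v"
  shows "y \<bullet> u \<le> y \<bullet> v"
  using Kpol_Kcone_nonpos[OF assms(1,2)] assms(3) by (simp add: scalar_prod_diff_right)

lemma Kcone_if_polar:
  assumes u: "u \<in> carrier_vec (p + q)" and polar: "\<And>w. w \<in> Kpol p q \<Longrightarrow> w \<bullet> u \<le> 0"
  shows "u \<in> Kcone p q"
proof -
  have unit: "(a \<cdot>\<^sub>v unit_vec (p + q) c) \<bullet> u = a * u $ c" if "c < p + q" for a c
    using that u by simp
  have "u $ c \<le> 0" if "c < p + q" for c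
    using polar[of "1 \<cdot>\<^sub>v unit_vec (p + q) c"] unit[OF that, of 1] that by (auto simp: Kpol_def unit_vec_def)
  moreover have "0 \<le> u $ c" if "c < p" for c
    using polar[of "(- 1) \<cdot>\<^sub>v unit_vec (p + q) c"] unit[of c "- 1"] that by (auto simp: Kpol_def)
  ultimately show ?thesis using u by (auto simp: Kcone_def intro: antisym)
qed

lemma Kpol_variational_iff:
  assumes y: "y \<in> Kpol p q" and u: "u \<in> carrier_vec (p + q)"
  shows "(\<forall>w\<in>Kpol p q. (w - y) \<bullet> u \<le> 0) \<longleftrightarrow> u \<in> Kcone p q \<and> y \<bullet> u = 0"
proof
  assume var: "\<forall>w\<in>Kpol p q. (w - y) \<bullet> u \<le> 0"
  have "u \<in> Kcone p q"
  proof (rule Kcone_if_polar[OF u])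
    fix w assume w: "w \<in> Kpol p q"
    have "(y + w - y) \<bullet> u \<le> 0" using var Kpol_add[OF y w] by blast
    then show "w \<bullet> u \<le> 0" using u dim_Kpol[OF y] dim_Kpol[OF w] by (simp add: scalar_prod_distribs)
  qed
  moreover have "0 \<le> y \<bullet> u"
    using bspec[OF var zero_Kpol] scalar_prod_left_zero[OF u] u dim_Kpol[OF y] by (simp add: scalar_prod_diff_left)
  ultimately show "u \<in> Kcone p q \<and> y \<bullet> u = 0" using Kpol_Kcone_nonpos[OF y] by (auto intro: antisym)
next
  assume "u \<in> Kcone p q \<and> y \<bullet> u = 0"
  then show "\<forall>w\<in>Kpol p q. (w - y) \<bullet> u \<le> 0"
    using Kpol_Kcone_nonpos u dim_Kpol[OF y] by (auto simp: scalar_prod_diff_left)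
qed

lemma projK_Kcone: "u \<in> Kcone p q \<Longrightarrow> projK p q u = 0\<^sub>v (p + q)"
  by (auto simp: projK_def Kcone_def)

lemma Kcone_smult: "u \<in> Kcone p q \<Longrightarrow> 0 \<le> a \<Longrightarrow> a \<cdot>\<^sub>v u \<in> Kcone p q"
  by (auto simp: Kcone_def mult_nonneg_nonpos)

lemma projK_smult: "u \<in> carrier_vec (p + q) \<Longrightarrow> 0 \<le> a \<Longrightarrow> projK p q (a \<cdot>\<^sub>v u) = a \<cdot>\<^sub>v projK p q u"
  by (auto simp: projK_def max_def mult_le_0_iff zero_le_mult_iff)

lemma projK_scalar_prod_self:
  assumes "u \<in> carrier_vec (p + q)"
  shows "projK p q u \<bullet> u = projK p q u \<bullet> projK p q u"
  using assms by (auto simp: scalar_prod_lessThan projK_def max_def intro!: sum.cong)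

lemma Kpol_scalar_prod_le_projK:
  assumes "w \<in> Kpol p q" "u \<in> carrier_vec (p + q)"
  shows "w \<bullet> u \<le> w \<bullet> projK p q u"
proof -
  have "w $ c * u $ c \<le> w $ c * projK p q u $ c" if "c < p + q" for c
    using assms that by (cases "c < p") (auto simp: projK_def Kpol_def intro: mult_left_mono)
  then show ?thesis using assms by (auto simp: scalar_prod_lessThan intro: sum_mono)
qed

lemma projK_variational:
  assumes "u \<in> carrier_vec (p + q)" "y \<in> Kpol p q"
  shows "(y - projK p q u) \<bullet> (u - projK p q u) \<le> 0"
  using Kpol_scalar_prod_le_projK[OF assms(2,1)] projK_scalar_prod_self[OF assms(1)] dim_Kpol[OF assms(2)] assms(1)
  by (simp add: scalar_prod_distribs)

lemma scalar_prod_le_half_squares: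
  fixes x y :: "real vec"
  assumes "dim_vec x = dim_vec y"
  shows "2 * (x \<bullet> y) \<le> x \<bullet> x + y \<bullet> y"
  using scalar_prod_self_nonneg[of "x - y"] assms
  by (simp add: scalar_prod_distribs scalar_prod_commute[of y x])

lemma projK_sq_ge:
  assumes "w \<in> Kpol p q" "u \<in> carrier_vec (p + q)"
  shows "2 * (w \<bullet> u) - w \<bullet> w \<le> projK p q u \<bullet> projK p q u"
  using Kpol_scalar_prod_le_projK[OF assms] scalar_prod_le_half_squares[of w "projK p q u"] dim_Kpol[OF assms(1)]
  by simp

lemma projK_sq_mono:
  assumes u: "u \<in> carrier_vec (p + q)" and v: "v \<in> carrier_vec (p + q)" and le: "u - v \<in> Kcone p q"
  shows "projK p q u \<bullet> projK p q u \<le> projK p q v \<bullet> projK p q v"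
proof -
  have "projK p q u \<bullet> u \<le> projK p q u \<bullet> v"
    using u v by (intro Kpol_scalar_prod_mono[OF projK_Kpol le]) simp
  then have "projK p q u \<bullet> projK p q u \<le> 2 * (projK p q u \<bullet> v) - projK p q u \<bullet> projK p q u"
    using projK_scalar_prod_self[OF u] by simp
  also have "\<dots> \<le> projK p q v \<bullet> projK p q v" using v by (intro projK_sq_ge) auto
  finally show ?thesis .
qed

lemma projK_add_sq_le:
  assumes u: "u \<in> carrier_vec (p + q)" and e: "e \<in> carrier_vec (p + q)"
  shows "projK p q (u + e) \<bullet> projK p q (u + e)
    \<le> projK p q u \<bullet> projK p q u + 2 * (projK p q u \<bullet> e) + e \<bullet> e"
proof -
  define w where "w = projK p q (u + e)"
  have w: "w \<in> Kpol p q" "dim_vec w = p + q" by (simp_all add: w_def)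
  have "w \<bullet> w = w \<bullet> u + w \<bullet> e"
    using projK_scalar_prod_self[of "u + e" p q] u e by (simp add: w_def scalar_prod_add_right)
  also have "\<dots> \<le> w \<bullet> (projK p q u + e)"
    using Kpol_scalar_prod_le_projK[OF w(1) u] e by (simp add: scalar_prod_add_right)
  finally have "w \<bullet> w \<le> (projK p q u + e) \<bullet> (projK p q u + e)"
    using scalar_prod_le_half_squares[of w "projK p q u + e"] w e by simp
  then show ?thesis
    using e by (simp add: w_def scalar_prod_distribs scalar_prod_commute[of e "projK p q u"])
qed

lemma Kpol_index_eq_0_if_nonneg:
  assumes w: "w \<in> Kpol p q" and u: "u \<in> carrier_vec (p + q)" and nonneg: "0 \<le> w \<bullet> u"
    and eq: "\<And>c. c < p \<Longrightarrow> u $ c = 0" and neg: "\<And>c. p \<le> c \<Longrightarrow> c < p + q \<Longrightarrow> u $ c < 0"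
    and c: "p \<le> c" "c < p + q"
  shows "w $ c = 0"
proof -
  have "0 \<le> - (w $ j * u $ j)" if "j < p + q" for j
    using w eq[of j] neg[of j] that by (cases "j < p") (auto simp: Kpol_def mult_nonneg_nonpos less_imp_le)
  moreover have "(\<Sum>j<p + q. - (w $ j * u $ j)) \<le> 0"
    using nonneg u by (simp add: scalar_prod_lessThan sum_negf)
  ultimately have "(\<Sum>j<p + q. - (w $ j * u $ j)) = 0" and "\<forall>j\<in>{..<p + q}. 0 \<le> - (w $ j * u $ j)"
    by (auto intro!: antisym sum_nonneg)
  then have "\<forall>j\<in>{..<p + q}. - (w $ j * u $ j) = 0"
    by (subst (asm) sum_nonneg_eq_0_iff) auto
  then show ?thesis using neg[OF c] c by fastforce
qed

section \<open>Maps convex with respect to the cone\<close>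

definition K_convex :: "nat \<Rightarrow> nat \<Rightarrow> nat \<Rightarrow> (real vec \<Rightarrow> real vec) \<Rightarrow> bool" where
  "K_convex p q d G \<longleftrightarrow> (\<forall>x\<in>carrier_vec d. G x \<in> carrier_vec (p + q)) \<and>
     (\<forall>w\<in>Kpol p q. proper_closed_convex d (\<lambda>x. w \<bullet> G x))"

lemma K_convex_carrier: "K_convex p q d G \<Longrightarrow> x \<in> carrier_vec d \<Longrightarrow> G x \<in> carrier_vec (p + q)"
  by (simp add: K_convex_def)

lemma K_convex_vconvex_fun: "K_convex p q d G \<Longrightarrow> w \<in> Kpol p q \<Longrightarrow> vconvex_fun d (\<lambda>x. w \<bullet> G x)"
  by (simp add: K_convex_def proper_closed_convex_def)

lemma K_convex_liminf_ge:
  assumes "K_convex p q d G" "w \<in> Kpol p q" "\<And>k. s k \<in> carrier_vec d" "vconv s x"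
  shows "liminf_ge (\<lambda>k. w \<bullet> G (s k)) (w \<bullet> G x)"
  using assms by (intro vlscD[of d]) (simp_all add: K_convex_def proper_closed_convex_def)

lemma K_convex_comb_Kcone:
  assumes G: "K_convex p q d G" and x: "x \<in> carrier_vec d" "x' \<in> carrier_vec d" and t: "0 \<le> t" "t \<le> 1"
  shows "G (t \<cdot>\<^sub>v x + (1 - t) \<cdot>\<^sub>v x') - (t \<cdot>\<^sub>v G x + (1 - t) \<cdot>\<^sub>v G x') \<in> Kcone p q"
proof (rule Kcone_if_polar)
  have dims: "dim_vec (G x) = p + q" "dim_vec (G x') = p + q"
    using K_convex_carrier[OF G] x by auto
  show "G (t \<cdot>\<^sub>v x + (1 - t) \<cdot>\<^sub>v x') - (t \<cdot>\<^sub>v G x + (1 - t) \<cdot>\<^sub>v G x') \<in> carrier_vec (p + q)"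
    using dims by (intro carrier_vecI) simp
  fix w assume w: "w \<in> Kpol p q"
  show "w \<bullet> (G (t \<cdot>\<^sub>v x + (1 - t) \<cdot>\<^sub>v x') - (t \<cdot>\<^sub>v G x + (1 - t) \<cdot>\<^sub>v G x')) \<le> 0"
    using vconvex_funD[OF K_convex_vconvex_fun[OF G w] x t] K_convex_carrier[OF G, of "t \<cdot>\<^sub>v x + (1 - t) \<cdot>\<^sub>v x'"]
      dims dim_Kpol[OF w] x by (simp add: scalar_prod_distribs)
qed

lemma K_convex_affine_append:
  assumes A: "A \<in> carrier_mat p d" and b: "b \<in> carrier_vec p"
    and g: "\<And>x. x \<in> carrier_vec d \<Longrightarrow> g x \<in> carrier_vec q" "\<And>c. c < q \<Longrightarrow> proper_closed_convex d (\<lambda>x. g x $ c)"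
  shows "K_convex p q d (\<lambda>x. (A *\<^sub>v x - b) @\<^sub>v g x)"
  unfolding K_convex_def
proof (intro conjI ballI)
  have Ax: "A *\<^sub>v x - b \<in> carrier_vec p" for x using b by simp
  show "(A *\<^sub>v x - b) @\<^sub>v g x \<in> carrier_vec (p + q)" if "x \<in> carrier_vec d" for x
    using Ax g(1)[OF that] by (rule append_carrier_vec)
  fix w assume w: "w \<in> Kpol p q"
  define w_eq w_le where "w_eq = vec_first w p" and "w_le = vec_last w q"
  have w_split: "w_eq \<in> carrier_vec p" "w_le \<in> carrier_vec q" "w = w_eq @\<^sub>v w_le"
    using w by (auto simp: w_eq_def w_le_def Kpol_def)
  have nonneg: "0 \<le> w_le $ c" if "c < q" for c
    using w that by (auto simp: w_le_def vec_last_def Kpol_def)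
  have "proper_closed_convex d (\<lambda>x. ((A\<^sup>T *\<^sub>v w_eq) \<bullet> x + - (w_eq \<bullet> b)) + (\<Sum>c<q. w_le $ c * g x $ c))"
    using A w_split(1) nonneg
    by (intro proper_closed_convex_add proper_closed_convex_affine proper_closed_convex_sum
        proper_closed_convex_cmult g(2)) auto
  then show "proper_closed_convex d (\<lambda>x. w \<bullet> ((A *\<^sub>v x - b) @\<^sub>v g x))"
  proof (rule proper_closed_convex_cong)
    fix x :: "real vec" assume x: "x \<in> carrier_vec d"
    have "w \<bullet> ((A *\<^sub>v x - b) @\<^sub>v g x) = w_eq \<bullet> (A *\<^sub>v x - b) + w_le \<bullet> g x"
      unfolding w_split(3) by (rule scalar_prod_append[OF w_split(1,2) Ax g(1)[OF x]])
    also have "w_eq \<bullet> (A *\<^sub>v x - b) = (A\<^sup>T *\<^sub>v w_eq) \<bullet> x - w_eq \<bullet> b"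
      using A b by (simp add: scalar_prod_diff_right transpose_vec_mult_scalar[OF A x w_split(1)])
    also have "w_le \<bullet> g x = (\<Sum>c<q. w_le $ c * g x $ c)" using g(1)[OF x] by (simp add: scalar_prod_lessThan)
    finally show "w \<bullet> ((A *\<^sub>v x - b) @\<^sub>v g x) = ((A\<^sup>T *\<^sub>v w_eq) \<bullet> x + - (w_eq \<bullet> b)) + (\<Sum>c<q. w_le $ c * g x $ c)"
      by simp
  qed
qed

definition prox_aug_lagrangian :: "nat \<Rightarrow> nat \<Rightarrow> real \<Rightarrow> real \<Rightarrow> (real vec \<Rightarrow> real) \<Rightarrow> (real vec \<Rightarrow> real vec)
    \<Rightarrow> real vec \<Rightarrow> real vec \<Rightarrow> real vec \<Rightarrow> real" where
  "prox_aug_lagrangian p q \<gamma> \<alpha> f G y x\<^sub>0 x =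
     f x + 1 / (2 * \<gamma>) * (projK p q (y + \<gamma> \<cdot>\<^sub>v G x) \<bullet> projK p q (y + \<gamma> \<cdot>\<^sub>v G x) - y \<bullet> y)
       + 1 / (2 * \<alpha>) * ((x - x\<^sub>0) \<bullet> (x - x\<^sub>0))"

lemma prox_aug_lagrangian_liminf_ge:
  assumes f: "vlsc d f" and G: "K_convex p q d G" and y: "y \<in> carrier_vec (p + q)"
    and x\<^sub>0: "x\<^sub>0 \<in> carrier_vec d" and pos: "0 < \<gamma>"
    and s: "\<And>k. s k \<in> carrier_vec d" "vconv s x"
  shows "liminf_ge (\<lambda>k. prox_aug_lagrangian p q \<gamma> \<alpha> f G y x\<^sub>0 (s k)) (prox_aug_lagrangian p q \<gamma> \<alpha> f G y x\<^sub>0 x)"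
proof -
  define w where "w = projK p q (y + \<gamma> \<cdot>\<^sub>v G x)"
  define P where "P z = projK p q (y + \<gamma> \<cdot>\<^sub>v G z) \<bullet> projK p q (y + \<gamma> \<cdot>\<^sub>v G z)" for z
  define minorant where "minorant z = 2 * (w \<bullet> y) - w \<bullet> w + 2 * \<gamma> * (w \<bullet> G z)" for z
  have x: "x \<in> carrier_vec d" using s(2,1) by (rule vconv_carrier)
  have carrier: "y + \<gamma> \<cdot>\<^sub>v G z \<in> carrier_vec (p + q)" and
    expand: "minorant z = 2 * (w \<bullet> (y + \<gamma> \<cdot>\<^sub>v G z)) - w \<bullet> w" if "z \<in> carrier_vec d" for z
    using K_convex_carrier[OF G that] y by (auto simp: minorant_def w_def scalar_prod_add_right)
  have touch: "minorant x = P x"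
    unfolding expand[OF x] P_def using projK_scalar_prod_self[OF carrier[OF x]] by (simp add: w_def)
  have "liminf_ge (\<lambda>k. minorant (s k)) (minorant x)"
    unfolding minorant_def using pos s
    by (intro liminf_ge_add liminf_ge_if_tendsto[OF tendsto_const] liminf_ge_cmult K_convex_liminf_ge[OF G])
      (auto simp: w_def)
  then have "liminf_ge (\<lambda>k. P (s k)) (P x)"
    unfolding touch
    by (rule liminf_ge_mono) (use expand[OF s(1)] projK_sq_ge[OF _ carrier[OF s(1)]] in \<open>simp add: P_def w_def\<close>)
  then have "liminf_ge (\<lambda>k. 1 / (2 * \<gamma>) * (P (s k) + - (y \<bullet> y))) (1 / (2 * \<gamma>) * (P x + - (y \<bullet> y)))"
    using pos by (intro liminf_ge_cmult liminf_ge_add liminf_ge_if_tendsto[OF tendsto_const]) auto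
  moreover have "(\<lambda>k. 1 / (2 * \<alpha>) * ((s k - x\<^sub>0) \<bullet> (s k - x\<^sub>0))) \<longlonglongrightarrow> 1 / (2 * \<alpha>) * ((x - x\<^sub>0) \<bullet> (x - x\<^sub>0))"
    using x x\<^sub>0 by (intro tendsto_intros tendsto_scalar_prod vconv_diff vconv_const s) auto
  ultimately show ?thesis
    unfolding prox_aug_lagrangian_def
    using vlscD[OF f s] by (auto simp: P_def intro: liminf_ge_add liminf_ge_if_tendsto)
qed

text \<open>The squared projection is monotone along the cone order and has gradient \<open>2 \<P>\<close>, so on a segment it is
  bounded by its first-order expansion along the chord of \<open>G\<close>.\<close>

lemma projK_sq_segment_le:
  assumes G: "K_convex p q d G" and y: "y \<in> carrier_vec (p + q)" and x: "x' \<in> carrier_vec d" "x \<in> carrier_vec d"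
    and \<gamma>: "0 \<le> \<gamma>" and t: "0 \<le> t" "t \<le> 1"
  defines "z \<equiv> t \<cdot>\<^sub>v x + (1 - t) \<cdot>\<^sub>v x'" and "\<Delta> \<equiv> G x - G x'" and "\<pi> \<equiv> \<lambda>x. projK p q (y + \<gamma> \<cdot>\<^sub>v G x)"
  shows "\<pi> z \<bullet> \<pi> z \<le> \<pi> x' \<bullet> \<pi> x' + 2 * t * \<gamma> * (\<pi> x' \<bullet> \<Delta>) + t\<^sup>2 * \<gamma>\<^sup>2 * (\<Delta> \<bullet> \<Delta>)"
proof -
  define u where "u = y + \<gamma> \<cdot>\<^sub>v G x'"
  have z: "z \<in> carrier_vec d" using x by (simp add: z_def)
  note Gc = K_convex_carrier[OF G x(1)] K_convex_carrier[OF G x(2)] K_convex_carrier[OF G z]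
  have \<Delta>: "\<Delta> \<in> carrier_vec (p + q)" and u: "u \<in> carrier_vec (p + q)"
    using Gc y by (auto simp: \<Delta>_def u_def)
  have "(y + \<gamma> \<cdot>\<^sub>v G z) - (u + (t * \<gamma>) \<cdot>\<^sub>v \<Delta>) = \<gamma> \<cdot>\<^sub>v (G z - (t \<cdot>\<^sub>v G x + (1 - t) \<cdot>\<^sub>v G x'))"
    using Gc y by (auto simp: vec_eq_iff u_def \<Delta>_def algebra_simps)
  also have "\<dots> \<in> Kcone p q"
    unfolding z_def using \<gamma> by (intro Kcone_smult K_convex_comb_Kcone[OF G x(2,1) t])
  finally have "\<pi> z \<bullet> \<pi> z \<le> projK p q (u + (t * \<gamma>) \<cdot>\<^sub>v \<Delta>) \<bullet> projK p q (u + (t * \<gamma>) \<cdot>\<^sub>v \<Delta>)"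
    unfolding \<pi>_def using Gc y u \<Delta> by (intro projK_sq_mono) auto
  also have "\<dots> \<le> \<pi> x' \<bullet> \<pi> x' + 2 * t * \<gamma> * (\<pi> x' \<bullet> \<Delta>) + t\<^sup>2 * \<gamma>\<^sup>2 * (\<Delta> \<bullet> \<Delta>)"
    using projK_add_sq_le[OF u, of "(t * \<gamma>) \<cdot>\<^sub>v \<Delta>"] \<Delta>
    by (simp add: \<pi>_def u_def power2_eq_square algebra_simps)
  finally show ?thesis .
qed

lemma prox_aug_lagrangian_segment_le:
  assumes f: "vconvex_fun d f" and G: "K_convex p q d G" and y: "y \<in> carrier_vec (p + q)"
    and x: "x\<^sub>0 \<in> carrier_vec d" "x' \<in> carrier_vec d" "x \<in> carrier_vec d"
    and pos: "0 < \<gamma>" "0 < \<alpha>" and t: "0 \<le> t" "t \<le> 1"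
  defines "\<Delta> \<equiv> G x - G x'"
  shows "prox_aug_lagrangian p q \<gamma> \<alpha> f G y x\<^sub>0 (t \<cdot>\<^sub>v x + (1 - t) \<cdot>\<^sub>v x') \<le>
    prox_aug_lagrangian p q \<gamma> \<alpha> f G y x\<^sub>0 x'
      + t * (f x - f x' + projK p q (y + \<gamma> \<cdot>\<^sub>v G x') \<bullet> \<Delta> + 1 / \<alpha> * ((x' - x\<^sub>0) \<bullet> (x - x')))
      + t\<^sup>2 * (\<gamma> / 2 * (\<Delta> \<bullet> \<Delta>) + 1 / (2 * \<alpha>) * ((x - x') \<bullet> (x - x')))"
proof -
  define z where "z = t \<cdot>\<^sub>v x + (1 - t) \<cdot>\<^sub>v x'"
  define \<pi> where "\<pi> w = projK p q (y + \<gamma> \<cdot>\<^sub>v G w)" for w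
  have "f z \<le> f x' + t * (f x - f x')"
    using vconvex_funD[OF f x(3,2) t] by (simp add: z_def algebra_simps)
  moreover have "(z - x\<^sub>0) \<bullet> (z - x\<^sub>0) =
      (x' - x\<^sub>0) \<bullet> (x' - x\<^sub>0) + 2 * t * ((x' - x\<^sub>0) \<bullet> (x - x')) + t\<^sup>2 * ((x - x') \<bullet> (x - x'))"
  proof -
    have "z - x\<^sub>0 = (x' - x\<^sub>0) + t \<cdot>\<^sub>v (x - x')" using x by (auto simp: z_def algebra_simps)
    then show ?thesis using x
      by (simp add: scalar_prod_add_left scalar_prod_add_right scalar_prod_commute[of "x - x'" "x' - x\<^sub>0"]
          power2_eq_square algebra_simps)
  qed
  moreover have "\<pi> z \<bullet> \<pi> z \<le> \<pi> x' \<bullet> \<pi> x' + 2 * t * \<gamma> * (\<pi> x' \<bullet> \<Delta>) + t\<^sup>2 * \<gamma>\<^sup>2 * (\<Delta> \<bullet> \<Delta>)"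
    unfolding \<pi>_def \<Delta>_def z_def using pos by (intro projK_sq_segment_le[OF G y x(2,3) _ t]) simp
  then have "1 / (2 * \<gamma>) * (\<pi> z \<bullet> \<pi> z - y \<bullet> y) \<le>
      1 / (2 * \<gamma>) * (\<pi> x' \<bullet> \<pi> x' + 2 * t * \<gamma> * (\<pi> x' \<bullet> \<Delta>) + t\<^sup>2 * \<gamma>\<^sup>2 * (\<Delta> \<bullet> \<Delta>) - y \<bullet> y)"
    using pos by (intro mult_left_mono) auto
  moreover have "\<dots> = 1 / (2 * \<gamma>) * (\<pi> x' \<bullet> \<pi> x' - y \<bullet> y) + t * (\<pi> x' \<bullet> \<Delta>) + t\<^sup>2 * (\<gamma> / 2 * (\<Delta> \<bullet> \<Delta>))"
    using pos by (simp add: field_simps power2_eq_square)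
  ultimately show ?thesis
    unfolding prox_aug_lagrangian_def z_def[symmetric] \<pi>_def[symmetric] by (simp add: algebra_simps add_divide_distrib)
qed

lemma prox_aug_lagrangian_stationary:
  assumes \<Omega>: "vconvex_set d \<Omega>" and f: "vconvex_fun d f" and G: "K_convex p q d G"
    and carrier: "y \<in> carrier_vec (p + q)" "x\<^sub>0 \<in> carrier_vec d" "v \<in> carrier_vec d"
    and pos: "0 < \<gamma>" "0 < \<alpha>" and x': "x' \<in> \<Omega>"
    and subgradient: "\<And>x. x \<in> \<Omega> \<Longrightarrow>
      prox_aug_lagrangian p q \<gamma> \<alpha> f G y x\<^sub>0 x' + v \<bullet> (x - x') \<le> prox_aug_lagrangian p q \<gamma> \<alpha> f G y x\<^sub>0 x"
    and x: "x \<in> \<Omega>"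
  defines "y' \<equiv> projK p q (y + \<gamma> \<cdot>\<^sub>v G x')"
  shows "f x' + y' \<bullet> G x' + (v + (1 / \<alpha>) \<cdot>\<^sub>v (x\<^sub>0 - x')) \<bullet> (x - x') \<le> f x + y' \<bullet> G x"
proof -
  have c: "x' \<in> carrier_vec d" "x \<in> carrier_vec d" using \<Omega> x x' by (auto simp: vconvex_set_def)
  define C where "C = \<gamma> / 2 * ((G x - G x') \<bullet> (G x - G x')) + 1 / (2 * \<alpha>) * ((x - x') \<bullet> (x - x'))"
  have "t * (v \<bullet> (x - x'))
      \<le> t * (f x - f x' + y' \<bullet> (G x - G x') + 1 / \<alpha> * ((x' - x\<^sub>0) \<bullet> (x - x'))) + t\<^sup>2 * C" if t: "0 < t" "t \<le> 1" for t
  proof -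
    define z where "z = t \<cdot>\<^sub>v x + (1 - t) \<cdot>\<^sub>v x'"
    have "z \<in> \<Omega>" unfolding z_def using \<Omega> x x' t by (intro vconvex_setD) auto
    moreover have "v \<bullet> (z - x') = t * (v \<bullet> (x - x'))"
      unfolding z_def using c carrier by (subst convex_comb_diff_end_vec) auto
    ultimately show ?thesis
      using subgradient[of z] prox_aug_lagrangian_segment_le[OF f G carrier(1,2) c pos, of t] t
      unfolding z_def[symmetric] C_def y'_def by simp
  qed
  then have "v \<bullet> (x - x') \<le> f x - f x' + y' \<bullet> (G x - G x') + 1 / \<alpha> * ((x' - x\<^sub>0) \<bullet> (x - x'))"
    by (rule le_if_le_add_quadratic)
  moreover have "y' \<bullet> (G x - G x') = y' \<bullet> G x - y' \<bullet> G x'"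
    using K_convex_carrier[OF G c(1)] K_convex_carrier[OF G c(2)] by (simp add: scalar_prod_diff_right)
  moreover have "(v + (1 / \<alpha>) \<cdot>\<^sub>v (x\<^sub>0 - x')) \<bullet> (x - x') = v \<bullet> (x - x') - 1 / \<alpha> * ((x' - x\<^sub>0) \<bullet> (x - x'))"
    using c carrier by (simp add: scalar_prod_distribs algebra_simps)
  ultimately show ?thesis by linarith
qed

section \<open>Lagrange multipliers under Slater's condition\<close>

lemma vconvex_set_Int_ball:
  assumes "vconvex_set d \<Omega>" "x\<^sub>0 \<in> carrier_vec d"
  shows "vconvex_set d {x \<in> \<Omega>. vnorm (x - x\<^sub>0) \<le> R}"
  unfolding vconvex_set_def
proof (intro conjI ballI allI impI)
  show "{x \<in> \<Omega>. vnorm (x - x\<^sub>0) \<le> R} \<subseteq> carrier_vec d" using assms by (auto simp: vconvex_set_def)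
  fix x y and t :: real
  assume xy: "x \<in> {x \<in> \<Omega>. vnorm (x - x\<^sub>0) \<le> R}" "y \<in> {x \<in> \<Omega>. vnorm (x - x\<^sub>0) \<le> R}" and t: "0 \<le> t \<and> t \<le> 1"
  have dims: "dim_vec x = dim_vec x\<^sub>0" "dim_vec y = dim_vec x\<^sub>0" using xy assms by (auto simp: vconvex_set_def)
  have "vnorm (t \<cdot>\<^sub>v x + (1 - t) \<cdot>\<^sub>v y - x\<^sub>0) \<le> t * vnorm (x - x\<^sub>0) + (1 - t) * vnorm (y - x\<^sub>0)"
    unfolding convex_comb_diff_vec[OF dims]
    using vnorm_triangle_ineq[of "t \<cdot>\<^sub>v (x - x\<^sub>0)" "(1 - t) \<cdot>\<^sub>v (y - x\<^sub>0)"] t by (simp add: vnorm_smult)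
  also have "\<dots> \<le> t * R + (1 - t) * R" using xy t by (intro add_mono mult_left_mono) auto
  finally show "t \<cdot>\<^sub>v x + (1 - t) \<cdot>\<^sub>v y \<in> {x \<in> \<Omega>. vnorm (x - x\<^sub>0) \<le> R}"
    using assms xy t by (auto simp: algebra_simps intro: vconvex_setD)
qed

lemma vclosed_Int_ball:
  assumes "vclosed d \<Omega>" "x\<^sub>0 \<in> carrier_vec d"
  shows "vclosed d {x \<in> \<Omega>. vnorm (x - x\<^sub>0) \<le> R}"
  unfolding vclosed_def
proof (intro conjI allI impI)
  show "{x \<in> \<Omega>. vnorm (x - x\<^sub>0) \<le> R} \<subseteq> carrier_vec d" using assms by (auto simp: vclosed_def)
  fix s l assume s: "\<forall>k. s k \<in> {x \<in> \<Omega>. vnorm (x - x\<^sub>0) \<le> R}" and lim: "vconv s l"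
  have l: "l \<in> \<Omega>" using vclosedD[OF assms(1) lim] s by blast
  have "(\<lambda>k. vnorm (s k - x\<^sub>0)) \<longlonglongrightarrow> vnorm (l - x\<^sub>0)"
    using vclosed_carrier[OF assms(1) l] assms(2) by (intro tendsto_vnorm vconv_diff lim vconv_const) auto
  then have "vnorm (l - x\<^sub>0) \<le> R" using s by (intro LIMSEQ_le_const2) auto
  then show "l \<in> {x \<in> \<Omega>. vnorm (x - x\<^sub>0) \<le> R}" using l by simp
qed

lemma vinterior_subset: "vinterior d S \<subseteq> S"
proof
  fix x assume "x \<in> vinterior d S"
  then obtain e where "x \<in> carrier_vec d" "e > 0" "\<And>y. y \<in> carrier_vec d \<Longrightarrow> vnorm (y - x) < e \<Longrightarrow> y \<in> S"
    by (auto simp: vinterior_def)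
  then show "x \<in> S" by simp
qed

lemma vconvex_fun_ge_if_ge_near:
  assumes h: "vconvex_fun d h" and \<Omega>: "vconvex_set d \<Omega>" and x\<^sub>0: "x\<^sub>0 \<in> \<Omega>" "h x\<^sub>0 \<le> a"
    and near: "\<And>x. x \<in> \<Omega> \<Longrightarrow> vnorm (x - x\<^sub>0) \<le> 1 \<Longrightarrow> a \<le> h x" and x: "x \<in> \<Omega>"
  shows "a \<le> h x"
proof -
  define t where "t = 1 / (1 + vnorm (x - x\<^sub>0))"
  define z where "z = t \<cdot>\<^sub>v x + (1 - t) \<cdot>\<^sub>v x\<^sub>0"
  have t: "0 < t" "t \<le> 1" by (auto simp: t_def add_pos_nonneg)
  have c: "x \<in> carrier_vec d" "x\<^sub>0 \<in> carrier_vec d" using \<Omega> x x\<^sub>0 by (auto simp: vconvex_set_def)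
  have "vnorm (z - x\<^sub>0) \<le> 1"
    unfolding z_def using c by (subst convex_comb_diff_end_vec) (auto simp: vnorm_smult t_def add_pos_nonneg)
  moreover have "z \<in> \<Omega>" unfolding z_def using \<Omega> x x\<^sub>0 t by (intro vconvex_setD) auto
  ultimately have "a \<le> h z" by (intro near)
  also have "\<dots> \<le> t * h x + (1 - t) * h x\<^sub>0" unfolding z_def using c t by (intro vconvex_funD[OF h]) auto
  also have "\<dots> \<le> t * h x + (1 - t) * a" using x\<^sub>0 t by (intro add_left_mono mult_left_mono) auto
  finally have "t * a \<le> t * h x" by (simp add: algebra_simps)
  then show ?thesis using t by simp
qed

lemma affine_eq_0_if_nonneg_near_zero:
  assumes affine: "\<And>x y t. x \<in> carrier_vec d \<Longrightarrow> y \<in> carrier_vec d \<Longrightarrow> 0 \<le> t \<Longrightarrow> t \<le> 1 \<Longrightarrow>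
      h (t \<cdot>\<^sub>v x + (1 - t) \<cdot>\<^sub>v y) = t * h x + (1 - t) * h y"
    and z: "z \<in> vinterior d S" "h z = 0" and nonneg: "\<And>x. x \<in> S \<Longrightarrow> 0 \<le> h x"
    and x: "x \<in> carrier_vec d"
  shows "h x = (0 :: real)"
proof -
  obtain e where e: "e > 0" "\<And>y. y \<in> carrier_vec d \<Longrightarrow> vnorm (y - z) < e \<Longrightarrow> y \<in> S"
    and zc: "z \<in> carrier_vec d" using z(1) by (auto simp: vinterior_def)
  define t where "t = e / (e + 1 + vnorm (x - z))"
  have t: "0 < t" "t \<le> 1" "t * vnorm (x - z) < e"
    using e(1) by (auto simp: t_def add_pos_nonneg field_simps)
  define z1 z2 where "z1 = t \<cdot>\<^sub>v x + (1 - t) \<cdot>\<^sub>v z" and "z2 = z + (- t) \<cdot>\<^sub>v (x - z)"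
  have c: "z1 \<in> carrier_vec d" "z2 \<in> carrier_vec d" using x zc by (auto simp: z1_def z2_def)
  have "z1 - z = t \<cdot>\<^sub>v (x - z)" unfolding z1_def using x zc by (intro convex_comb_diff_end_vec) simp
  moreover have "z2 - z = (- t) \<cdot>\<^sub>v (x - z)" using x zc by (auto simp: z2_def)
  ultimately have "z1 \<in> S" "z2 \<in> S" using e(2) c t by (auto simp: vnorm_smult)
  then have "0 \<le> h z1" "0 \<le> h z2" using nonneg by auto
  moreover have "(1 / 2) \<cdot>\<^sub>v z1 + (1 - 1 / 2) \<cdot>\<^sub>v z2 = z" using x zc by (auto simp: z1_def z2_def algebra_simps)
  then have "h z1 + h z2 = 0" using affine[OF c, of "1 / 2"] z(2) by simp
  ultimately have "h z1 = 0" by linarith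
  then have "t * h x = 0" using affine[OF x zc, of t] t z(2) by (simp add: z1_def)
  then show ?thesis using t by simp
qed

lemma normalized_convergent_subseq:
  fixes y :: "nat \<Rightarrow> real vec"
  assumes y: "\<And>k. y k \<in> carrier_vec n"
  obtains \<rho> w \<tau> where "strict_mono \<rho>" "0 \<le> \<tau>" "\<tau> + vnorm w = 1" "w \<in> carrier_vec n"
    "(\<lambda>k. 1 / (1 + vnorm (y (\<rho> k)))) \<longlonglongrightarrow> \<tau>" "vconv (\<lambda>k. (1 / (1 + vnorm (y (\<rho> k)))) \<cdot>\<^sub>v y (\<rho> k)) w"
proof -
  define \<sigma> where "\<sigma> k = 1 / (1 + vnorm (y k))" for k
  have \<sigma>: "0 \<le> \<sigma> k" and norm: "vnorm (\<sigma> k \<cdot>\<^sub>v y k) = 1 - \<sigma> k" for k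
    using vnorm_nonneg[of "y k"] by (simp_all add: \<sigma>_def vnorm_smult field_simps del: vnorm_nonneg)
  have "\<sigma> k \<cdot>\<^sub>v y k \<in> carrier_vec n" "vnorm (\<sigma> k \<cdot>\<^sub>v y k) \<le> 1" for k
    using y norm \<sigma> by auto
  then obtain \<rho> w where \<rho>: "strict_mono \<rho>" "w \<in> carrier_vec n" "vconv (\<lambda>k. \<sigma> (\<rho> k) \<cdot>\<^sub>v y (\<rho> k)) w"
    by (rule bounded_vec_convergent_subseq)
  have "(\<lambda>k. 1 - vnorm (\<sigma> (\<rho> k) \<cdot>\<^sub>v y (\<rho> k))) \<longlonglongrightarrow> 1 - vnorm w"
    by (intro tendsto_intros tendsto_vnorm \<rho>)
  then have lim: "(\<lambda>k. \<sigma> (\<rho> k)) \<longlonglongrightarrow> 1 - vnorm w" by (simp add: norm)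
  then have "0 \<le> 1 - vnorm w" using \<sigma> by (intro LIMSEQ_le_const) auto
  then show ?thesis using that[of \<rho> "1 - vnorm w" w] \<rho> lim by (simp add: \<sigma>_def)
qed

locale convex_program =
  fixes p q d :: nat and \<Omega> :: "real vec set" and F :: "real vec \<Rightarrow> real" and G :: "real vec \<Rightarrow> real vec"
    and x_opt :: "real vec"
  assumes closed: "vclosed d \<Omega>" and convex: "vconvex_set d \<Omega>"
    and objective: "proper_closed_convex d F" and constraint: "K_convex p q d G"
    and x_opt_mem: "x_opt \<in> \<Omega>" and x_opt_feasible: "G x_opt \<in> Kcone p q"
    and x_opt_minimal: "\<And>x. x \<in> \<Omega> \<Longrightarrow> G x \<in> Kcone p q \<Longrightarrow> F x_opt \<le> F x"
begin

lemma objective_convex: "vconvex_fun d F" and objective_lsc: "vlsc d F"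
  using objective by (simp_all add: proper_closed_convex_def)

lemma x_opt_carrier [simp]: "x_opt \<in> carrier_vec d"
  using closed x_opt_mem by (rule vclosed_carrier)

lemma dim_x_opt [simp]: "dim_vec x_opt = d"
  using x_opt_carrier by (rule carrier_vecD)

definition nhd :: "real vec set" where
  "nhd = {x \<in> \<Omega>. vnorm (x - x_opt) \<le> 1}"

lemma x_opt_nhd: "x_opt \<in> nhd"
  using x_opt_mem by (simp add: nhd_def)

lemma nhd_carrier: "x \<in> nhd \<Longrightarrow> x \<in> carrier_vec d"
  using vclosed_carrier[OF closed] by (auto simp: nhd_def)

lemma vclosed_nhd: "vclosed d nhd"
  unfolding nhd_def using closed by (rule vclosed_Int_ball) simp

lemma vnorm_nhd_le: "x \<in> nhd \<Longrightarrow> vnorm x \<le> 1 + vnorm x_opt"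
  using vnorm_le_vnorm_diff_add[of x x_opt] nhd_carrier[of x] by (auto simp: nhd_def)

lemma nhd_attains_min:
  assumes "\<And>s x. (\<And>k. s k \<in> carrier_vec d) \<Longrightarrow> vconv s x \<Longrightarrow> liminf_ge (\<lambda>k. \<psi> (s k)) (\<psi> x)"
  obtains x where "x \<in> nhd" "\<And>z. z \<in> nhd \<Longrightarrow> \<psi> x \<le> \<psi> z"
  using lsc_attains_min[OF _ vclosed_nhd vnorm_nhd_le, of \<psi>] x_opt_nhd nhd_carrier assms by blast

abbreviation penalty :: "real \<Rightarrow> real vec \<Rightarrow> real" where
  "penalty n \<equiv> prox_aug_lagrangian p q n 1 F G (0\<^sub>v (p + q)) x_opt"

definition penalty_min :: "nat \<Rightarrow> real vec" where
  "penalty_min k = (SOME x. x \<in> nhd \<and> (\<forall>z\<in>nhd. penalty (real (Suc k)) x \<le> penalty (real (Suc k)) z))"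

definition penalty_mult :: "nat \<Rightarrow> real vec" where
  "penalty_mult k = projK p q (real (Suc k) \<cdot>\<^sub>v G (penalty_min k))"

lemma penalty_min_nhd: "penalty_min k \<in> nhd"
  and penalty_min_le: "z \<in> nhd \<Longrightarrow> penalty (real (Suc k)) (penalty_min k) \<le> penalty (real (Suc k)) z"
proof -
  obtain x where "x \<in> nhd" "\<And>z. z \<in> nhd \<Longrightarrow> penalty (real (Suc k)) x \<le> penalty (real (Suc k)) z"
    by (rule nhd_attains_min[OF prox_aug_lagrangian_liminf_ge[OF objective_lsc constraint]]) auto
  then have "penalty_min k \<in> nhd \<and> (\<forall>z\<in>nhd. penalty (real (Suc k)) (penalty_min k) \<le> penalty (real (Suc k)) z)"
    unfolding penalty_min_def by (intro someI_ex[of "\<lambda>x. x \<in> nhd \<and> _ x"]) blast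
  then show "penalty_min k \<in> nhd" "z \<in> nhd \<Longrightarrow> penalty (real (Suc k)) (penalty_min k) \<le> penalty (real (Suc k)) z"
    by auto
qed

lemma penalty_min_carrier [simp]: "penalty_min k \<in> carrier_vec d"
  using penalty_min_nhd by (rule nhd_carrier)

lemma G_carrier: "x \<in> carrier_vec d \<Longrightarrow> G x \<in> carrier_vec (p + q)"
  using constraint by (rule K_convex_carrier)

lemma penalty_mult_Kpol: "penalty_mult k \<in> Kpol p q"
  by (simp add: penalty_mult_def)

lemma penalty_mult_carrier [simp]: "penalty_mult k \<in> carrier_vec (p + q)"
  by (simp add: penalty_mult_def)

lemma penalty_min_value_le:
  "F (penalty_min k) + 1 / (2 * real (Suc k)) * (penalty_mult k \<bullet> penalty_mult k)
    + 1 / 2 * ((penalty_min k - x_opt) \<bullet> (penalty_min k - x_opt)) \<le> F x_opt"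
proof -
  have "projK p q (real (Suc k) \<cdot>\<^sub>v G x_opt) = 0\<^sub>v (p + q)"
    using x_opt_feasible by (intro projK_Kcone Kcone_smult) auto
  then have "penalty (real (Suc k)) x_opt = F x_opt"
    using G_carrier[OF x_opt_carrier] x_opt_carrier by (simp add: prox_aug_lagrangian_def diff_self_vec del: of_nat_Suc)
  then show ?thesis
    using penalty_min_le[OF x_opt_nhd, of k] G_carrier[OF penalty_min_carrier]
    by (simp add: prox_aug_lagrangian_def penalty_mult_def del: of_nat_Suc)
qed

lemma penalty_stationary:
  assumes x: "x \<in> nhd"
  shows "F (penalty_min k) + (x_opt - penalty_min k) \<bullet> (x - penalty_min k) \<le> F x + penalty_mult k \<bullet> G x"
proof -
  define n where "n = real (Suc k)"
  define x' where "x' = penalty_min k"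
  have n: "0 < n" by (simp add: n_def)
  have x': "x' \<in> nhd" "x' \<in> carrier_vec d" by (simp_all add: x'_def penalty_min_nhd)
  have mult: "projK p q (0\<^sub>v (p + q) + n \<cdot>\<^sub>v G x') = penalty_mult k"
    using G_carrier[OF x'(2)] by (simp add: penalty_mult_def n_def x'_def)
  have "F x' + penalty_mult k \<bullet> G x' + (0\<^sub>v d + (1 / 1) \<cdot>\<^sub>v (x_opt - x')) \<bullet> (x - x') \<le> F x + penalty_mult k \<bullet> G x"
    unfolding mult[symmetric]
  proof (rule prox_aug_lagrangian_stationary[OF _ objective_convex constraint _ _ _ n _ x'(1) _ x])
    show "vconvex_set d nhd" unfolding nhd_def using convex by (rule vconvex_set_Int_ball) simp
    fix z assume z: "z \<in> nhd"
    have "0\<^sub>v d \<bullet> (z - x') = 0" using nhd_carrier[OF z] x' by (intro scalar_prod_left_zero) auto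
    then show "penalty n x' + 0\<^sub>v d \<bullet> (z - x') \<le> penalty n z"
      using penalty_min_le[OF z, of k] by (simp add: n_def x'_def)
  qed auto
  moreover have "n * (penalty_mult k \<bullet> G x') = penalty_mult k \<bullet> penalty_mult k"
    using projK_scalar_prod_self[of "n \<cdot>\<^sub>v G x'" p q] G_carrier[OF x'(2)] by (simp add: penalty_mult_def n_def x'_def)
  then have "0 \<le> n * (penalty_mult k \<bullet> G x')" by simp
  then have "0 \<le> penalty_mult k \<bullet> G x'" using n by (simp add: zero_le_mult_iff)
  moreover have "0\<^sub>v d + (1 / 1) \<cdot>\<^sub>v (x_opt - x') = x_opt - x'" using x' by simp
  ultimately show ?thesis by (simp add: x'_def)
qed

lemma constraint_violation_tendsto_0: "(\<lambda>k. vnorm (projK p q (G (penalty_min k)))) \<longlonglongrightarrow> 0"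
proof -
  obtain x_min where x_min: "x_min \<in> nhd" "\<And>x. x \<in> nhd \<Longrightarrow> F x_min \<le> F x"
    by (rule nhd_attains_min[of F]) (use vlscD[OF objective_lsc] in blast)+
  define C where "C = 2 * (F x_opt - F x_min)"
  have bound: "(vnorm (projK p q (G (penalty_min k))))\<^sup>2 \<le> C * inverse (real (Suc k))" for k
  proof -
    define n where "n = real (Suc k)"
    define v where "v = projK p q (G (penalty_min k))"
    have n: "0 < n" by (simp add: n_def)
    have "penalty_mult k = n \<cdot>\<^sub>v v"
      unfolding penalty_mult_def n_def v_def by (rule projK_smult[OF G_carrier]) auto
    then have "1 / (2 * n) * (penalty_mult k \<bullet> penalty_mult k) = n * (v \<bullet> v) / 2"
      using n by (simp add: field_simps)
    then have "F (penalty_min k) + n * (v \<bullet> v) / 2 \<le> F x_opt"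
      using penalty_min_value_le[of k] scalar_prod_self_nonneg[of "penalty_min k - x_opt"]
      unfolding n_def[symmetric] by linarith
    then have "n * (v \<bullet> v) \<le> C" using x_min(2)[OF penalty_min_nhd[of k]] by (simp add: C_def)
    then show ?thesis
      unfolding n_def[symmetric] v_def[symmetric] vnorm_power2 using n by (simp add: field_simps)
  qed
  have "(\<lambda>k. C * inverse (real (Suc k))) \<longlonglongrightarrow> 0"
    using tendsto_mult[OF tendsto_const LIMSEQ_inverse_real_of_nat, of C] by simp
  then have "(\<lambda>k. (vnorm (projK p q (G (penalty_min k))))\<^sup>2) \<longlonglongrightarrow> 0"
    by (rule tendsto_sandwich[OF _ _ tendsto_const, rotated 2]) (intro always_eventually allI bound zero_le_power2)+
  from tendsto_real_sqrt[OF this] show ?thesis by simp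
qed

lemma penalty_min_cluster_feasible:
  assumes \<rho>: "strict_mono \<rho>" and lim: "vconv (\<lambda>k. penalty_min (\<rho> k)) x"
  shows "G x \<in> Kcone p q"
proof (rule Kcone_if_polar)
  show "G x \<in> carrier_vec (p + q)" using vconv_carrier[OF lim] by (intro G_carrier) simp
  fix w assume w: "w \<in> Kpol p q"
  show "w \<bullet> G x \<le> 0"
  proof (rule le_if_liminf_ge)
    show "liminf_ge (\<lambda>k. w \<bullet> G (penalty_min (\<rho> k))) (w \<bullet> G x)"
      by (rule K_convex_liminf_ge[OF constraint w _ lim]) simp
    show "w \<bullet> G (penalty_min (\<rho> k)) \<le> vnorm w * vnorm (projK p q (G (penalty_min (\<rho> k))))" for k
      using Kpol_scalar_prod_le_projK[OF w G_carrier] scalar_prod_le_vnorm dim_Kpol[OF w]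
      by (metis dim_projK order_trans penalty_min_carrier)
    show "(\<lambda>k. vnorm w * vnorm (projK p q (G (penalty_min (\<rho> k))))) \<longlonglongrightarrow> 0"
      using tendsto_mult[OF tendsto_const LIMSEQ_subseq_LIMSEQ[OF constraint_violation_tendsto_0 \<rho>], of "vnorm w"]
      by (simp add: o_def)
  qed
qed

lemma penalty_min_subseq_tendsto_x_opt:
  obtains \<rho> where "strict_mono \<rho>" "vconv (\<lambda>k. penalty_min (\<rho> k)) x_opt" "(\<lambda>k. F (penalty_min (\<rho> k))) \<longlonglongrightarrow> F x_opt"
proof -
  obtain \<rho> x where \<rho>: "strict_mono \<rho>" "x \<in> carrier_vec d" and lim: "vconv (\<lambda>k. penalty_min (\<rho> k)) x"
    using bounded_vec_convergent_subseq[of penalty_min d] vnorm_nhd_le[OF penalty_min_nhd] by auto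
  have "x \<in> nhd" using vclosedD[OF vclosed_nhd lim] penalty_min_nhd by blast
  then have "F x_opt \<le> F x"
    using x_opt_minimal penalty_min_cluster_feasible[OF \<rho>(1) lim] by (simp add: nhd_def)
  have le: "F (penalty_min k) + 1 / 2 * ((penalty_min k - x_opt) \<bullet> (penalty_min k - x_opt)) \<le> F x_opt" for k
  proof -
    have "0 \<le> 1 / (2 * real (Suc k)) * (penalty_mult k \<bullet> penalty_mult k)" by simp
    then show ?thesis using penalty_min_value_le[of k] by linarith
  qed
  have "F x + 1 / 2 * ((x - x_opt) \<bullet> (x - x_opt)) \<le> F x_opt"
  proof (rule le_if_liminf_ge[OF _ le tendsto_const])
    show "liminf_ge (\<lambda>k. F (penalty_min (\<rho> k)) + 1 / 2 * ((penalty_min (\<rho> k) - x_opt) \<bullet> (penalty_min (\<rho> k) - x_opt)))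
        (F x + 1 / 2 * ((x - x_opt) \<bullet> (x - x_opt)))"
      using \<rho>(2) x_opt_carrier
      by (intro liminf_ge_add vlscD[OF objective_lsc _ lim] liminf_ge_if_tendsto tendsto_intros
          tendsto_scalar_prod vconv_diff lim vconv_const) auto
  qed
  with \<open>F x_opt \<le> F x\<close> have "(x - x_opt) \<bullet> (x - x_opt) = 0"
    using scalar_prod_self_nonneg[of "x - x_opt"] by linarith
  then have "x = x_opt"
    unfolding vec_eq_iff_diff_eq_0[OF \<rho>(2) x_opt_carrier] by (simp add: scalar_prod_self_eq_0_iff)
  moreover have "(\<lambda>k. F (penalty_min (\<rho> k))) \<longlonglongrightarrow> F x_opt"
  proof (rule tendsto_if_liminf_ge)
    show "liminf_ge (\<lambda>k. F (penalty_min (\<rho> k))) (F x_opt)"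
      using lim \<open>x = x_opt\<close> by (intro vlscD[OF objective_lsc]) auto
    show "F (penalty_min (\<rho> k)) \<le> F x_opt" for k
      using le[of "\<rho> k"] scalar_prod_self_nonneg[of "penalty_min (\<rho> k) - x_opt"] by linarith
  qed
  ultimately show ?thesis using that \<rho>(1) lim by blast
qed

text \<open>Combinations of the equality constraints that vanish identically: a multiplier in this space carries no
  information, so it must be kept out of the Fritz John multipliers when the equalities are linearly dependent.\<close>

definition redundant :: "real vec set" where
  "redundant = {u \<in> carrier_vec (p + q). (\<forall>c. p \<le> c \<and> c < p + q \<longrightarrow> u $ c = 0) \<and> (\<forall>x\<in>carrier_vec d. u \<bullet> G x = 0)}"

lemma penalty_mult_orthogonal_redundant:
  assumes u: "u \<in> redundant"
  shows "u \<bullet> penalty_mult k = 0"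
proof -
  have "u \<bullet> penalty_mult k = u \<bullet> (real (Suc k) \<cdot>\<^sub>v G (penalty_min k))"
    using u G_carrier[OF penalty_min_carrier, of k]
    by (auto simp: redundant_def scalar_prod_lessThan penalty_mult_def projK_def intro!: sum.cong)
  then show ?thesis using u G_carrier[OF penalty_min_carrier, of k] by (simp add: redundant_def)
qed

definition mult_scale :: "nat \<Rightarrow> real" where
  "mult_scale k = 1 / (1 + vnorm (penalty_mult k))"

lemma mult_scale_nonneg [simp]: "0 \<le> mult_scale k"
  by (simp add: mult_scale_def)

lemma penalty_limits:
  obtains \<rho> \<tau> w where "vconv (\<lambda>k. penalty_min (\<rho> k)) x_opt" "(\<lambda>k. F (penalty_min (\<rho> k))) \<longlonglongrightarrow> F x_opt"
    "(\<lambda>k. mult_scale (\<rho> k)) \<longlonglongrightarrow> \<tau>" "vconv (\<lambda>k. mult_scale (\<rho> k) \<cdot>\<^sub>v penalty_mult (\<rho> k)) w"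
    "0 \<le> \<tau>" "\<tau> + vnorm w = 1" "w \<in> Kpol p q"
proof -
  obtain \<rho> where \<rho>: "strict_mono \<rho>" "vconv (\<lambda>k. penalty_min (\<rho> k)) x_opt" "(\<lambda>k. F (penalty_min (\<rho> k))) \<longlonglongrightarrow> F x_opt"
    by (rule penalty_min_subseq_tendsto_x_opt)
  obtain \<rho>' w \<tau> where \<rho>': "strict_mono \<rho>'" and \<tau>: "0 \<le> \<tau>" "\<tau> + vnorm w = 1"
    and scale: "(\<lambda>k. mult_scale (\<rho> (\<rho>' k))) \<longlonglongrightarrow> \<tau>"
    and w: "vconv (\<lambda>k. mult_scale (\<rho> (\<rho>' k)) \<cdot>\<^sub>v penalty_mult (\<rho> (\<rho>' k))) w"
    unfolding mult_scale_def by (rule normalized_convergent_subseq[of "\<lambda>k. penalty_mult (\<rho> k)" "p + q"]) (simp, blast)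
  have "mult_scale k \<cdot>\<^sub>v penalty_mult k \<in> Kpol p q" for k by (intro Kpol_smult penalty_mult_Kpol) simp
  then have "w \<in> Kpol p q" using vclosedD[OF vclosed_Kpol w] by blast
  then show ?thesis
    using that[of "\<lambda>k. \<rho> (\<rho>' k)"] vconv_subseq[OF \<rho>(2) \<rho>'] LIMSEQ_subseq_LIMSEQ[OF \<rho>(3) \<rho>'] scale w \<tau>
    by (simp add: o_def)
qed

lemma penalty_limit_subgradient:
  assumes x: "vconv (\<lambda>k. penalty_min (\<rho> k)) x_opt" "(\<lambda>k. F (penalty_min (\<rho> k))) \<longlonglongrightarrow> F x_opt"
    and \<tau>: "(\<lambda>k. mult_scale (\<rho> k)) \<longlonglongrightarrow> \<tau>"
    and w: "vconv (\<lambda>k. mult_scale (\<rho> k) \<cdot>\<^sub>v penalty_mult (\<rho> k)) w" "w \<in> Kpol p q" and z: "z \<in> nhd"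
  shows "\<tau> * F x_opt \<le> \<tau> * F z + w \<bullet> G z"
proof (rule LIMSEQ_le)
  let ?x = "\<lambda>k. penalty_min (\<rho> k)" and ?y = "\<lambda>k. penalty_mult (\<rho> k)" and ?\<sigma> = "\<lambda>k. mult_scale (\<rho> k)"
  have zc: "z \<in> carrier_vec d" using z by (rule nhd_carrier)
  show "(\<lambda>k. ?\<sigma> k * F (?x k)) \<longlonglongrightarrow> \<tau> * F x_opt" by (intro tendsto_intros \<tau> x)
  have "(\<lambda>k. ?\<sigma> k * F z + (?\<sigma> k \<cdot>\<^sub>v ?y k) \<bullet> G z - ?\<sigma> k * ((x_opt - ?x k) \<bullet> (z - ?x k)))
      \<longlonglongrightarrow> \<tau> * F z + w \<bullet> G z - \<tau> * ((x_opt - x_opt) \<bullet> (z - x_opt))"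
    using zc G_carrier[OF zc] dim_Kpol[OF w(2)]
    by (intro tendsto_intros \<tau> tendsto_scalar_prod vconv_diff vconv_const x w(1)) auto
  then show "(\<lambda>k. ?\<sigma> k * F z + (?\<sigma> k \<cdot>\<^sub>v ?y k) \<bullet> G z - ?\<sigma> k * ((x_opt - ?x k) \<bullet> (z - ?x k)))
      \<longlonglongrightarrow> \<tau> * F z + w \<bullet> G z"
    using scalar_prod_left_zero[of "z - x_opt" d] zc by (simp add: diff_self_vec)
  have "?\<sigma> k * F (?x k) \<le> ?\<sigma> k * F z + (?\<sigma> k \<cdot>\<^sub>v ?y k) \<bullet> G z - ?\<sigma> k * ((x_opt - ?x k) \<bullet> (z - ?x k))" for k
    using mult_left_mono[OF penalty_stationary[OF z, of "\<rho> k"] mult_scale_nonneg[of "\<rho> k"]]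
      carrier_vecD[OF penalty_mult_carrier] carrier_vecD[OF G_carrier[OF zc]] by (simp add: algebra_simps)
  then show "\<exists>N. \<forall>k\<ge>N. ?\<sigma> k * F (?x k) \<le> ?\<sigma> k * F z + (?\<sigma> k \<cdot>\<^sub>v ?y k) \<bullet> G z - ?\<sigma> k * ((x_opt - ?x k) \<bullet> (z - ?x k))"
    by blast
qed

lemma fritz_john:
  obtains \<tau> w where "0 \<le> \<tau>" "w \<in> Kpol p q" "\<tau> + vnorm w = 1"
    "\<And>x. x \<in> \<Omega> \<Longrightarrow> \<tau> * F x_opt \<le> \<tau> * F x + w \<bullet> G x" "\<And>u. u \<in> redundant \<Longrightarrow> u \<bullet> w = 0"
proof -
  obtain \<rho> \<tau> w where x: "vconv (\<lambda>k. penalty_min (\<rho> k)) x_opt" "(\<lambda>k. F (penalty_min (\<rho> k))) \<longlonglongrightarrow> F x_opt"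
    and scale: "(\<lambda>k. mult_scale (\<rho> k)) \<longlonglongrightarrow> \<tau>" and mult: "vconv (\<lambda>k. mult_scale (\<rho> k) \<cdot>\<^sub>v penalty_mult (\<rho> k)) w"
    and \<tau>: "0 \<le> \<tau>" "\<tau> + vnorm w = 1" and w: "w \<in> Kpol p q" by (rule penalty_limits)
  have "proper_closed_convex d (\<lambda>z. \<tau> * F z + w \<bullet> G z)"
    using \<tau>(1) constraint w
    by (intro proper_closed_convex_add proper_closed_convex_cmult objective) (simp_all add: K_convex_def)
  then have "vconvex_fun d (\<lambda>z. \<tau> * F z + w \<bullet> G z)" by (simp add: proper_closed_convex_def)
  then have "\<tau> * F x_opt \<le> \<tau> * F z + w \<bullet> G z" if "z \<in> \<Omega>" for z
    by (rule vconvex_fun_ge_if_ge_near[OF _ convex x_opt_mem])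
      (use penalty_limit_subgradient[OF x scale mult w] that Kpol_Kcone_nonpos[OF w x_opt_feasible] in \<open>auto simp: nhd_def\<close>)
  moreover have "u \<bullet> w = 0" if u: "u \<in> redundant" for u
  proof (rule LIMSEQ_unique)
    show "(\<lambda>k. u \<bullet> (mult_scale (\<rho> k) \<cdot>\<^sub>v penalty_mult (\<rho> k))) \<longlonglongrightarrow> u \<bullet> w"
      using u dim_Kpol[OF w] by (intro tendsto_scalar_prod vconv_const mult) (simp add: redundant_def)
    have "u \<bullet> (mult_scale (\<rho> k) \<cdot>\<^sub>v penalty_mult (\<rho> k)) = 0" for k
      using penalty_mult_orthogonal_redundant[OF u] u
      by (subst scalar_prod_smult_distrib[OF _ penalty_mult_carrier]) (auto simp: redundant_def)
    then show "(\<lambda>k. u \<bullet> (mult_scale (\<rho> k) \<cdot>\<^sub>v penalty_mult (\<rho> k))) \<longlonglongrightarrow> 0" by simp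
  qed
  ultimately show ?thesis using that \<tau> w by blast
qed

context
  fixes z
  assumes slater: "z \<in> vinterior d \<Omega>" "\<And>c. c < p \<Longrightarrow> G z $ c = 0" "\<And>c. p \<le> c \<Longrightarrow> c < p + q \<Longrightarrow> G z $ c < 0"
begin

lemma redundant_if_nonneg:
  assumes w: "w \<in> Kpol p q" and nonneg: "\<And>x. x \<in> \<Omega> \<Longrightarrow> 0 \<le> w \<bullet> G x"
  shows "w \<in> redundant"
proof -
  have z: "z \<in> carrier_vec d" "z \<in> \<Omega>"
    using slater(1) vinterior_subset[of d \<Omega>] by (auto simp: vinterior_def)
  have zero: "w $ c = 0" if "p \<le> c" "c < p + q" for c
    using Kpol_index_eq_0_if_nonneg[OF w G_carrier[OF z(1)] nonneg[OF z(2)] slater(2,3)] that by blast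
  then have uminus: "(- 1) \<cdot>\<^sub>v w \<in> Kpol p q" using w by (auto simp: Kpol_def)
  have "w \<bullet> G (t \<cdot>\<^sub>v x + (1 - t) \<cdot>\<^sub>v x') = t * (w \<bullet> G x) + (1 - t) * (w \<bullet> G x')"
    if x: "x \<in> carrier_vec d" "x' \<in> carrier_vec d" and t: "0 \<le> t" "t \<le> 1" for x x' t
    using vconvex_funD[OF K_convex_vconvex_fun[OF constraint w] x t]
      vconvex_funD[OF K_convex_vconvex_fun[OF constraint uminus] x t]
      G_carrier[OF x(1)] G_carrier[OF x(2)] G_carrier[of "t \<cdot>\<^sub>v x + (1 - t) \<cdot>\<^sub>v x'"] dim_Kpol[OF w] x
    by simp
  moreover have "G z \<in> Kcone p q" using G_carrier[OF z(1)] slater(2,3) by (auto simp: Kcone_def intro: less_imp_le)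
  then have "w \<bullet> G z = 0" using Kpol_Kcone_nonpos[OF w] nonneg[OF z(2)] by (intro antisym)
  ultimately have "w \<bullet> G x = 0" if "x \<in> carrier_vec d" for x
    using affine_eq_0_if_nonneg_near_zero[of d "\<lambda>x. w \<bullet> G x" z \<Omega> x] slater(1) nonneg z(2) that by fastforce
  then show ?thesis using w zero by (simp add: redundant_def Kpol_carrier)
qed

theorem slater_multiplier:
  obtains y where "y \<in> Kpol p q" "\<And>x. x \<in> \<Omega> \<Longrightarrow> F x_opt \<le> F x + y \<bullet> G x"
proof -
  obtain \<tau> w where \<tau>: "0 \<le> \<tau>" and w: "w \<in> Kpol p q" "\<tau> + vnorm w = 1"
    and min: "\<And>x. x \<in> \<Omega> \<Longrightarrow> \<tau> * F x_opt \<le> \<tau> * F x + w \<bullet> G x"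
    and orth: "\<And>u. u \<in> redundant \<Longrightarrow> u \<bullet> w = 0" by (rule fritz_john) blast
  have "\<tau> \<noteq> 0"
  proof
    assume "\<tau> = 0"
    then have "w \<bullet> w = 0" using min by (intro orth redundant_if_nonneg w(1)) simp
    then show False using w(2) \<open>\<tau> = 0\<close> by (simp add: vnorm_def)
  qed
  with \<tau> have \<tau>: "0 < \<tau>" by simp
  show ?thesis
  proof (rule that)
    show "(1 / \<tau>) \<cdot>\<^sub>v w \<in> Kpol p q" using w \<tau> by (intro Kpol_smult) auto
    fix x assume x: "x \<in> \<Omega>"
    have "\<tau> * (F x + ((1 / \<tau>) \<cdot>\<^sub>v w) \<bullet> G x) = \<tau> * F x + w \<bullet> G x"
      using dim_Kpol[OF w(1)] G_carrier[OF vclosed_carrier[OF closed x]] \<tau> by (simp add: distrib_left)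
    then show "F x_opt \<le> F x + ((1 / \<tau>) \<cdot>\<^sub>v w) \<bullet> G x"
      using min[OF x] \<tau> by (metis mult_le_cancel_left_pos)
  qed
qed

end

end

section \<open>Block vectors\<close>

lemma offs_Suc: "offs ds (Suc i) = offs ds i + ds i"
  by (simp add: offs_def)

lemma offs_0 [simp]: "offs ds 0 = 0"
  by (simp add: offs_def)

lemma offs_const [simp]: "offs (\<lambda>_. d) i = i * d"
  by (simp add: offs_def)

lemma offs_less: "i < m \<Longrightarrow> j < ds i \<Longrightarrow> offs ds i + j < offs ds m"
  by (induction m) (auto simp: offs_Suc less_Suc_eq)

lemma dim_blk [simp]: "dim_vec (blk ds i x) = ds i"
  by (simp add: blk_def)

lemma index_blk [simp]: "j < ds i \<Longrightarrow> blk ds i x $ j = x $ (offs ds i + j)"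
  by (simp add: blk_def)

lemma blk_carrier [simp]: "blk ds i x \<in> carrier_vec (ds i)"
  by (simp add: carrier_vecI)

lemma blk_const_carrier [simp]: "blk (\<lambda>_. d) i x \<in> carrier_vec d"
  by (simp add: carrier_vecI)

lemma blk_add: "dim_vec y = offs ds m \<Longrightarrow> i < m \<Longrightarrow> blk ds i (x + y) = blk ds i x + blk ds i y"
  by (auto simp: offs_less)

lemma blk_diff: "dim_vec y = offs ds m \<Longrightarrow> i < m \<Longrightarrow> blk ds i (x - y) = blk ds i x - blk ds i y"
  by (auto simp: offs_less)

lemma blk_uminus: "dim_vec y = offs ds m \<Longrightarrow> i < m \<Longrightarrow> blk ds i (- y) = - blk ds i y"
  by (auto simp: offs_less)

lemma blk_smult: "dim_vec y = offs ds m \<Longrightarrow> i < m \<Longrightarrow> blk ds i (a \<cdot>\<^sub>v y) = a \<cdot>\<^sub>v blk ds i y"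
  by (auto simp: offs_less)

lemma blk_zero: "i < m \<Longrightarrow> blk ds i (0\<^sub>v (offs ds m)) = 0\<^sub>v (ds i)"
  by (auto simp: offs_less)

lemma blk_convex_comb:
  assumes "x \<in> carrier_vec (offs ds m)" "y \<in> carrier_vec (offs ds m)" "i < m"
  shows "blk ds i (s \<cdot>\<^sub>v x + t \<cdot>\<^sub>v y) = s \<cdot>\<^sub>v blk ds i x + t \<cdot>\<^sub>v blk ds i y"
  using assms by (simp add: blk_add[of _ _ m] blk_smult[of _ _ m])

lemma dim_stack: "(\<And>i. i < m \<Longrightarrow> vs i \<in> carrier_vec (ds i)) \<Longrightarrow> dim_vec (stack m vs) = offs ds m"
  by (induction m) (auto simp: offs_Suc)

lemma stack_carrier: "(\<And>i. i < m \<Longrightarrow> vs i \<in> carrier_vec (ds i)) \<Longrightarrow> stack m vs \<in> carrier_vec (offs ds m)"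
  by (rule carrier_vecI) (rule dim_stack)

lemma blk_stack: "(\<And>i. i < m \<Longrightarrow> vs i \<in> carrier_vec (ds i)) \<Longrightarrow> i < m \<Longrightarrow> blk ds i (stack m vs) = vs i"
proof (induction m)
  case (Suc m)
  have dim: "dim_vec (stack m vs) = offs ds m" using Suc.prems by (intro dim_stack) auto
  show ?case
  proof (cases "i = m")
    case True
    then show ?thesis using Suc.prems(1)[of m] dim by auto
  next
    case False
    then have "blk ds i (stack (Suc m) vs) = blk ds i (stack m vs)"
      using Suc.prems dim offs_less[of i m _ ds] by (intro eq_vecI) (auto simp: trans_less_add1)
    then show ?thesis using Suc False by auto
  qed
qed simp

lemma stack_blk: "dim_vec x = offs ds m \<Longrightarrow> stack m (\<lambda>i. blk ds i x) = x"
proof -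
  have "stack m (\<lambda>i. blk ds i x) = vec (offs ds m) (($) x)"
    by (induction m) (auto simp: offs_Suc)
  then show "dim_vec x = offs ds m \<Longrightarrow> stack m (\<lambda>i. blk ds i x) = x" by auto
qed

lemma stack_cong: "(\<And>i. i < m \<Longrightarrow> vs i = ws i) \<Longrightarrow> stack m vs = stack m ws"
  by (induction m) auto

lemma vec_eq_blkI:
  assumes "dim_vec x = offs ds m" "dim_vec y = offs ds m" "\<And>i. i < m \<Longrightarrow> blk ds i x = blk ds i y"
  shows "x = y"
  using stack_cong[of m "\<lambda>i. blk ds i x" "\<lambda>i. blk ds i y"] assms by (simp add: stack_blk)

lemma sum_lessThan_offs:
  fixes h :: "nat \<Rightarrow> 'a :: comm_monoid_add"
  shows "(\<Sum>k<offs ds m. h k) = (\<Sum>i<m. \<Sum>j<ds i. h (offs ds i + j))"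
proof (induction m)
  case (Suc m)
  have "(\<Sum>k<a + b. h k) = (\<Sum>k<a. h k) + (\<Sum>k<b. h (a + k))" for a b
    by (induction b) (auto simp: ac_simps)
  then show ?case using Suc by (simp add: offs_Suc)
qed simp

lemma scalar_prod_blk: "dim_vec y = offs ds m \<Longrightarrow> x \<bullet> y = (\<Sum>i<m. blk ds i x \<bullet> blk ds i y)"
  by (simp add: scalar_prod_lessThan sum_lessThan_offs)

lemma vnorm_eq_L2_set_blk: "dim_vec x = offs ds m \<Longrightarrow> vnorm x = L2_set (\<lambda>i. vnorm (blk ds i x)) {..<m}"
  using scalar_prod_blk[of x ds m x] by (simp add: vnorm_def L2_set_def)

lemma vnorm_blk_le: "dim_vec x = offs ds m \<Longrightarrow> i < m \<Longrightarrow> vnorm (blk ds i x) \<le> vnorm x"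
  unfolding vnorm_eq_L2_set_blk by (intro member_le_L2_set) auto

lemma vnorm_le_sum_blk: "dim_vec x = offs ds m \<Longrightarrow> vnorm x \<le> (\<Sum>i<m. vnorm (blk ds i x))"
  unfolding vnorm_eq_L2_set_blk by (intro L2_set_le_sum) auto

lemma vconv_blk:
  assumes "vconv s x" "dim_vec x = offs ds m" "i < m"
  shows "vconv (\<lambda>k. blk ds i (s k)) (blk ds i x)"
  using assms by (auto simp: vconv_iff_index offs_less)

lemma proper_closed_convex_blk:
  assumes "proper_closed_convex (ds i) h" and i: "i < m"
  shows "proper_closed_convex (offs ds m) (\<lambda>x. h (blk ds i x))"
  unfolding proper_closed_convex_def
proof
  have convex: "vconvex_fun (ds i) h" and lsc: "vlsc (ds i) h"
    using assms by (simp_all add: proper_closed_convex_def)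
  show "vconvex_fun (offs ds m) (\<lambda>x. h (blk ds i x))"
    unfolding vconvex_fun_def using vconvex_funD[OF convex] i by (auto simp: blk_convex_comb)
  show "vlsc (offs ds m) (\<lambda>x. h (blk ds i x))"
    using i by (intro vlscI vlscD[OF lsc] vconv_blk[where m = m]) auto
qed

definition block_prod :: "(nat \<Rightarrow> nat) \<Rightarrow> nat \<Rightarrow> (nat \<Rightarrow> real vec set) \<Rightarrow> real vec set" where
  "block_prod ds m S = {x \<in> carrier_vec (offs ds m). \<forall>i<m. blk ds i x \<in> S i}"

lemma block_prod_subset: "block_prod ds m S \<subseteq> carrier_vec (offs ds m)"
  by (auto simp: block_prod_def)

lemma vclosed_block_prod:
  assumes "\<And>i. i < m \<Longrightarrow> vclosed (ds i) (S i)"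
  shows "vclosed (offs ds m) (block_prod ds m S)"
  unfolding vclosed_def
proof (intro conjI allI impI block_prod_subset)
  fix s l assume s: "\<forall>k. s k \<in> block_prod ds m S" and lim: "vconv s l"
  have l: "l \<in> carrier_vec (offs ds m)" using vconv_carrier[OF lim] s block_prod_subset by blast
  have "blk ds i l \<in> S i" if "i < m" for i
    using vclosedD[OF assms[OF that] vconv_blk[OF lim _ that]] l s that by (simp add: block_prod_def)
  then show "l \<in> block_prod ds m S" using l by (simp add: block_prod_def)
qed

lemma vconvex_set_block_prod:
  assumes "\<And>i. i < m \<Longrightarrow> vconvex_set (ds i) (S i)"
  shows "vconvex_set (offs ds m) (block_prod ds m S)"
  using assms unfolding vconvex_set_def by (auto simp: block_prod_def blk_convex_comb)

lemma stack_in_vinterior_block_prod: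
  assumes z: "\<And>i. i < m \<Longrightarrow> z i \<in> vinterior (ds i) (S i)"
  shows "stack m z \<in> vinterior (offs ds m) (block_prod ds m S)"
proof -
  have "z i \<in> carrier_vec (ds i)" if "i < m" for i using z[OF that] by (simp add: vinterior_def)
  then have carrier: "stack m z \<in> carrier_vec (offs ds m)" and blk_z: "\<And>i. i < m \<Longrightarrow> blk ds i (stack m z) = z i"
    by (auto intro: stack_carrier blk_stack)
  have "\<exists>e>0. \<forall>y\<in>carrier_vec (ds i). vnorm (y - z i) < e \<longrightarrow> y \<in> S i" if "i < m" for i
    using z[OF that] by (simp add: vinterior_def)
  then obtain e where e: "\<And>i. i < m \<Longrightarrow> 0 < e i"
    "\<And>i y. i < m \<Longrightarrow> y \<in> carrier_vec (ds i) \<Longrightarrow> vnorm (y - z i) < e i \<Longrightarrow> y \<in> S i" by metis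
  define r where "r = Min (insert 1 (e ` {..<m}))"
  have r: "0 < r" "\<And>i. i < m \<Longrightarrow> r \<le> e i" using e(1) by (auto simp: r_def)
  have "w \<in> block_prod ds m S" if w: "w \<in> carrier_vec (offs ds m)" "vnorm (w - stack m z) < r" for w
  proof -
    have "blk ds i w \<in> S i" if i: "i < m" for i
    proof (rule e(2)[OF i])
      have "blk ds i w - z i = blk ds i (w - stack m z)"
        using carrier i by (simp add: blk_diff[of _ _ m] blk_z)
      also have "vnorm \<dots> \<le> vnorm (w - stack m z)" using carrier i by (intro vnorm_blk_le) auto
      finally show "vnorm (blk ds i w - z i) < e i" using w(2) r(2)[OF i] by simp
    qed simp
    then show ?thesis using w(1) by (simp add: block_prod_def)
  qed
  then show ?thesis using carrier r(1) by (auto simp: vinterior_def)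
qed

lemma block_sum_subgradient_iff:
  fixes h :: "nat \<Rightarrow> real vec \<Rightarrow> real"
  assumes S: "\<And>i. i < m \<Longrightarrow> S i \<subseteq> carrier_vec (ds i)" and x: "x \<in> block_prod ds m S"
    and s: "s \<in> carrier_vec (offs ds m)"
  shows "(\<forall>w\<in>block_prod ds m S. (\<Sum>i<m. h i (blk ds i x)) + s \<bullet> (w - x) \<le> (\<Sum>i<m. h i (blk ds i w))) \<longleftrightarrow>
    (\<forall>i<m. \<forall>x'\<in>S i. h i (blk ds i x) + blk ds i s \<bullet> (x' - blk ds i x) \<le> h i x')"
proof -
  define gap where "gap i v = h i v - h i (blk ds i x) - blk ds i s \<bullet> (v - blk ds i x)" for i v
  have gap_x: "gap i (blk ds i x) = 0" for i
    using scalar_prod_right_zero[OF blk_carrier, of ds i s] by (simp add: gap_def diff_self_vec)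
  have x_carrier: "x \<in> carrier_vec (offs ds m)" using x block_prod_subset by blast
  have sum_gap: "(\<Sum>i<m. h i (blk ds i x)) + s \<bullet> (w - x) \<le> (\<Sum>i<m. h i (blk ds i w)) \<longleftrightarrow>
      0 \<le> (\<Sum>i<m. gap i (blk ds i w))" if "w \<in> block_prod ds m S" for w
  proof -
    have "s \<bullet> (w - x) = (\<Sum>i<m. blk ds i s \<bullet> (blk ds i w - blk ds i x))"
      using x_carrier by (subst scalar_prod_blk[of _ ds m]) (auto simp: blk_diff[of _ _ m])
    then show ?thesis by (auto simp: gap_def sum_subtractf)
  qed
  have "(\<forall>w\<in>block_prod ds m S. 0 \<le> (\<Sum>i<m. gap i (blk ds i w))) \<longleftrightarrow> (\<forall>i<m. \<forall>x'\<in>S i. 0 \<le> gap i x')"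
  proof (intro iffI allI impI ballI)
    fix i x' assume all: "\<forall>w\<in>block_prod ds m S. 0 \<le> (\<Sum>i<m. gap i (blk ds i w))" and i: "i < m" "x' \<in> S i"
    define w where "w = stack m ((\<lambda>j. blk ds j x)(i := x'))"
    have carrier: "((\<lambda>j. blk ds j x)(i := x')) j \<in> carrier_vec (ds j)" if "j < m" for j
      using S[OF i(1)] i(2) by auto
    have blk_w: "blk ds j w = (if j = i then x' else blk ds j x)" if "j < m" for j
      unfolding w_def using blk_stack[of m "(\<lambda>j. blk ds j x)(i := x')", OF carrier that] by simp
    have "w \<in> block_prod ds m S"
      using stack_carrier[of m "(\<lambda>j. blk ds j x)(i := x')", OF carrier] x i(2) blk_w
      by (auto simp: block_prod_def w_def simp del: fun_upd_apply)
    then have "0 \<le> (\<Sum>j<m. gap j (blk ds j w))" using all by blast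
    also have "\<dots> = (\<Sum>j<m. if j = i then gap i x' else 0)"
      by (intro sum.cong) (auto simp: blk_w gap_x)
    finally show "0 \<le> gap i x'" using i(1) by simp
  qed (auto simp: block_prod_def intro!: sum_nonneg)
  then show ?thesis using sum_gap by (simp add: gap_def algebra_simps)
qed

lemma esubdiff_block_sum_iff:
  assumes F: "\<And>w. F w = (if \<forall>i<m. blk ds i w \<in> S i then ereal (\<Sum>i<m. h i (blk ds i w)) else \<infinity>)"
    and S: "\<And>i. i < m \<Longrightarrow> S i \<subseteq> carrier_vec (ds i)"
    and x: "x \<in> carrier_vec (offs ds m)" and s: "s \<in> carrier_vec (offs ds m)"
  shows "s \<in> esubdiff (offs ds m) F x \<longleftrightarrow> (\<forall>i<m. blk ds i x \<in> S i \<and>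
    (\<forall>x'\<in>S i. h i (blk ds i x) + blk ds i s \<bullet> (x' - blk ds i x) \<le> h i x'))"
proof (cases "x \<in> block_prod ds m S")
  case True
  then have "s \<in> esubdiff (offs ds m) F x \<longleftrightarrow>
      (\<forall>w\<in>block_prod ds m S. (\<Sum>i<m. h i (blk ds i x)) + s \<bullet> (w - x) \<le> (\<Sum>i<m. h i (blk ds i w)))"
    using x s by (auto simp: esubdiff_def F block_prod_def)
  also have "\<dots> \<longleftrightarrow> (\<forall>i<m. \<forall>x'\<in>S i. h i (blk ds i x) + blk ds i s \<bullet> (x' - blk ds i x) \<le> h i x')"
    by (rule block_sum_subgradient_iff[OF S True s])
  finally show ?thesis using True by (auto simp: block_prod_def)
qed (use x in \<open>auto simp: esubdiff_def F block_prod_def\<close>)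

lemma index_vsum [simp]: "c < d \<Longrightarrow> vsum d m F $ c = (\<Sum>i<m. F i $ c)"
  by (simp add: vsum_def)

lemma dim_vsum [simp]: "dim_vec (vsum d m F) = d"
  by (simp add: vsum_def)

lemma vsum_carrier [simp]: "vsum d m F \<in> carrier_vec d"
  by (simp add: carrier_vecI)

lemma scalar_prod_vsum:
  assumes "\<And>i. i < m \<Longrightarrow> F i \<in> carrier_vec d"
  shows "y \<bullet> vsum d m F = (\<Sum>i<m. y \<bullet> F i)"
proof -
  have "y \<bullet> vsum d m F = (\<Sum>i<m. \<Sum>c<d. y $ c * F i $ c)"
    by (simp add: scalar_prod_lessThan sum_distrib_left sum.swap[of _ "{..<m}"])
  also have "\<dots> = (\<Sum>i<m. y \<bullet> F i)"
    using carrier_vecD[OF assms] by (intro sum.cong) (auto simp: scalar_prod_lessThan)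
  finally show ?thesis .
qed

lemma vsum_Kcone: "(\<And>i. i < m \<Longrightarrow> u i \<in> Kcone p q) \<Longrightarrow> vsum (p + q) m u \<in> Kcone p q"
  by (auto simp: Kcone_def intro: sum_nonpos)

lemma K_convex_vsum_blk:
  assumes "\<And>i. i < m \<Longrightarrow> K_convex p q (ds i) (G i)"
  shows "K_convex p q (offs ds m) (\<lambda>x. vsum (p + q) m (\<lambda>i. G i (blk ds i x)))"
  unfolding K_convex_def
proof (intro conjI ballI vsum_carrier)
  fix w assume w: "w \<in> Kpol p q"
  have "w \<bullet> vsum (p + q) m (\<lambda>i. G i (blk ds i x)) = (\<Sum>i<m. w \<bullet> G i (blk ds i x))" for x
    by (intro scalar_prod_vsum K_convex_carrier[OF assms]) auto
  moreover have "proper_closed_convex (offs ds m) (\<lambda>x. \<Sum>i<m. w \<bullet> G i (blk ds i x))"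
    using assms w by (intro proper_closed_convex_sum proper_closed_convex_blk[where h = "\<lambda>x. w \<bullet> G _ x"])
      (auto simp: K_convex_def)
  ultimately show "proper_closed_convex (offs ds m) (\<lambda>x. w \<bullet> vsum (p + q) m (\<lambda>i. G i (blk ds i x)))"
    by simp
qed

section \<open>Quadratic forms\<close>

lemma eq_mat_if_mult_vec_eq:
  fixes A B :: "'a :: semiring_1 mat"
  assumes "A \<in> carrier_mat n l" "B \<in> carrier_mat n l" "\<And>v. v \<in> carrier_vec l \<Longrightarrow> A *\<^sub>v v = B *\<^sub>v v"
  shows "A = B"
proof (rule eq_matI)
  fix i j assume ij: "i < dim_row B" "j < dim_col B"
  have "(C *\<^sub>v unit_vec l j) $ i = C $$ (i, j)" if "C \<in> carrier_mat n l" for C :: "'a mat"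
    using that ij assms by (simp add: scalar_prod_right_unit)
  then show "A $$ (i, j) = B $$ (i, j)" using assms by (metis unit_vec_carrier)
qed (use assms in auto)

lemma minv_eqI:
  assumes A: "A \<in> carrier_mat n n" and B: "B \<in> carrier_mat n n" and AB: "A * B = 1\<^sub>m n"
  shows "minv A = B"
  unfolding minv_def
proof (rule the_equality)
  have "B * A = 1\<^sub>m n" by (rule mat_mult_left_right_inverse[OF A B AB])
  then show "B \<in> carrier_mat (dim_row A) (dim_row A) \<and> inverts_mat A B \<and> inverts_mat B A"
    using A B AB by (auto simp: inverts_mat_def)
  fix C assume "C \<in> carrier_mat (dim_row A) (dim_row A) \<and> inverts_mat A C \<and> inverts_mat C A"
  then have C: "C \<in> carrier_mat n n" "C * A = 1\<^sub>m n" using A by (auto simp: inverts_mat_def)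
  have "C = C * (A * B)" using C AB by simp
  also have "\<dots> = B" using C A B by (simp flip: assoc_mult_mat[OF C(1) A B])
  finally show "C = B" .
qed

lemma tendsto_qn: "H \<in> carrier_mat n n \<Longrightarrow> vconv s v \<Longrightarrow> v \<in> carrier_vec n \<Longrightarrow> (\<lambda>k. qn H (s k)) \<longlonglongrightarrow> qn H v"
  unfolding qn_def by (intro tendsto_scalar_prod vconv_mult_mat_vec) auto

lemma qn_smult: "H \<in> carrier_mat n n \<Longrightarrow> v \<in> carrier_vec n \<Longrightarrow> qn H (a \<cdot>\<^sub>v v) = a\<^sup>2 * qn H v"
  by (simp add: qn_def mult_mat_vec power2_eq_square)

lemma qn_sphere_min:
  assumes H: "H \<in> carrier_mat n n" and n: "0 < n"
  obtains e where "e \<in> carrier_vec n" "e \<bullet> e = 1" "\<And>v. v \<in> carrier_vec n \<Longrightarrow> qn H e * (v \<bullet> v) \<le> qn H v"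
proof -
  define S where "S = {v \<in> carrier_vec n. vnorm v = 1}"
  have closed: "vclosed n S" unfolding vclosed_def
  proof (intro conjI allI impI)
    fix s l assume s: "\<forall>k. s k \<in> S" and lim: "vconv s l"
    have "(\<lambda>k. vnorm (s k)) \<longlonglongrightarrow> vnorm l" using lim by (rule tendsto_vnorm)
    then have "vnorm l = 1" using s by (simp add: S_def LIMSEQ_const_iff)
    then show "l \<in> S" using vconv_carrier[OF lim, of _ n] s by (auto simp: S_def)
  qed (auto simp: S_def)
  have "unit_vec n 0 \<in> S" using n by (simp add: S_def vnorm_def)
  then have nonempty: "S \<noteq> {}" by blast
  have bounded: "vnorm v \<le> 1" if "v \<in> S" for v using that by (simp add: S_def)
  have "liminf_ge (\<lambda>k. qn H (s k)) (qn H v)" if "v \<in> S" "vconv s v" for s v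
    using that by (intro liminf_ge_if_tendsto tendsto_qn[OF H]) (auto simp: S_def)
  then obtain e where e: "e \<in> S" and min: "\<And>v. v \<in> S \<Longrightarrow> qn H e \<le> qn H v"
    using lsc_attains_min[OF nonempty closed bounded] by blast
  have "qn H e * (v \<bullet> v) \<le> qn H v" if v: "v \<in> carrier_vec n" for v
  proof (cases "v \<bullet> v = 0")
    case True
    then have "v = 0\<^sub>v n" using v by (simp add: scalar_prod_self_eq_0_iff)
    then show ?thesis using H by (simp add: qn_def scalar_prod_left_zero[OF mult_mat_vec_carrier[OF H]])
  next
    case False
    then have "0 < vnorm v" using scalar_prod_self_nonneg[of v] by (simp add: vnorm_def less_le)
    then have "(1 / vnorm v) \<cdot>\<^sub>v v \<in> S" using v by (simp add: S_def vnorm_smult)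
    then have "qn H e \<le> (1 / vnorm v)\<^sup>2 * qn H v" using min qn_smult[OF H v] by metis
    then show ?thesis using \<open>0 < vnorm v\<close> by (simp add: field_simps flip: vnorm_power2)
  qed
  then show ?thesis using that[of e] e by (auto simp: S_def simp flip: vnorm_power2)
qed

lemma eigenvector_if_qn_sphere_min:
  assumes H: "H \<in> carrier_mat n n" "H\<^sup>T = H" and e: "e \<in> carrier_vec n" "e \<bullet> e = 1"
    and min: "\<And>v. v \<in> carrier_vec n \<Longrightarrow> qn H e * (v \<bullet> v) \<le> qn H v"
  shows "H *\<^sub>v e = qn H e \<cdot>\<^sub>v e"
proof -
  define \<mu> where "\<mu> = qn H e"
  define r where "r = \<mu> \<cdot>\<^sub>v e - H *\<^sub>v e"
  have He: "H *\<^sub>v e \<in> carrier_vec n" and r: "r \<in> carrier_vec n" using H e by (auto simp: r_def)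
  have sym: "e \<bullet> (H *\<^sub>v r) = r \<bullet> (H *\<^sub>v e)"
    using transpose_vec_mult_scalar[OF H(1) r e(1)] H(2) comm_scalar_prod[OF He r] by simp
  have rr: "r \<bullet> r = \<mu> * (r \<bullet> e) - r \<bullet> (H *\<^sub>v e)"
    using H(1) r e by (subst (2) r_def) (simp add: scalar_prod_diff_right)
  have "t * (2 * (r \<bullet> r)) \<le> t * 0 + t\<^sup>2 * (qn H r - \<mu> * (r \<bullet> r))" for t
  proof -
    define w where "w = e + t \<cdot>\<^sub>v r"
    have w: "w \<in> carrier_vec n" using e r by (simp add: w_def)
    have "H *\<^sub>v w = H *\<^sub>v e + t \<cdot>\<^sub>v (H *\<^sub>v r)"
      unfolding w_def using e r by (simp add: mult_add_distrib_mat_vec[OF H(1)] mult_mat_vec[OF H(1)])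
    then have "qn H w = \<mu> + 2 * t * (r \<bullet> (H *\<^sub>v e)) + t\<^sup>2 * qn H r"
      using H(1) e r by (simp add: qn_def \<mu>_def w_def scalar_prod_distribs sym power2_eq_square algebra_simps)
    moreover have "w \<bullet> w = 1 + 2 * t * (r \<bullet> e) + t\<^sup>2 * (r \<bullet> r)"
      using e r by (simp add: w_def scalar_prod_distribs scalar_prod_commute[of e r] power2_eq_square algebra_simps)
    ultimately have "\<mu> * (1 + 2 * t * (r \<bullet> e) + t\<^sup>2 * (r \<bullet> r)) \<le> \<mu> + 2 * t * (r \<bullet> (H *\<^sub>v e)) + t\<^sup>2 * qn H r"
      using min[OF w] by (simp add: \<mu>_def)
    moreover have "t * (2 * (r \<bullet> r)) = 2 * t * (\<mu> * (r \<bullet> e) - r \<bullet> (H *\<^sub>v e))" unfolding rr by simp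
    ultimately show ?thesis by (simp add: algebra_simps)
  qed
  then have "2 * (r \<bullet> r) \<le> 0" by (rule le_if_le_add_quadratic)
  then have "r \<bullet> r = 0" using scalar_prod_self_nonneg[of r] by linarith
  then have "\<mu> \<cdot>\<^sub>v e - H *\<^sub>v e = 0\<^sub>v n"
    using carrier_vecD[OF r] by (simp add: scalar_prod_self_eq_0_iff flip: r_def)
  then show ?thesis using vec_eq_iff_diff_eq_0[of "\<mu> \<cdot>\<^sub>v e" n "H *\<^sub>v e"] e He by (simp add: \<mu>_def)
qed

lemma qn_le_lam_max:
  assumes L: "L \<in> carrier_mat n n" "L\<^sup>T = L" and v: "v \<in> carrier_vec n"
  shows "qn L v \<le> lam_max L * (v \<bullet> v)"
proof (cases "n = 0")
  case True
  then show ?thesis using v by (simp add: qn_def scalar_prod_lessThan)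
next
  case False
  have uminus: "- L \<in> carrier_mat n n" "(- L)\<^sup>T = - L" using L by (auto simp: transpose_uminus)
  have qn_uminus: "qn (- L) w = - qn L w" if "w \<in> carrier_vec n" for w
    using L that by (simp add: qn_def uminus_mult_mat_vec)
  obtain e where e: "e \<in> carrier_vec n" "e \<bullet> e = 1" and min: "\<And>w. w \<in> carrier_vec n \<Longrightarrow> qn (- L) e * (w \<bullet> w) \<le> qn (- L) w"
    using qn_sphere_min[OF uminus(1)] False by blast
  have "(- L) *\<^sub>v e = qn (- L) e \<cdot>\<^sub>v e" by (rule eigenvector_if_qn_sphere_min[OF uminus e min])
  then have "- (L *\<^sub>v e) = - (qn L e \<cdot>\<^sub>v e)"
    using L(1) e(1) qn_uminus[OF e(1)] by (auto simp: vec_eq_iff)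
  then have "L *\<^sub>v e = qn L e \<cdot>\<^sub>v e" by simp
  then have "eigenvalue L (qn L e)" using L e unfolding eigenvalue_def eigenvector_def by auto
  moreover have "char_poly L \<noteq> 0" using degree_monic_char_poly[OF L(1)] by auto
  then have "finite {c. eigenvalue L c}"
    unfolding eigenvalue_root_char_poly[OF L(1)] by (rule poly_roots_finite)
  ultimately have "qn L e \<le> lam_max L" unfolding lam_max_def by (intro Max_ge) auto
  then have "qn L e * (v \<bullet> v) \<le> lam_max L * (v \<bullet> v)" by (intro mult_right_mono) auto
  then show ?thesis using min[OF v] qn_uminus e v by simp
qed

definition positive_definite :: "nat \<Rightarrow> (real vec \<Rightarrow> real) \<Rightarrow> bool" where
  "positive_definite n h \<longleftrightarrow> h (0\<^sub>v n) = 0 \<and> (\<forall>v\<in>carrier_vec n. v \<noteq> 0\<^sub>v n \<longrightarrow> 0 < h v)"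

lemma positive_definite_nonneg: "positive_definite n h \<Longrightarrow> v \<in> carrier_vec n \<Longrightarrow> 0 \<le> h v"
  by (cases "v = 0\<^sub>v n") (auto simp: positive_definite_def less_imp_le)

lemma positive_definite_scalar_prod_self: "0 < a \<Longrightarrow> positive_definite n (\<lambda>v. a * (v \<bullet> v))"
  by (auto simp: positive_definite_def less_le scalar_prod_self_eq_0_iff)

lemma positive_definite_vnorm_le:
  assumes pd: "positive_definite n (qn H)" and H: "H \<in> carrier_mat n n"
  obtains c where "0 < c" "\<And>v. v \<in> carrier_vec n \<Longrightarrow> vnorm v \<le> c * sqrt (qn H v)"
proof (cases "n = 0")
  case True
  then show ?thesis using that[of 1] by (simp add: vnorm_def qn_def scalar_prod_lessThan)
next
  case False
  then obtain e where e: "e \<in> carrier_vec n" "e \<bullet> e = 1" and min: "\<And>v. v \<in> carrier_vec n \<Longrightarrow> qn H e * (v \<bullet> v) \<le> qn H v"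
    using qn_sphere_min[OF H] by blast
  have "e \<noteq> 0\<^sub>v n" using e by auto
  then have pos: "0 < qn H e" using pd e by (simp add: positive_definite_def)
  show ?thesis
  proof (rule that)
    show "0 < 1 / sqrt (qn H e)" using pos by simp
    fix v :: "real vec" assume "v \<in> carrier_vec n"
    then have "sqrt (qn H e * (v \<bullet> v)) \<le> sqrt (qn H v)" using min by (intro real_sqrt_le_mono)
    then show "vnorm v \<le> 1 / sqrt (qn H e) * sqrt (qn H v)"
      using pos by (simp add: vnorm_def real_sqrt_mult field_simps)
  qed
qed

section \<open>Full row rank\<close>

lemma full_row_rank_transpose_inj:
  assumes U: "U \<in> carrier_mat r m" "full_row_rank U" and z: "z \<in> carrier_vec r" "U\<^sup>T *\<^sub>v z = 0\<^sub>v m"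
  shows "z = 0\<^sub>v r"
proof -
  have "(\<Sum>i<r. z $ i * U $$ (i, j)) = (U\<^sup>T *\<^sub>v z) $ j" if "j < m" for j
    using that U(1) z(1) by (simp add: scalar_prod_lessThan mult.commute)
  then show ?thesis using U z unfolding full_row_rank_def by auto
qed

lemma full_row_rank_gram_inverse:
  assumes U: "U \<in> carrier_mat r m" "full_row_rank U"
  obtains B where "B \<in> carrier_mat r r" "U * U\<^sup>T * B = 1\<^sub>m r"
proof -
  have UT: "U\<^sup>T \<in> carrier_mat m r" using U by simp
  have S: "U * U\<^sup>T \<in> carrier_mat r r" using U UT by simp
  have "z = 0\<^sub>v r" if z: "z \<in> carrier_vec r" "(U * U\<^sup>T) *\<^sub>v z = 0\<^sub>v r" for z
  proof -
    define w where "w = U\<^sup>T *\<^sub>v z"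
    have w: "w \<in> carrier_vec m" using UT z by (simp add: w_def)
    have "U *\<^sub>v w = 0\<^sub>v r" using z assoc_mult_mat_vec[OF U(1) UT z(1)] by (simp add: w_def)
    then have "w \<bullet> w = 0"
      using transpose_vec_mult_scalar[OF U(1) w z(1)] z(1) by (simp add: w_def[symmetric])
    then have "w = 0\<^sub>v m" using w by (simp add: scalar_prod_self_eq_0_iff)
    then show ?thesis using full_row_rank_transpose_inj[OF U z(1)] by (simp add: w_def)
  qed
  then have "det (U * U\<^sup>T) \<noteq> 0" unfolding det_0_iff_vec_prod_zero_field[OF S] by blast
  then have "U * U\<^sup>T \<in> Units (ring_mat TYPE(real) r ())" by (rule det_non_zero_imp_unit[OF S])
  then show ?thesis using that by (auto simp: Units_def ring_mat_def)
qed

lemma range_transpose_if_orthogonal_kernel: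
  assumes U: "U \<in> carrier_mat r m" "full_row_rank U" and u: "u \<in> carrier_vec m"
    and orth: "\<And>v. v \<in> carrier_vec m \<Longrightarrow> U *\<^sub>v v = 0\<^sub>v r \<Longrightarrow> v \<bullet> u = 0"
  obtains z where "z \<in> carrier_vec r" "U\<^sup>T *\<^sub>v z = u"
proof -
  have UT: "U\<^sup>T \<in> carrier_mat m r" using U by simp
  obtain B where B: "B \<in> carrier_mat r r" "U * U\<^sup>T * B = 1\<^sub>m r" by (rule full_row_rank_gram_inverse[OF U])
  have Uu: "U *\<^sub>v u \<in> carrier_vec r" using U u by simp
  define z where "z = B *\<^sub>v (U *\<^sub>v u)"
  define e where "e = u - U\<^sup>T *\<^sub>v z"
  have z: "z \<in> carrier_vec r" using B U u by (simp add: z_def)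
  have UTz: "U\<^sup>T *\<^sub>v z \<in> carrier_vec m" and e: "e \<in> carrier_vec m" using UT z u by (auto simp: e_def)
  have "U *\<^sub>v (U\<^sup>T *\<^sub>v z) = U * U\<^sup>T *\<^sub>v z" using assoc_mult_mat_vec[OF U(1) UT z] by simp
  also have "\<dots> = U * U\<^sup>T * B *\<^sub>v (U *\<^sub>v u)"
    unfolding z_def using assoc_mult_mat_vec[OF mult_carrier_mat[OF U(1) UT] B(1) Uu] by simp
  finally have "U *\<^sub>v (U\<^sup>T *\<^sub>v z) = U *\<^sub>v u" using B(2) Uu by simp
  then have Ue: "U *\<^sub>v e = 0\<^sub>v r"
    unfolding e_def using mult_minus_distrib_mat_vec[OF U(1) u UTz] Uu by simp
  then have "e \<bullet> (U\<^sup>T *\<^sub>v z) = 0"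
    using transpose_vec_mult_scalar[OF UT z e] z by simp
  then have "e \<bullet> e = 0"
    using orth[OF e Ue] u U(1) by (subst (2) e_def) (simp add: scalar_prod_diff_right)
  then have "u - U\<^sup>T *\<^sub>v z = 0\<^sub>v m"
    using carrier_vecD[OF e] by (simp add: scalar_prod_self_eq_0_iff flip: e_def)
  then have "U\<^sup>T *\<^sub>v z = u" using vec_eq_iff_diff_eq_0[OF u UTz] by simp
  then show ?thesis using that z by blast
qed

lemma transpose_sq_le_lam_max:
  assumes U: "U \<in> carrier_mat r m" and z: "z \<in> carrier_vec r" and pos: "0 < lam_max (U\<^sup>T * U)"
  shows "(U\<^sup>T *\<^sub>v z) \<bullet> (U\<^sup>T *\<^sub>v z) \<le> lam_max (U\<^sup>T * U) * (z \<bullet> z)"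
proof -
  define \<mu> where "\<mu> = lam_max (U\<^sup>T * U)"
  define w where "w = U\<^sup>T *\<^sub>v z"
  have UT: "U\<^sup>T \<in> carrier_mat m r" using U by simp
  have w: "w \<in> carrier_vec m" and Uw: "U *\<^sub>v w \<in> carrier_vec r" using UT U z by (auto simp: w_def)
  have "(U *\<^sub>v w) \<bullet> (U *\<^sub>v w) = qn (U\<^sup>T * U) w"
    unfolding qn_def assoc_mult_mat_vec[OF UT U w] using transpose_vec_mult_scalar[OF UT Uw w] by simp
  also have "\<dots> \<le> \<mu> * (w \<bullet> w)"
    unfolding \<mu>_def using U UT w by (intro qn_le_lam_max[of _ m]) (auto simp: transpose_mult)
  finally have Uw_sq: "(U *\<^sub>v w) \<bullet> (U *\<^sub>v w) \<le> \<mu> * (w \<bullet> w)" .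
  have ww: "w \<bullet> w = z \<bullet> (U *\<^sub>v w)" using transpose_vec_mult_scalar[OF U w z] by (simp add: w_def)
  have "2 * (\<mu> * (w \<bullet> w)) \<le> \<mu> * (\<mu> * (z \<bullet> z)) + (U *\<^sub>v w) \<bullet> (U *\<^sub>v w)"
    using scalar_prod_le_half_squares[of "\<mu> \<cdot>\<^sub>v z" "U *\<^sub>v w"] z U by (simp add: ww)
  with Uw_sq have "\<mu> * (w \<bullet> w) \<le> \<mu> * (\<mu> * (z \<bullet> z))" by linarith
  then show ?thesis using pos by (simp add: \<mu>_def w_def)
qed

section \<open>Block matrices\<close>

lemma bdiag_carrier [simp]: "bdiag m ds cs \<in> carrier_mat (offs ds m) (offs ds m)"
proof -
  have "sum_list (map ds [0..<m]) = offs ds m"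
    by (simp add: offs_def sum_list_sum_nth atLeast0LessThan)
  then show ?thesis by (auto simp: bdiag_def dim_diag_block_mat o_def)
qed

lemma dim_bdiag [simp]: "dim_row (bdiag m ds cs) = offs ds m" "dim_col (bdiag m ds cs) = offs ds m"
  using bdiag_carrier by (rule carrier_matD)+

lemma bdiag_mult_carrier [simp]: "v \<in> carrier_vec (offs ds m) \<Longrightarrow> bdiag m ds cs *\<^sub>v v \<in> carrier_vec (offs ds m)"
  using bdiag_carrier by (rule mult_mat_vec_carrier)

lemma bdiag_cong: "(\<And>i. i < m \<Longrightarrow> cs i = cs' i) \<Longrightarrow> bdiag m ds cs = bdiag m ds cs'"
  unfolding bdiag_def by (intro arg_cong[of _ _ diag_block_mat] map_cong) auto

lemma bdiag_Suc:
  "bdiag (Suc m) ds cs = four_block_mat (bdiag m ds cs) (0\<^sub>m (offs ds m) (ds m)) (0\<^sub>m (ds m) (offs ds m)) (cs m \<cdot>\<^sub>m 1\<^sub>m (ds m))"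
  using bdiag_carrier[of m ds cs] unfolding bdiag_def by (simp add: diag_block_mat_last Let_def)

lemma smult_one_mult_vec: "v \<in> carrier_vec n \<Longrightarrow> (a \<cdot>\<^sub>m 1\<^sub>m n) *\<^sub>v v = a \<cdot>\<^sub>v (v :: 'a :: comm_semiring_1 vec)"
  by (auto simp: scalar_prod_left_unit)

lemma bdiag_mult_vec:
  "x \<in> carrier_vec (offs ds m) \<Longrightarrow> bdiag m ds cs *\<^sub>v x = stack m (\<lambda>i. cs i \<cdot>\<^sub>v blk ds i x)"
proof (induction m arbitrary: x)
  case 0
  then show ?case using bdiag_carrier[of 0 ds cs] by auto
next
  case (Suc m)
  define x1 where "x1 = vec_first x (offs ds m)"
  have x: "x = x1 @\<^sub>v blk ds m x"
    using Suc.prems by (auto simp: x1_def vec_first_def offs_Suc)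
  have x1: "x1 \<in> carrier_vec (offs ds m)" by (simp add: x1_def)
  have "blk ds i x = blk ds i x1" if "i < m" for i
    using that offs_less[of i m _ ds] by (auto simp: x1_def vec_first_def)
  then have "stack m (\<lambda>i. cs i \<cdot>\<^sub>v blk ds i x1) = stack m (\<lambda>i. cs i \<cdot>\<^sub>v blk ds i x)"
    by (intro stack_cong) auto
  moreover have "bdiag (Suc m) ds cs *\<^sub>v x = (bdiag m ds cs *\<^sub>v x1) @\<^sub>v (cs m \<cdot>\<^sub>v blk ds m x)"
    by (subst x, unfold bdiag_Suc, subst mult_mat_vec_split[of _ "offs ds m" _ "ds m"])
      (auto simp: x1 smult_one_mult_vec)
  ultimately show ?case using Suc.IH[OF x1] by simp
qed

lemma blk_bdiag_mult:
  assumes "dim_vec x = offs ds m" "i < m"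
  shows "blk ds i (bdiag m ds cs *\<^sub>v x) = cs i \<cdot>\<^sub>v blk ds i x"
  unfolding bdiag_mult_vec[OF carrier_vecI[OF assms(1)]] using assms(2) by (intro blk_stack) auto

lemma bdiag_mult_bdiag:
  "x \<in> carrier_vec (offs ds m) \<Longrightarrow> bdiag m ds cs *\<^sub>v (bdiag m ds cs' *\<^sub>v x) = bdiag m ds (\<lambda>i. cs i * cs' i) *\<^sub>v x"
  by (rule vec_eq_blkI[of _ ds m]) (auto simp: blk_bdiag_mult smult_smult_assoc)

lemma bdiag_one: "x \<in> carrier_vec (offs ds m) \<Longrightarrow> bdiag m ds (\<lambda>_. 1) *\<^sub>v x = x"
  by (rule vec_eq_blkI[of _ ds m]) (auto simp: blk_bdiag_mult)

lemma bdiag_inverse_mult: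
  assumes "\<And>i. i < m \<Longrightarrow> cs i * cs' i = 1" "x \<in> carrier_vec (offs ds m)"
  shows "bdiag m ds cs *\<^sub>v (bdiag m ds cs' *\<^sub>v x) = x"
  using assms bdiag_cong[of m "\<lambda>i. cs i * cs' i" "\<lambda>_. 1"] by (simp add: bdiag_mult_bdiag bdiag_one)

lemma minv_bdiag:
  assumes "\<And>i. i < m \<Longrightarrow> cs i \<noteq> 0"
  shows "minv (bdiag m ds cs) = bdiag m ds (\<lambda>i. 1 / cs i)"
proof (rule minv_eqI)
  show "bdiag m ds cs * bdiag m ds (\<lambda>i. 1 / cs i) = 1\<^sub>m (offs ds m)"
    by (rule eq_mat_if_mult_vec_eq)
      (auto simp: assoc_mult_mat_vec[OF bdiag_carrier bdiag_carrier] assms bdiag_inverse_mult intro: mult_carrier_mat)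
qed auto

lemma scalar_prod_bdiag:
  assumes "dim_vec x = offs ds m" "dim_vec y = offs ds m"
  shows "x \<bullet> (bdiag m ds cs *\<^sub>v y) = (\<Sum>i<m. cs i * (blk ds i x \<bullet> blk ds i y))"
  using assms by (subst scalar_prod_blk[of _ ds m]) (auto simp: blk_bdiag_mult intro!: sum.cong)

lemma scalar_prod_bdiag_left:
  assumes "dim_vec x = offs ds m" "dim_vec y = offs ds m"
  shows "(bdiag m ds cs *\<^sub>v x) \<bullet> y = x \<bullet> (bdiag m ds cs *\<^sub>v y)"
  unfolding scalar_prod_bdiag[OF assms]
  using assms by (subst scalar_prod_blk[of _ ds m]) (auto simp: blk_bdiag_mult intro!: sum.cong)

lemma positive_definite_bdiag:
  assumes "\<And>i. i < m \<Longrightarrow> 0 < cs i"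
  shows "positive_definite (offs ds m) (qn (bdiag m ds cs))"
  unfolding positive_definite_def
proof (intro conjI ballI impI)
  show "qn (bdiag m ds cs) (0\<^sub>v (offs ds m)) = 0"
    unfolding qn_def by (intro scalar_prod_left_zero bdiag_mult_carrier) simp
  fix v :: "real vec" assume v: "v \<in> carrier_vec (offs ds m)" "v \<noteq> 0\<^sub>v (offs ds m)"
  have nonneg: "0 \<le> cs i * (blk ds i v \<bullet> blk ds i v)" if "i < m" for i
    using assms[OF that] by (simp add: less_imp_le)
  have "\<exists>i<m. blk ds i v \<noteq> 0\<^sub>v (ds i)"
    using v vec_eq_blkI[of v ds m "0\<^sub>v (offs ds m)"] by (auto simp: blk_zero)
  then obtain i where i: "i < m" "0 < cs i * (blk ds i v \<bullet> blk ds i v)"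
    using assms scalar_prod_self_nonneg by (metis dim_blk less_le mult_pos_pos scalar_prod_self_eq_0_iff)
  then have "0 < (\<Sum>i<m. cs i * (blk ds i v \<bullet> blk ds i v))"
    using nonneg by (intro sum_pos2[of _ i]) auto
  then show "0 < qn (bdiag m ds cs) v" using v by (simp add: qn_def scalar_prod_bdiag)
qed

definition block3_upper :: "nat \<Rightarrow> nat \<Rightarrow> nat \<Rightarrow> real mat \<Rightarrow> real mat \<Rightarrow> real mat \<Rightarrow> real mat \<Rightarrow> real mat" where
  "block3_upper n1 n2 n3 A B C D =
     four_block_mat A (0\<^sub>m n1 (n2 + n3)) (0\<^sub>m (n2 + n3) n1) (four_block_mat B C (0\<^sub>m n3 n2) D)"

lemma block3_upper_carrier:
  assumes "A \<in> carrier_mat n1 n1" "B \<in> carrier_mat n2 n2" "D \<in> carrier_mat n3 n3"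
  shows "block3_upper n1 n2 n3 A B C D \<in> carrier_mat (n1 + (n2 + n3)) (n1 + (n2 + n3))"
  unfolding block3_upper_def using assms by (intro four_block_carrier_mat)

lemma block3_upper_mult_vec:
  assumes "A \<in> carrier_mat n1 n1" "B \<in> carrier_mat n2 n2" "C \<in> carrier_mat n2 n3" "D \<in> carrier_mat n3 n3"
    and "a \<in> carrier_vec n1" "u \<in> carrier_vec n2" "c \<in> carrier_vec n3"
  shows "block3_upper n1 n2 n3 A B C D *\<^sub>v (a @\<^sub>v u @\<^sub>v c) = (A *\<^sub>v a) @\<^sub>v (B *\<^sub>v u + C *\<^sub>v c) @\<^sub>v (D *\<^sub>v c)"
proof -
  have "four_block_mat B C (0\<^sub>m n3 n2) D *\<^sub>v (u @\<^sub>v c) = (B *\<^sub>v u + C *\<^sub>v c) @\<^sub>v (0\<^sub>m n3 n2 *\<^sub>v u + D *\<^sub>v c)"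
    using assms by (intro four_block_mat_mult_vec) auto
  also have "0\<^sub>m n3 n2 *\<^sub>v u + D *\<^sub>v c = D *\<^sub>v c"
    using assms by (intro eq_vecI) (auto simp: scalar_prod_left_zero)
  finally have inner: "four_block_mat B C (0\<^sub>m n3 n2) D *\<^sub>v (u @\<^sub>v c) = (B *\<^sub>v u + C *\<^sub>v c) @\<^sub>v (D *\<^sub>v c)" .
  show ?thesis
    unfolding block3_upper_def inner[symmetric] using assms by (intro mult_mat_vec_split four_block_carrier_mat) auto
qed

lemma append3_carrier:
  "x \<in> carrier_vec n1 \<Longrightarrow> y \<in> carrier_vec n2 \<Longrightarrow> z \<in> carrier_vec n3 \<Longrightarrow> x @\<^sub>v y @\<^sub>v z \<in> carrier_vec (n1 + (n2 + n3))"
  by (intro append_carrier_vec)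

lemma vec_first_last_append3:
  assumes "x \<in> carrier_vec n1" "y \<in> carrier_vec n2" "z \<in> carrier_vec n3"
  shows "vec_first (x @\<^sub>v y @\<^sub>v z) n1 = x"
    "vec_first (vec_last (x @\<^sub>v y @\<^sub>v z) (n2 + n3)) n2 = y"
    "vec_last (x @\<^sub>v y @\<^sub>v z) n3 = z"
  using assms by (auto simp: vec_first_def vec_last_def)

lemma append3_cases:
  assumes "v \<in> carrier_vec (n1 + (n2 + n3))"
  obtains x y z where "x \<in> carrier_vec n1" "y \<in> carrier_vec n2" "z \<in> carrier_vec n3" "v = x @\<^sub>v y @\<^sub>v z"
proof
  have "vec_last v (n2 + n3) = vec_first (vec_last v (n2 + n3)) n2 @\<^sub>v vec_last (vec_last v (n2 + n3)) n3"
    by simp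
  then show "v = vec_first v n1 @\<^sub>v vec_first (vec_last v (n2 + n3)) n2 @\<^sub>v vec_last (vec_last v (n2 + n3)) n3"
    using assms vec_first_last_append[of v n1 "n2 + n3"] by simp
qed auto

lemma zero_vec_append3: "0\<^sub>v (n1 + (n2 + n3)) = 0\<^sub>v n1 @\<^sub>v 0\<^sub>v n2 @\<^sub>v (0\<^sub>v n3 :: 'a :: zero vec)"
  by (intro eq_vecI) auto

lemma positive_definite_append3:
  assumes pd: "positive_definite n1 h1" "positive_definite n2 h2" "positive_definite n3 h3"
    and h: "\<And>x y z. x \<in> carrier_vec n1 \<Longrightarrow> y \<in> carrier_vec n2 \<Longrightarrow> z \<in> carrier_vec n3 \<Longrightarrow>
      h (x @\<^sub>v y @\<^sub>v z) = h1 x + h2 y + h3 z"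
  shows "positive_definite (n1 + (n2 + n3)) h"
  unfolding positive_definite_def
proof (intro conjI ballI impI)
  show "h (0\<^sub>v (n1 + (n2 + n3))) = 0" using pd by (simp add: zero_vec_append3 h positive_definite_def)
  fix v :: "real vec" assume v: "v \<in> carrier_vec (n1 + (n2 + n3))" "v \<noteq> 0\<^sub>v (n1 + (n2 + n3))"
  obtain x y z where c: "x \<in> carrier_vec n1" "y \<in> carrier_vec n2" "z \<in> carrier_vec n3" and v_eq: "v = x @\<^sub>v y @\<^sub>v z"
    using v(1) by (rule append3_cases)
  have "x \<noteq> 0\<^sub>v n1 \<or> y \<noteq> 0\<^sub>v n2 \<or> z \<noteq> 0\<^sub>v n3" using v(2) by (auto simp: v_eq zero_vec_append3)
  then have "0 < h1 x \<or> 0 < h2 y \<or> 0 < h3 z" using pd c by (auto simp: positive_definite_def)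
  moreover have "0 \<le> h1 x" "0 \<le> h2 y" "0 \<le> h3 z" using pd c by (auto intro: positive_definite_nonneg)
  ultimately show "0 < h v" using h[OF c] by (auto simp: v_eq)
qed

lemma append_diff_vec:
  fixes x x' y y' :: "'a :: ab_group_add vec"
  assumes "dim_vec x = dim_vec x'" "dim_vec y = dim_vec y'"
  shows "(x @\<^sub>v y) - (x' @\<^sub>v y') = (x - x') @\<^sub>v (y - y')"
  using assms by (intro eq_vecI) auto

lemma scalar_prod_append_dim:
  assumes "dim_vec x = dim_vec x'" "dim_vec y = dim_vec y'"
  shows "(x @\<^sub>v y) \<bullet> (x' @\<^sub>v y') = x \<bullet> x' + y \<bullet> (y' :: 'a :: comm_semiring_0 vec)"
  by (rule scalar_prod_append[OF carrier_vecI[OF assms(1)] carrier_vecI[OF assms(2)] carrier_vecI[OF refl] carrier_vecI[OF refl]])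

lemma scalar_prod_append3:
  assumes "dim_vec x = dim_vec x'" "dim_vec y = dim_vec y'" "dim_vec z = dim_vec z'"
  shows "(x @\<^sub>v y @\<^sub>v z) \<bullet> (x' @\<^sub>v y' @\<^sub>v z') = x \<bullet> x' + y \<bullet> y' + z \<bullet> (z' :: 'a :: comm_semiring_0 vec)"
  using assms by (simp add: scalar_prod_append_dim add.assoc)

lemma vnorm_le_vnorm_append3: "vnorm x \<le> vnorm (x @\<^sub>v y @\<^sub>v z)"
  by (simp add: vnorm_def scalar_prod_append3)

lemma vconv_append3D:
  assumes lim: "vconv (\<lambda>k. s k @\<^sub>v t k @\<^sub>v u k) (x @\<^sub>v y @\<^sub>v z)"
    and dims: "\<And>k. dim_vec (s k) = dim_vec x" "\<And>k. dim_vec (t k) = dim_vec y"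
  shows "vconv s x" "vconv t y" "vconv u z"
  using vconv_appendD[OF lim dims(1)] vconv_appendD[OF vconv_appendD(2)[OF lim dims(1)] dims(2)] by auto

section \<open>Kronecker products with an identity\<close>

lemma dim_kron [simp]: "dim_row (kron A B) = dim_row A * dim_row B" "dim_col (kron A B) = dim_col A * dim_col B"
  by (simp_all add: kron_def)

lemma kron_one_carrier: "V \<in> carrier_mat a b \<Longrightarrow> kron V (1\<^sub>m d) \<in> carrier_mat (a * d) (b * d)"
  by (auto intro!: carrier_matI)

lemma block_index_less: "(j::nat) < a \<Longrightarrow> c < d \<Longrightarrow> j * d + c < a * d"
  using offs_less[of j a c "\<lambda>_. d"] by simp

lemma index_kron_one:
  assumes "j < dim_row V" "i < dim_col V" "c < d" "e < d"
  shows "kron V (1\<^sub>m d) $$ (j * d + c, i * d + e) = (if c = e then V $$ (j, i) else 0)"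
  using assms block_index_less[of j "dim_row V" c d] block_index_less[of i "dim_col V" e d] by (auto simp: kron_def)

lemma transpose_kron_one: "(kron V (1\<^sub>m d))\<^sup>T = kron V\<^sup>T (1\<^sub>m d)"
proof (rule eq_matI)
  fix i j assume "i < dim_row (kron V\<^sup>T (1\<^sub>m d))" "j < dim_col (kron V\<^sup>T (1\<^sub>m d))"
  then have ij: "i < dim_col V * d" "j < dim_row V * d" by simp_all
  then have "i div d < dim_col V" "j div d < dim_row V" "i mod d < d" "j mod d < d"
    by (auto simp: less_mult_imp_div_less) (metis less_nat_zero_code mod_less_divisor mult_0_right neq0_conv)+
  then show "(kron V (1\<^sub>m d))\<^sup>T $$ (i, j) = kron V\<^sup>T (1\<^sub>m d) $$ (i, j)"
    using ij by (auto simp: kron_def)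
qed simp_all

definition comp_vec :: "nat \<Rightarrow> nat \<Rightarrow> real vec \<Rightarrow> nat \<Rightarrow> real vec" where
  "comp_vec d n y c = vec n (\<lambda>i. blk (\<lambda>_. d) i y $ c)"

lemma comp_vec_carrier [simp]: "comp_vec d n y c \<in> carrier_vec n"
  by (simp add: comp_vec_def)

lemma dim_comp_vec [simp]: "dim_vec (comp_vec d n y c) = n"
  by (simp add: comp_vec_def)

lemma comp_vec_kron_one:
  assumes V: "V \<in> carrier_mat a b" and y: "dim_vec y = b * d" and c: "c < d"
  shows "comp_vec d a (kron V (1\<^sub>m d) *\<^sub>v y) c = V *\<^sub>v comp_vec d b y c"
proof (rule eq_vecI)
  fix j assume "j < dim_vec (V *\<^sub>v comp_vec d b y c)"
  then have j: "j < a" using V by simp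
  have jc: "j * d + c < a * d" using block_index_less[OF j c] .
  have "comp_vec d a (kron V (1\<^sub>m d) *\<^sub>v y) c $ j = row (kron V (1\<^sub>m d)) (j * d + c) \<bullet> y"
    using c j jc V by (simp add: comp_vec_def)
  also have "\<dots> = (\<Sum>i<b. \<Sum>e<d. kron V (1\<^sub>m d) $$ (j * d + c, i * d + e) * y $ (i * d + e))"
    using jc y V block_index_less[of _ b _ d]
    by (subst scalar_prod_blk[of _ "\<lambda>_. d" b]) (auto simp: scalar_prod_lessThan)
  also have "\<dots> = (\<Sum>i<b. \<Sum>e<d. if c = e then V $$ (j, i) * y $ (i * d + e) else 0)"
    using V j c by (intro sum.cong) (auto simp: index_kron_one)
  also have "\<dots> = (V *\<^sub>v comp_vec d b y c) $ j" using V c j by (simp add: comp_vec_def scalar_prod_lessThan)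
  finally show "comp_vec d a (kron V (1\<^sub>m d) *\<^sub>v y) c $ j = (V *\<^sub>v comp_vec d b y c) $ j" .
qed (use V in simp)

lemma blk_eq_comp_vec: "i < n \<Longrightarrow> c < d \<Longrightarrow> blk (\<lambda>_. d) i y $ c = comp_vec d n y c $ i"
  by (simp add: comp_vec_def)

lemma vec_eq_comp_vecI:
  assumes "dim_vec x = n * d" "dim_vec y = n * d" "\<And>c. c < d \<Longrightarrow> comp_vec d n x c = comp_vec d n y c"
  shows "x = y"
proof (rule vec_eq_blkI[of _ "\<lambda>_. d" n])
  fix i assume i: "i < n"
  show "blk (\<lambda>_. d) i x = blk (\<lambda>_. d) i y"
    by (rule eq_vecI) (use assms(3) blk_eq_comp_vec[OF i] in \<open>simp_all del: index_blk\<close>)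
qed (use assms in simp_all)

lemma scalar_prod_comp_vec:
  assumes "dim_vec y = n * d"
  shows "x \<bullet> y = (\<Sum>c<d. comp_vec d n x c \<bullet> comp_vec d n y c)"
proof -
  have "x \<bullet> y = (\<Sum>i<n. \<Sum>c<d. blk (\<lambda>_. d) i x $ c * blk (\<lambda>_. d) i y $ c)"
    using assms by (subst scalar_prod_blk[of _ "\<lambda>_. d" n]) (auto simp: scalar_prod_lessThan)
  also have "\<dots> = (\<Sum>c<d. comp_vec d n x c \<bullet> comp_vec d n y c)"
    by (subst sum.swap) (simp add: comp_vec_def scalar_prod_lessThan)
  finally show ?thesis .
qed

lemma comp_vec_zero: "c < d \<Longrightarrow> comp_vec d n (0\<^sub>v (n * d)) c = 0\<^sub>v n"
  by (auto simp: comp_vec_def block_index_less)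

lemma comp_vec_stack:
  assumes "\<And>i. i < n \<Longrightarrow> vs i \<in> carrier_vec d" "c < d"
  shows "comp_vec d n (stack n vs) c = vec n (\<lambda>i. vs i $ c)"
  using blk_stack[of n vs "\<lambda>_. d"] assms by (auto simp: comp_vec_def simp del: index_blk)

lemma kron_transpose_inj:
  assumes U: "U \<in> carrier_mat r m" "full_row_rank U"
    and z: "z \<in> carrier_vec (r * d)" "z' \<in> carrier_vec (r * d)"
    and eq: "kron U\<^sup>T (1\<^sub>m d) *\<^sub>v z = kron U\<^sup>T (1\<^sub>m d) *\<^sub>v z'"
  shows "z = z'"
proof (rule vec_eq_comp_vecI[of _ r d])
  fix c assume c: "c < d"
  have UT: "U\<^sup>T \<in> carrier_mat m r" using U by simp
  have "U\<^sup>T *\<^sub>v comp_vec d r z c = U\<^sup>T *\<^sub>v comp_vec d r z' c"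
    using arg_cong[OF eq, of "\<lambda>y. comp_vec d m y c"] comp_vec_kron_one[OF UT _ c] z by simp
  then have "U\<^sup>T *\<^sub>v (comp_vec d r z c - comp_vec d r z' c) = 0\<^sub>v m"
    using mult_minus_distrib_mat_vec[OF UT comp_vec_carrier comp_vec_carrier] mult_mat_vec_carrier[OF UT comp_vec_carrier]
    by simp
  then have "comp_vec d r z c - comp_vec d r z' c = 0\<^sub>v r"
    by (intro full_row_rank_transpose_inj[OF U]) simp
  then show "comp_vec d r z c = comp_vec d r z' c"
    using vec_eq_iff_diff_eq_0[OF comp_vec_carrier comp_vec_carrier] by blast
qed (use z in simp_all)

lemma kron_transpose_range:
  assumes U: "U \<in> carrier_mat r m" "full_row_rank U" and u: "u \<in> carrier_vec (m * d)"
    and orth: "\<And>v c. v \<in> carrier_vec m \<Longrightarrow> U *\<^sub>v v = 0\<^sub>v r \<Longrightarrow> c < d \<Longrightarrow> v \<bullet> comp_vec d m u c = 0"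
  obtains z where "z \<in> carrier_vec (r * d)" "kron U\<^sup>T (1\<^sub>m d) *\<^sub>v z = u"
proof -
  have UT: "U\<^sup>T \<in> carrier_mat m r" using U by simp
  have "\<exists>z\<in>carrier_vec r. U\<^sup>T *\<^sub>v z = comp_vec d m u c" if "c < d" for c
    using range_transpose_if_orthogonal_kernel[OF U comp_vec_carrier orth] that by blast
  then obtain zc where zc: "\<And>c. c < d \<Longrightarrow> zc c \<in> carrier_vec r" "\<And>c. c < d \<Longrightarrow> U\<^sup>T *\<^sub>v zc c = comp_vec d m u c"
    by metis
  define z where "z = stack r (\<lambda>j. vec d (\<lambda>c. zc c $ j))"
  have z: "z \<in> carrier_vec (r * d)" using stack_carrier[of r "\<lambda>j. vec d (\<lambda>c. zc c $ j)" "\<lambda>_. d"] by (simp add: z_def)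
  have "comp_vec d r z c = zc c" if "c < d" for c
    unfolding z_def using zc(1)[OF that] that by (subst comp_vec_stack) auto
  then have "comp_vec d m (kron U\<^sup>T (1\<^sub>m d) *\<^sub>v z) c = comp_vec d m u c" if "c < d" for c
    using comp_vec_kron_one[OF UT carrier_vecD[OF z] that] zc(2)[OF that] that by simp
  then have "kron U\<^sup>T (1\<^sub>m d) *\<^sub>v z = u"
    by (rule vec_eq_comp_vecI[of _ m d, rotated 2]) (use u U in simp_all)
  then show ?thesis using that z by blast
qed

lemma kron_transpose_sq_le_lam_max:
  assumes U: "U \<in> carrier_mat r m" and z: "z \<in> carrier_vec (r * d)" and pos: "0 < lam_max (U\<^sup>T * U)"
  shows "(kron U\<^sup>T (1\<^sub>m d) *\<^sub>v z) \<bullet> (kron U\<^sup>T (1\<^sub>m d) *\<^sub>v z) \<le> lam_max (U\<^sup>T * U) * (z \<bullet> z)"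
proof -
  have UT: "U\<^sup>T \<in> carrier_mat m r" using U by simp
  have z: "dim_vec z = r * d" using z by simp
  have "(kron U\<^sup>T (1\<^sub>m d) *\<^sub>v z) \<bullet> (kron U\<^sup>T (1\<^sub>m d) *\<^sub>v z)
      = (\<Sum>c<d. (U\<^sup>T *\<^sub>v comp_vec d r z c) \<bullet> (U\<^sup>T *\<^sub>v comp_vec d r z c))"
    using U by (subst scalar_prod_comp_vec[of _ m d]) (auto simp: comp_vec_kron_one[OF UT z])
  also have "\<dots> \<le> (\<Sum>c<d. lam_max (U\<^sup>T * U) * (comp_vec d r z c \<bullet> comp_vec d r z c))"
    by (intro sum_mono transpose_sq_le_lam_max[OF U _ pos]) simp
  also have "\<dots> = lam_max (U\<^sup>T * U) * (z \<bullet> z)"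
    unfolding scalar_prod_comp_vec[OF z] by (simp add: sum_distrib_left)
  finally show ?thesis .
qed

section \<open>Subgradients of the saddle function\<close>

locale dpmm_problem =
  fixes m p q r :: nat
    and nd :: "nat \<Rightarrow> nat"
    and f :: "nat \<Rightarrow> real vec \<Rightarrow> real"
    and A :: "nat \<Rightarrow> real mat" and b :: "nat \<Rightarrow> real vec"
    and g :: "nat \<Rightarrow> real vec \<Rightarrow> real vec"
    and \<Omega> :: "nat \<Rightarrow> real vec set"
    and L U :: "real mat"
  assumes m_pos: "0 < m"
    and A_dim: "\<forall>i<m. A i \<in> carrier_mat p (nd i)"
    and b_dim: "\<forall>i<m. b i \<in> carrier_vec p"
    and g_dim: "\<forall>i<m. \<forall>x\<in>carrier_vec (nd i). g i x \<in> carrier_vec q"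
    and L_null: "{v \<in> carrier_vec m. L *\<^sub>v v = 0\<^sub>v m} = {c \<cdot>\<^sub>v vec m (\<lambda>_. 1) | c. True}"
    and U_dim: "U \<in> carrier_mat r m"
    and L_UU: "L = U\<^sup>T * U"
    and U_rank: "full_row_rank U"
    and U_one: "U *\<^sub>v vec m (\<lambda>_. 1) = 0\<^sub>v r"
    and f_cvx: "\<forall>i<m. proper_closed_convex (nd i) (f i)"
    and g_cvx: "\<forall>i<m. \<forall>c<q. proper_closed_convex (nd i) (\<lambda>x. g i x $ c)"
    and \<Omega>_closed: "\<forall>i<m. vclosed (nd i) (\<Omega> i)"
    and \<Omega>_cvx: "\<forall>i<m. vconvex_set (nd i) (\<Omega> i)"
begin

abbreviation "G \<equiv> Gfun A b g"
abbreviation "pq \<equiv> p + q"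
abbreviation "N \<equiv> offs nd m"
abbreviation "MY \<equiv> m * pq"
abbreviation "RZ \<equiv> r * pq"
abbreviation "blx \<equiv> blk nd"
abbreviation "bly \<equiv> blk (\<lambda>_. pq)"
abbreviation "bU \<equiv> kron U (1\<^sub>m pq)"
abbreviation "bUT \<equiv> kron U\<^sup>T (1\<^sub>m pq)"
abbreviation "lag \<equiv> Lag m nd f A b g \<Omega> p q"
abbreviation "Phi0 \<equiv> PhiZero m nd f A b g \<Omega> p q U"

lemma dim_U [simp]: "dim_row U = r" "dim_col U = m"
  using U_dim by auto

lemma UT_dim: "U\<^sup>T \<in> carrier_mat m r"
  using U_dim by simp

lemma bU_carrier: "bU \<in> carrier_mat RZ MY"
  using U_dim by (rule kron_one_carrier)

lemma bUT_carrier: "bUT \<in> carrier_mat MY RZ"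
  using UT_dim by (rule kron_one_carrier)

lemma bU_mult_carrier [simp]: "bU *\<^sub>v Y \<in> carrier_vec RZ"
  by (simp add: carrier_vecI)

lemma bUT_mult_carrier [simp]: "bUT *\<^sub>v Z \<in> carrier_vec MY"
  by (simp add: carrier_vecI)

lemma U_kernel:
  assumes v: "v \<in> carrier_vec m" "U *\<^sub>v v = 0\<^sub>v r"
  obtains c where "v = c \<cdot>\<^sub>v vec m (\<lambda>_. 1)"
proof -
  have "U\<^sup>T *\<^sub>v 0\<^sub>v r = 0\<^sub>v m" by (rule mult_mat_zero_vec[OF UT_dim])
  then have "L *\<^sub>v v = 0\<^sub>v m" unfolding L_UU assoc_mult_mat_vec[OF UT_dim U_dim v(1)] v(2) .
  then have "v \<in> {c \<cdot>\<^sub>v vec m (\<lambda>_. 1) | c. True}" using v(1) unfolding L_null[symmetric] by simp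
  then show ?thesis using that by blast
qed

lemma \<Omega>_carrier: "i < m \<Longrightarrow> x \<in> \<Omega> i \<Longrightarrow> x \<in> carrier_vec (nd i)"
  using \<Omega>_closed vclosed_carrier by blast

lemma G_K_convex: "i < m \<Longrightarrow> K_convex p q (nd i) (G i)"
  unfolding Gfun_def using A_dim b_dim g_dim g_cvx by (intro K_convex_affine_append) auto

lemma G_carrier: "i < m \<Longrightarrow> x \<in> carrier_vec (nd i) \<Longrightarrow> G i x \<in> carrier_vec pq"
  using G_K_convex by (rule K_convex_carrier)

lemma dim_G: "i < m \<Longrightarrow> x \<in> carrier_vec (nd i) \<Longrightarrow> dim_vec (G i x) = pq"
  using G_carrier by (rule carrier_vecD)

lemma G_blk_carrier [simp]: "i < m \<Longrightarrow> G i (blx i x) \<in> carrier_vec pq"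
  by (rule G_carrier) simp_all

text \<open>\<open>e \<in> \<partial>\<^sub>x \<ell>\<^sub>i(x, y)\<close> and \<open>l \<in> \<partial>\<^sub>y \<ell>\<^sub>i(x, y)\<close>.\<close>

definition ell_subgradient :: "nat \<Rightarrow> real vec \<Rightarrow> real vec \<Rightarrow> real vec \<Rightarrow> real vec \<Rightarrow> bool" where
  "ell_subgradient i x y e l \<longleftrightarrow> x \<in> \<Omega> i \<and> y \<in> Kpol p q \<and>
     (\<forall>x'\<in>\<Omega> i. f i x + y \<bullet> G i x + e \<bullet> (x' - x) \<le> f i x' + y \<bullet> G i x') \<and>
     (\<forall>y'\<in>Kpol p q. (y' - y) \<bullet> (G i x - l) \<le> 0)"

lemma ell_subgradient_monotone:
  assumes i: "i < m" and s: "ell_subgradient i x y e l" "ell_subgradient i x' y' e' l'"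
    and e: "e \<in> carrier_vec (nd i)" "e' \<in> carrier_vec (nd i)" and l: "l \<in> carrier_vec pq" "l' \<in> carrier_vec pq"
  shows "0 \<le> (x - x') \<bullet> (e - e') + (y - y') \<bullet> (l' - l)"
proof -
  have mem: "x \<in> \<Omega> i" "x' \<in> \<Omega> i" "y \<in> Kpol p q" "y' \<in> Kpol p q" using s by (auto simp: ell_subgradient_def)
  note dims = \<Omega>_carrier[OF i mem(1), THEN carrier_vecD] \<Omega>_carrier[OF i mem(2), THEN carrier_vecD]
    mem(3,4)[THEN dim_Kpol] dim_G[OF i \<Omega>_carrier[OF i mem(1)]] dim_G[OF i \<Omega>_carrier[OF i mem(2)]]
  have "f i x + y \<bullet> G i x + e \<bullet> (x' - x) \<le> f i x' + y \<bullet> G i x'"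
    "f i x' + y' \<bullet> G i x' + e' \<bullet> (x - x') \<le> f i x + y' \<bullet> G i x"
    "(y' - y) \<bullet> (G i x - l) \<le> 0" "(y - y') \<bullet> (G i x' - l') \<le> 0"
    using s mem by (auto simp: ell_subgradient_def)
  moreover have "(x - x') \<bullet> (e - e') = - (e \<bullet> (x' - x)) - e' \<bullet> (x - x')"
    using dims e by (simp add: scalar_prod_distribs scalar_prod_commute[of e] scalar_prod_commute[of e'])
  ultimately show ?thesis using dims l by (simp add: scalar_prod_distribs)
qed

lemma ell_subgradient_iff:
  assumes i: "i < m" and l: "l \<in> carrier_vec pq"
  shows "ell_subgradient i x y e l \<longleftrightarrow> x \<in> \<Omega> i \<and> y \<in> Kpol p q \<and>
    (\<forall>x'\<in>\<Omega> i. f i x + y \<bullet> G i x + e \<bullet> (x' - x) \<le> f i x' + y \<bullet> G i x') \<and>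
    G i x - l \<in> Kcone p q \<and> y \<bullet> G i x = y \<bullet> l"
proof (cases "x \<in> \<Omega> i \<and> y \<in> Kpol p q")
  case True
  then have "dim_vec (G i x) = pq" using i by (intro dim_G \<Omega>_carrier) simp_all
  then show ?thesis
    using True l Kpol_variational_iff[of y p q "G i x - l"] by (auto simp: ell_subgradient_def scalar_prod_diff_right)
qed (auto simp: ell_subgradient_def)

lemma ell_subgradient_closed:
  assumes i: "i < m" and s: "\<And>k. ell_subgradient i (x k) (y k) (e k) (l k)"
    and e: "e' \<in> carrier_vec (nd i)" and l: "l' \<in> carrier_vec pq"
    and lim: "vconv x x'" "vconv y y'" "vconv e e'" "vconv l l'"
  shows "ell_subgradient i x' y' e' l'"
proof -
  have lk: "l k \<in> carrier_vec pq" for k using l lim(4) by (auto simp: vconv_def intro!: carrier_vecI)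
  have mem: "x k \<in> \<Omega> i" "y k \<in> Kpol p q" and cone: "G i (x k) - l k \<in> Kcone p q" "y k \<bullet> G i (x k) = y k \<bullet> l k" for k
    using s ell_subgradient_iff[OF i lk] by auto
  have x': "x' \<in> \<Omega> i" using vclosedD[OF _ lim(1)] \<Omega>_closed i mem(1) by blast
  have y': "y' \<in> Kpol p q" using vclosedD[OF vclosed_Kpol lim(2)] mem(2) by blast
  note carrier = \<Omega>_carrier[OF i mem(1)] \<Omega>_carrier[OF i x']
  note dims = dim_G[OF i carrier(1)] dim_G[OF i carrier(2)] carrier_vecD[OF lk] carrier_vecD[OF l]
  have "w \<bullet> G i x' \<le> w \<bullet> l'" if w: "w \<in> Kpol p q" for w
  proof (rule le_if_liminf_ge)
    show "liminf_ge (\<lambda>k. w \<bullet> G i (x k)) (w \<bullet> G i x')"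
      by (rule K_convex_liminf_ge[OF G_K_convex[OF i] w carrier(1) lim(1)])
    show "(\<lambda>k. w \<bullet> l k) \<longlonglongrightarrow> w \<bullet> l'" using dim_Kpol[OF w] l by (intro tendsto_scalar_prod vconv_const lim) simp
  qed (rule Kpol_scalar_prod_mono[OF w cone(1)], simp add: dims)
  then have polar: "G i x' - l' \<in> Kcone p q"
    using l dims(2) by (intro Kcone_if_polar) (auto simp: scalar_prod_diff_right)
  have min: "f i x' + y' \<bullet> l' + e' \<bullet> (z - x') \<le> f i z + y' \<bullet> G i z" if z: "z \<in> \<Omega> i" for z
  proof (rule le_if_liminf_ge)
    have zc: "z \<in> carrier_vec (nd i)" by (rule \<Omega>_carrier[OF i z])
    show "liminf_ge (\<lambda>k. f i (x k) + y k \<bullet> l k + e k \<bullet> (z - x k)) (f i x' + y' \<bullet> l' + e' \<bullet> (z - x'))"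
      using f_cvx i zc carrier dim_Kpol[OF y'] l e
      by (intro liminf_ge_add liminf_ge_if_tendsto tendsto_scalar_prod vconv_diff vconv_const lim vlscD[of "nd i" "f i"])
        (auto simp: proper_closed_convex_def)
    show "f i (x k) + y k \<bullet> l k + e k \<bullet> (z - x k) \<le> f i z + y k \<bullet> G i z" for k
      using s[of k] z cone(2)[of k] by (auto simp: ell_subgradient_def)
    show "(\<lambda>k. f i z + y k \<bullet> G i z) \<longlonglongrightarrow> f i z + y' \<bullet> G i z"
      using dim_Kpol[OF y'] dim_G[OF i zc] by (intro tendsto_intros tendsto_scalar_prod vconv_const lim) simp
  qed
  have "y' \<bullet> l' \<le> y' \<bullet> G i x'" using min[OF x'] e carrier(2) by (simp add: diff_self_vec)
  moreover have "y' \<bullet> G i x' \<le> y' \<bullet> l'" by (rule Kpol_scalar_prod_mono[OF y' polar]) (simp add: dims)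
  ultimately show ?thesis using x' y' min polar ell_subgradient_iff[OF i l] by auto
qed

definition saddle_subgradient :: "real vec \<Rightarrow> real vec \<Rightarrow> real vec \<Rightarrow> real vec \<Rightarrow> bool" where
  "saddle_subgradient x Y E \<Lambda> \<longleftrightarrow> (\<forall>i<m. ell_subgradient i (blx i x) (bly i Y) (blx i E) (bly i \<Lambda>))"

lemma saddle_subgradient_monotone:
  assumes s: "saddle_subgradient x Y E \<Lambda>" "saddle_subgradient x' Y' E' \<Lambda>'"
    and x: "x' \<in> carrier_vec N" "E' \<in> carrier_vec N" and Y: "Y' \<in> carrier_vec MY" "\<Lambda> \<in> carrier_vec MY"
  shows "0 \<le> (x - x') \<bullet> (E - E') + (Y - Y') \<bullet> (\<Lambda>' - \<Lambda>)"
proof -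
  have "(x - x') \<bullet> (E - E') = (\<Sum>i<m. (blx i x - blx i x') \<bullet> (blx i E - blx i E'))"
    using x by (subst scalar_prod_blk[of _ nd m]) (auto simp: blk_diff[of _ _ m])
  moreover have "(Y - Y') \<bullet> (\<Lambda>' - \<Lambda>) = (\<Sum>i<m. (bly i Y - bly i Y') \<bullet> (bly i \<Lambda>' - bly i \<Lambda>))"
    using Y by (subst scalar_prod_blk[of _ "\<lambda>_. pq" m]) (auto simp: blk_diff[of _ _ m])
  moreover have "0 \<le> (blx i x - blx i x') \<bullet> (blx i E - blx i E') + (bly i Y - bly i Y') \<bullet> (bly i \<Lambda>' - bly i \<Lambda>)"
    if "i < m" for i
    using s that by (intro ell_subgradient_monotone[of i]) (auto simp: saddle_subgradient_def)
  ultimately show ?thesis by (auto simp flip: sum.distrib intro: sum_nonneg)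
qed

lemma saddle_subgradient_closed:
  assumes s: "\<And>k. saddle_subgradient (x k) (Y k) (E k) (\<Lambda> k)"
    and lim: "vconv x x'" "vconv Y Y'" "vconv E E'" "vconv \<Lambda> \<Lambda>'"
    and carrier: "x' \<in> carrier_vec N" "Y' \<in> carrier_vec MY" "E' \<in> carrier_vec N" "\<Lambda>' \<in> carrier_vec MY"
  shows "saddle_subgradient x' Y' E' \<Lambda>'"
  unfolding saddle_subgradient_def
proof (intro allI impI)
  fix i assume i: "i < m"
  show "ell_subgradient i (blx i x') (bly i Y') (blx i E') (bly i \<Lambda>')"
  proof (rule ell_subgradient_closed[OF i])
    show "ell_subgradient i (blx i (x k)) (bly i (Y k)) (blx i (E k)) (bly i (\<Lambda> k))" for k
      using s i by (simp add: saddle_subgradient_def)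
  qed (use lim carrier i in \<open>auto intro!: vconv_blk[of _ _ _ m]\<close>)
qed

lemma lag_eq:
  "lag x Y = (if \<forall>i<m. blx i x \<in> \<Omega> i
     then if \<forall>i<m. bly i Y \<in> Kpol p q then ereal (\<Sum>i<m. f i (blx i x) + bly i Y \<bullet> G i (blx i x)) else - \<infinity>
     else \<infinity>)"
proof -
  define t where "t i = ell f A b g \<Omega> p q i (blx i x) (bly i Y)" for i
  have t: "t i = (if blx i x \<in> \<Omega> i
      then if bly i Y \<in> Kpol p q then ereal (f i (blx i x) + bly i Y \<bullet> G i (blx i x)) else - \<infinity> else \<infinity>)" for i
    by (simp add: t_def ell_def ind_def)
  have lag: "lag x Y = (\<Sum>i<m. t i)" by (simp add: Lag_def t_def)
  consider (finite) "\<forall>i<m. blx i x \<in> \<Omega> i \<and> bly i Y \<in> Kpol p q"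
    | (outside_Kpol) i where "\<forall>i<m. blx i x \<in> \<Omega> i" "i < m" "bly i Y \<notin> Kpol p q"
    | (outside_\<Omega>) i where "i < m" "blx i x \<notin> \<Omega> i" by blast
  then show ?thesis
  proof cases
    case finite
    then show ?thesis by (simp add: lag t)
  next
    case (outside_Kpol i)
    then have "(\<Sum>j\<in>{..<m} - {i}. t j) \<noteq> \<infinity>" by (auto simp: sum_Pinfty t)
    moreover have "t i = - \<infinity>" using outside_Kpol by (simp add: t)
    ultimately have "(\<Sum>j<m. t j) = - \<infinity>" using outside_Kpol(2) by (subst sum.remove[of _ i]) auto
    then show ?thesis using outside_Kpol by (auto simp: lag)
  next
    case (outside_\<Omega> i)
    then have "(\<Sum>j<m. t j) = \<infinity>" by (auto simp: sum_Pinfty t)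
    then show ?thesis using outside_\<Omega> by (auto simp: lag)
  qed
qed

lemma in_esubdiff_lag_x_iff:
  assumes x: "x \<in> carrier_vec N" and s: "s \<in> carrier_vec N"
  shows "s \<in> esubdiff N (\<lambda>x'. lag x' Y) x \<longleftrightarrow> (\<forall>i<m. blx i x \<in> \<Omega> i \<and> bly i Y \<in> Kpol p q \<and>
    (\<forall>x'\<in>\<Omega> i. f i (blx i x) + bly i Y \<bullet> G i (blx i x) + blx i s \<bullet> (x' - blx i x) \<le> f i x' + bly i Y \<bullet> G i x'))"
proof (cases "\<forall>i<m. bly i Y \<in> Kpol p q")
  case True
  have "s \<in> esubdiff N (\<lambda>x'. lag x' Y) x \<longleftrightarrow> (\<forall>i<m. blx i x \<in> \<Omega> i \<and>
      (\<forall>x'\<in>\<Omega> i. f i (blx i x) + bly i Y \<bullet> G i (blx i x) + blx i s \<bullet> (x' - blx i x) \<le> f i x' + bly i Y \<bullet> G i x'))"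
    by (rule esubdiff_block_sum_iff[OF _ _ x s, where h = "\<lambda>i x. f i x + bly i Y \<bullet> G i x"])
      (use True \<Omega>_carrier in \<open>auto simp: lag_eq\<close>)
  then show ?thesis using True by auto
next
  case False
  then have "lag x Y \<in> {\<infinity>, - \<infinity>}" by (auto simp: lag_eq)
  then show ?thesis using False by (auto simp: esubdiff_def)
qed

lemma in_esubdiff_lag_Y_iff:
  assumes Y: "Y \<in> carrier_vec MY" and s: "s \<in> carrier_vec MY"
  shows "s \<in> esubdiff MY (\<lambda>Y'. - lag x Y') Y \<longleftrightarrow> (\<forall>i<m. blx i x \<in> \<Omega> i \<and> bly i Y \<in> Kpol p q \<and>
    (\<forall>y'\<in>Kpol p q. (y' - bly i Y) \<bullet> (G i (blx i x) + bly i s) \<le> 0))"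
proof (cases "\<forall>i<m. blx i x \<in> \<Omega> i")
  case True
  define h where "h i y = - (f i (blx i x) + y \<bullet> G i (blx i x))" for i y
  have "s \<in> esubdiff (offs (\<lambda>_. pq) m) (\<lambda>Y'. - lag x Y') Y \<longleftrightarrow> (\<forall>i<m. bly i Y \<in> Kpol p q \<and>
      (\<forall>y'\<in>Kpol p q. h i (bly i Y) + bly i s \<bullet> (y' - bly i Y) \<le> h i y'))"
  proof (rule esubdiff_block_sum_iff)
    have "(\<Sum>i<m. h i (bly i Y')) = - (\<Sum>i<m. f i (blx i x) + bly i Y' \<bullet> G i (blx i x))" for Y'
      by (simp only: h_def sum_negf)
    then show "- lag x Y' = (if \<forall>i<m. bly i Y' \<in> Kpol p q then ereal (\<Sum>i<m. h i (bly i Y')) else \<infinity>)" for Y'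
      using True by (simp add: lag_eq)
  qed (use Y s in \<open>auto simp: Kpol_def\<close>)
  moreover have "h i (bly i Y) + bly i s \<bullet> (y' - bly i Y) \<le> h i y' \<longleftrightarrow>
      (y' - bly i Y) \<bullet> (G i (blx i x) + bly i s) \<le> 0" if i: "i < m" and y': "y' \<in> Kpol p q" for i y'
    using G_blk_carrier[OF i, of x] dim_Kpol[OF y']
    by (simp add: h_def scalar_prod_distribs scalar_prod_commute[of "bly i s"] algebra_simps)
  ultimately show ?thesis using True by auto
next
  case False
  then have "lag x Y = \<infinity>" by (simp add: lag_eq)
  then show ?thesis using False by (auto simp: esubdiff_def)
qed

lemma saddle_subgradient_iff:
  assumes x: "x \<in> carrier_vec N" "E \<in> carrier_vec N" and Y: "Y \<in> carrier_vec MY" "\<Lambda> \<in> carrier_vec MY"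
  shows "saddle_subgradient x Y E \<Lambda> \<longleftrightarrow>
    E \<in> esubdiff N (\<lambda>x'. lag x' Y) x \<and> - \<Lambda> \<in> esubdiff MY (\<lambda>Y'. - lag x Y') Y"
proof -
  have "G i (blx i x) + bly i (- \<Lambda>) = G i (blx i x) - bly i \<Lambda>" if "i < m" for i
    using blk_uminus[of \<Lambda> "\<lambda>_. pq" m i] that Y minus_add_uminus_vec[of "G i (blx i x)" pq "bly i \<Lambda>"]
    by simp
  then have "- \<Lambda> \<in> esubdiff MY (\<lambda>Y'. - lag x Y') Y \<longleftrightarrow> (\<forall>i<m. blx i x \<in> \<Omega> i \<and> bly i Y \<in> Kpol p q \<and>
      (\<forall>y'\<in>Kpol p q. (y' - bly i Y) \<bullet> (G i (blx i x) - bly i \<Lambda>) \<le> 0))"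
    using Y by (simp add: in_esubdiff_lag_Y_iff)
  then show ?thesis
    unfolding in_esubdiff_lag_x_iff[OF x] saddle_subgradient_def ell_subgradient_def by blast
qed

lemma PhiZero_carrier: "\<xi> \<in> Phi0 \<Longrightarrow> \<xi> \<in> carrier_vec (N + (MY + RZ))"
  by (simp add: PhiZero_def Let_def offs_def add.assoc)

lemma PhiZero_iff:
  assumes x: "x \<in> carrier_vec N" and Y: "Y \<in> carrier_vec MY" and Z: "Z \<in> carrier_vec RZ"
  shows "x @\<^sub>v Y @\<^sub>v Z \<in> Phi0 \<longleftrightarrow> saddle_subgradient x Y (0\<^sub>v N) (bUT *\<^sub>v Z) \<and> bU *\<^sub>v Y = 0\<^sub>v RZ"
proof -
  define \<Lambda> where "\<Lambda> = bUT *\<^sub>v Z"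
  have \<Lambda>: "\<Lambda> \<in> carrier_vec MY" by (simp add: \<Lambda>_def)
  have double_uminus: "0\<^sub>v MY \<in> (\<lambda>s. s + \<Lambda>) ` ((\<lambda>s. - s) ` ((\<lambda>s. - s) ` S)) \<longleftrightarrow> - \<Lambda> \<in> S"
    if "S \<subseteq> carrier_vec MY" for S
  proof -
    have "0\<^sub>v MY = s + \<Lambda> \<longleftrightarrow> s = - \<Lambda>" if "s \<in> carrier_vec MY" for s
      using that \<Lambda> by (auto simp: vec_eq_iff eq_neg_iff_add_eq_0)
    then show ?thesis using that by (auto simp: image_image image_iff)
  qed
  have sub: "esubdiff MY F Y \<subseteq> carrier_vec MY" for F by (auto simp: esubdiff_def)
  have "x @\<^sub>v Y @\<^sub>v Z \<in> Phi0 \<longleftrightarrow> (0\<^sub>v N \<in> esubdiff N (\<lambda>x'. lag x' Y) x \<and>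
      - \<Lambda> \<in> esubdiff MY (\<lambda>Y'. - lag x Y') Y) \<and> 0\<^sub>v RZ = - (bU *\<^sub>v Y)"
    unfolding PhiZero_def Let_def dim_U offs_def[of nd m, symmetric] mem_Collect_eq vec_first_last_append3[OF x Y Z]
      transpose_kron_one \<Lambda>_def[symmetric] double_uminus[OF sub]
    using append3_carrier[OF x Y Z] by (simp add: add.assoc)
  also have "0\<^sub>v RZ = - (bU *\<^sub>v Y) \<longleftrightarrow> bU *\<^sub>v Y = 0\<^sub>v RZ"
    by (metis uminus_uminus_vec uminus_zero_vec)
  finally show ?thesis using saddle_subgradient_iff[OF x zero_carrier_vec Y \<Lambda>] by (simp add: \<Lambda>_def)
qed

section \<open>Zeros of the saddle operator and Karush--Kuhn--Tucker pairs\<close>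

lemma bU_eq_0_iff:
  assumes Y: "Y \<in> carrier_vec MY"
  shows "bU *\<^sub>v Y = 0\<^sub>v RZ \<longleftrightarrow> (\<exists>y\<in>carrier_vec pq. Y = stack m (\<lambda>_. y))"
proof
  assume UY: "bU *\<^sub>v Y = 0\<^sub>v RZ"
  have "\<exists>a. comp_vec pq m Y c = a \<cdot>\<^sub>v vec m (\<lambda>_. 1)" if c: "c < pq" for c
  proof (rule U_kernel[OF comp_vec_carrier])
    show "U *\<^sub>v comp_vec pq m Y c = 0\<^sub>v r"
      using comp_vec_kron_one[OF U_dim carrier_vecD[OF Y] c] comp_vec_zero[OF c, of r] UY by simp
  qed blast
  then obtain a where a: "\<And>c. c < pq \<Longrightarrow> comp_vec pq m Y c = a c \<cdot>\<^sub>v vec m (\<lambda>_. 1)" by metis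
  have "Y = stack m (\<lambda>_. vec pq a)"
  proof (rule vec_eq_comp_vecI[of _ m pq])
    show "comp_vec pq m Y c = comp_vec pq m (stack m (\<lambda>_. vec pq a)) c" if "c < pq" for c
      using a[OF that] that by (subst comp_vec_stack) auto
  qed (use Y dim_stack[of m "\<lambda>_. vec pq a" "\<lambda>_. pq"] in auto)
  then show "\<exists>y\<in>carrier_vec pq. Y = stack m (\<lambda>_. y)" by (metis vec_carrier)
next
  assume "\<exists>y\<in>carrier_vec pq. Y = stack m (\<lambda>_. y)"
  then obtain y where y: "y \<in> carrier_vec pq" "Y = stack m (\<lambda>_. y)" by blast
  show "bU *\<^sub>v Y = 0\<^sub>v RZ"
  proof (rule vec_eq_comp_vecI[of _ r pq])
    fix c assume c: "c < pq"
    have "comp_vec pq m Y c = (y $ c) \<cdot>\<^sub>v vec m (\<lambda>_. 1)"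
      unfolding y(2) using y(1) c by (subst comp_vec_stack) auto
    then have "U *\<^sub>v comp_vec pq m Y c = 0\<^sub>v r"
      using mult_mat_vec[OF U_dim, of "vec m (\<lambda>_. 1)" "y $ c"] U_one by auto
    then show "comp_vec pq r (bU *\<^sub>v Y) c = comp_vec pq r (0\<^sub>v RZ) c"
      using comp_vec_kron_one[OF U_dim carrier_vecD[OF Y] c] comp_vec_zero[OF c, of r] by simp
  qed simp_all
qed

lemma vsum_bly_bUT:
  assumes Z: "Z \<in> carrier_vec RZ"
  shows "vsum pq m (\<lambda>i. bly i (bUT *\<^sub>v Z)) = 0\<^sub>v pq"
proof (rule eq_vecI)
  fix c assume "c < dim_vec (0\<^sub>v pq)"
  then have c: "c < pq" by simp
  let ?o = "vec m (\<lambda>_. 1) :: real vec"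
  have "(\<Sum>i<m. bly i (bUT *\<^sub>v Z) $ c) = ?o \<bullet> comp_vec pq m (bUT *\<^sub>v Z) c"
    by (simp add: comp_vec_def scalar_prod_lessThan)
  also have "\<dots> = ?o \<bullet> (U\<^sup>T *\<^sub>v comp_vec pq r Z c)" unfolding comp_vec_kron_one[OF UT_dim carrier_vecD[OF Z] c] ..
  also have "\<dots> = (U *\<^sub>v ?o) \<bullet> comp_vec pq r Z c"
    using transpose_vec_mult_scalar[OF UT_dim, of "comp_vec pq r Z c" ?o] by simp
  also have "\<dots> = 0" unfolding U_one by (intro scalar_prod_left_zero) simp
  finally show "vsum pq m (\<lambda>i. bly i (bUT *\<^sub>v Z)) $ c = 0\<^sub>v pq $ c" using c by simp
qed simp

lemma stack_eq_bUT_mult_if_vsum_eq_0: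
  assumes l: "\<And>i. i < m \<Longrightarrow> l i \<in> carrier_vec pq" and sum: "vsum pq m l = 0\<^sub>v pq"
  obtains Z where "Z \<in> carrier_vec RZ" "bUT *\<^sub>v Z = stack m l"
proof (rule kron_transpose_range[OF U_dim U_rank])
  show "stack m l \<in> carrier_vec MY" using stack_carrier[of m l "\<lambda>_. pq"] l by simp
  show "v \<bullet> comp_vec pq m (stack m l) c = 0" if v: "v \<in> carrier_vec m" "U *\<^sub>v v = 0\<^sub>v r" and c: "c < pq" for v c
  proof -
    obtain a where a: "v = a \<cdot>\<^sub>v vec m (\<lambda>_. 1)" using v by (rule U_kernel)
    have "v \<bullet> comp_vec pq m (stack m l) c = a * (\<Sum>i<m. l i $ c)"
      unfolding a using l c by (subst comp_vec_stack) (auto simp: scalar_prod_lessThan sum_distrib_left)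
    also have "(\<Sum>i<m. l i $ c) = 0" using arg_cong[OF sum, of "\<lambda>v. v $ c"] c by simp
    finally show ?thesis by simp
  qed
qed (rule that)

definition objective :: "real vec \<Rightarrow> real" where
  "objective x = (\<Sum>i<m. f i (blx i x))"

definition Gsum :: "real vec \<Rightarrow> real vec" where
  "Gsum x = vsum pq m (\<lambda>i. G i (blx i x))"

definition kkt :: "real vec \<Rightarrow> real vec \<Rightarrow> bool" where
  "kkt x y \<longleftrightarrow> x \<in> block_prod nd m \<Omega> \<and> y \<in> Kpol p q \<and> Gsum x \<in> Kcone p q \<and> y \<bullet> Gsum x = 0 \<and>
     (\<forall>i<m. \<forall>x'\<in>\<Omega> i. f i (blx i x) + y \<bullet> G i (blx i x) \<le> f i x' + y \<bullet> G i x')"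

lemma Gsum_carrier [simp]: "Gsum x \<in> carrier_vec pq"
  by (simp add: Gsum_def)

lemma dim_Gsum [simp]: "dim_vec (Gsum x) = pq"
  by (simp add: Gsum_def)

lemma sum_scalar_prod_G: "(\<Sum>i<m. y \<bullet> G i (blx i x)) = y \<bullet> Gsum x"
  unfolding Gsum_def by (rule scalar_prod_vsum[symmetric]) simp

lemma feasibleP_iff: "feasibleP m nd A b g \<Omega> p q x \<longleftrightarrow> x \<in> block_prod nd m \<Omega> \<and> Gsum x \<in> Kcone p q"
  by (auto simp: feasibleP_def block_prod_def Gsum_def offs_def)

lemma optimalP_iff: "optimalP m nd f A b g \<Omega> p q x \<longleftrightarrow> x \<in> block_prod nd m \<Omega> \<and> Gsum x \<in> Kcone p q \<and>
    (\<forall>x'\<in>block_prod nd m \<Omega>. Gsum x' \<in> Kcone p q \<longrightarrow> objective x \<le> objective x')"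
  by (auto simp: optimalP_def feasibleP_iff objective_def)

lemma kkt_if_PhiZero:
  assumes carrier: "x \<in> carrier_vec N" "Y \<in> carrier_vec MY" "Z \<in> carrier_vec RZ"
    and zero: "x @\<^sub>v Y @\<^sub>v Z \<in> Phi0"
  obtains y where "Y = stack m (\<lambda>_. y)" "kkt x y"
proof -
  define l where "l i = bly i (bUT *\<^sub>v Z)" for i
  have UY: "bU *\<^sub>v Y = 0\<^sub>v RZ" and sub: "\<And>i. i < m \<Longrightarrow> ell_subgradient i (blx i x) (bly i Y) (0\<^sub>v (nd i)) (l i)"
    using zero by (auto simp: PhiZero_iff[OF carrier] saddle_subgradient_def l_def blk_zero)
  obtain y where y: "y \<in> carrier_vec pq" "Y = stack m (\<lambda>_. y)" using UY bU_eq_0_iff carrier(2) by auto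
  have blk_Y: "bly i Y = y" if "i < m" for i
    unfolding y(2) using y(1) that by (intro blk_stack) auto
  have x: "blx i x \<in> \<Omega> i" and yK: "y \<in> Kpol p q" and min: "\<And>x'. x' \<in> \<Omega> i \<Longrightarrow>
      f i (blx i x) + y \<bullet> G i (blx i x) \<le> f i x' + y \<bullet> G i x'" if "i < m" for i
    using sub[OF that] \<Omega>_carrier[OF that] by (auto simp: ell_subgradient_def blk_Y[OF that])
  have diff: "G i (blx i x) - l i \<in> Kcone p q" "y \<bullet> (G i (blx i x) - l i) = 0" if "i < m" for i
    using sub[OF that] that Kpol_variational_iff[OF yK[OF that], of "G i (blx i x) - l i"]
    by (auto simp: ell_subgradient_def blk_Y l_def)
  have Gsum: "Gsum x = vsum pq m (\<lambda>i. G i (blx i x) - l i)"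
  proof (rule eq_vecI)
    fix c assume "c < dim_vec (vsum pq m (\<lambda>i. G i (blx i x) - l i))"
    then show "Gsum x $ c = vsum pq m (\<lambda>i. G i (blx i x) - l i) $ c"
      using arg_cong[OF vsum_bly_bUT[OF carrier(3)], of "\<lambda>v. v $ c"]
      by (simp add: Gsum_def sum_subtractf l_def del: index_blk)
  qed simp
  have "y \<bullet> Gsum x = (\<Sum>i<m. y \<bullet> (G i (blx i x) - l i))"
    unfolding Gsum by (rule scalar_prod_vsum) (simp add: l_def)
  then have "kkt x y"
    using x yK[OF m_pos] min diff carrier(1) vsum_Kcone[of m "\<lambda>i. G i (blx i x) - l i" p q]
    by (simp add: kkt_def block_prod_def Gsum)
  with y(2) show ?thesis by (rule that)
qed

lemma PhiZero_if_kkt: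
  assumes kkt: "kkt x y"
  obtains Z where "Z \<in> carrier_vec RZ" "x @\<^sub>v stack m (\<lambda>_. y) @\<^sub>v Z \<in> Phi0"
proof -
  define S where "S = (1 / real m) \<cdot>\<^sub>v Gsum x"
  define l where "l i = G i (blx i x) - S" for i
  define Y where "Y = stack m (\<lambda>_. y)"
  have x: "x \<in> block_prod nd m \<Omega>" and y: "y \<in> Kpol p q" using kkt by (auto simp: kkt_def)
  have S: "S \<in> Kcone p q" "S \<in> carrier_vec pq" "y \<bullet> S = 0"
    using kkt dim_Kpol[OF y] by (auto simp: S_def kkt_def intro: Kcone_smult)
  have l: "l i \<in> carrier_vec pq" for i using S(2) by (simp add: l_def)
  have Y: "Y \<in> carrier_vec MY" and blk_Y: "\<And>i. i < m \<Longrightarrow> bly i Y = y"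
    using stack_carrier[of m "\<lambda>_. y" "\<lambda>_. pq"] blk_stack[of m "\<lambda>_. y" "\<lambda>_. pq"] Kpol_carrier[OF y] by (auto simp: Y_def)
  have "vsum pq m l = 0\<^sub>v pq"
    using S(2) m_pos by (intro eq_vecI) (simp_all add: l_def sum_subtractf S_def Gsum_def)
  then obtain Z where Z: "Z \<in> carrier_vec RZ" "bUT *\<^sub>v Z = stack m l"
    by (rule stack_eq_bUT_mult_if_vsum_eq_0[OF l])
  have blk_l: "bly i (stack m l) = l i" if "i < m" for i using l that by (intro blk_stack) auto
  have "ell_subgradient i (blx i x) y (0\<^sub>v (nd i)) (l i)" if i: "i < m" for i
  proof -
    have "G i (blx i x) - l i = S"
      using diff_diff_cancel_vec[of "G i (blx i x)" S] G_blk_carrier[OF i, of x] S(2) by (simp add: l_def)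
    then show ?thesis
      using kkt i x \<Omega>_carrier[OF i] S Kpol_variational_iff[OF y S(2)] by (auto simp: ell_subgradient_def kkt_def block_prod_def)
  qed
  moreover have "bU *\<^sub>v Y = 0\<^sub>v RZ" using Y Kpol_carrier[OF y] by (auto simp: bU_eq_0_iff Y_def)
  ultimately have "x @\<^sub>v Y @\<^sub>v Z \<in> Phi0"
    unfolding PhiZero_iff[OF subsetD[OF block_prod_subset x] Y Z(1)] saddle_subgradient_def
    by (simp add: Z(2) blk_Y blk_l blk_zero)
  then show ?thesis using that Z(1) by (simp add: Y_def)
qed

lemma kkt_objective_le_lagrangian:
  assumes kkt: "kkt x y" and w: "w \<in> block_prod nd m \<Omega>"
  shows "objective x \<le> objective w + y \<bullet> Gsum w"
proof -
  have "objective x = (\<Sum>i<m. f i (blx i x) + y \<bullet> G i (blx i x))"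
    using kkt by (simp add: kkt_def objective_def sum.distrib sum_scalar_prod_G)
  also have "\<dots> \<le> (\<Sum>i<m. f i (blx i w) + y \<bullet> G i (blx i w))"
    using kkt w by (intro sum_mono) (auto simp: kkt_def block_prod_def)
  finally show ?thesis by (simp add: objective_def sum.distrib sum_scalar_prod_G)
qed

lemma kkt_optimalP: "kkt x y \<Longrightarrow> optimalP m nd f A b g \<Omega> p q x"
  unfolding optimalP_iff
proof (intro conjI ballI impI)
  assume kkt: "kkt x y"
  then show "x \<in> block_prod nd m \<Omega>" "Gsum x \<in> Kcone p q" by (auto simp: kkt_def)
  fix w assume w: "w \<in> block_prod nd m \<Omega>" "Gsum w \<in> Kcone p q"
  have "y \<bullet> Gsum w \<le> 0" using kkt w(2) by (intro Kpol_Kcone_nonpos) (auto simp: kkt_def)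
  then show "objective x \<le> objective w" using kkt_objective_le_lagrangian[OF kkt w(1)] by simp
qed

lemma dualfun_le_objective:
  assumes x: "x \<in> block_prod nd m \<Omega>" "Gsum x \<in> Kcone p q" and y: "y \<in> carrier_vec pq"
  shows "dualfun m nd f A b g \<Omega> p q y \<le> ereal (objective x)"
proof -
  have blk: "bly i (stack m (\<lambda>_. y)) = y" if "i < m" for i using y that by (intro blk_stack) auto
  have "dualfun m nd f A b g \<Omega> p q y \<le> lag x (stack m (\<lambda>_. y))"
    unfolding dualfun_def Lag_def using blk by (auto intro!: sum_mono INF_lower)
  also have "\<dots> \<le> ereal (objective x)"
  proof (cases "y \<in> Kpol p q")
    case True
    then have "lag x (stack m (\<lambda>_. y)) = ereal (objective x + y \<bullet> Gsum x)"
      using x(1) blk by (simp add: lag_eq block_prod_def objective_def sum.distrib flip: sum_scalar_prod_G)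
    then show ?thesis using Kpol_Kcone_nonpos[OF True x(2)] by simp
  next
    case False
    then have "lag x (stack m (\<lambda>_. y)) = - \<infinity>" using x(1) blk m_pos by (auto simp: lag_eq block_prod_def)
    then show ?thesis by simp
  qed
  finally show ?thesis .
qed

lemma kkt_objective_le_dualfun:
  assumes kkt: "kkt x y"
  shows "ereal (objective x) \<le> dualfun m nd f A b g \<Omega> p q y"
proof -
  have "ereal (objective x) = (\<Sum>i<m. ereal (f i (blx i x) + y \<bullet> G i (blx i x)))"
    using kkt by (simp add: kkt_def objective_def sum.distrib sum_scalar_prod_G)
  also have "\<dots> \<le> dualfun m nd f A b g \<Omega> p q y"
    unfolding dualfun_def using kkt by (intro sum_mono INF_greatest) (auto simp: kkt_def ell_def ind_def)
  finally show ?thesis .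
qed

lemma kkt_optimalD:
  assumes "kkt x y"
  shows "optimalD m nd f A b g \<Omega> p q y"
  unfolding optimalD_def
proof (intro conjI ballI)
  show "y \<in> carrier_vec pq" using assms by (auto simp: kkt_def Kpol_carrier)
  fix y' :: "real vec" assume "y' \<in> carrier_vec pq"
  then have "dualfun m nd f A b g \<Omega> p q y' \<le> ereal (objective x)"
    using assms by (intro dualfun_le_objective) (auto simp: kkt_def)
  also have "\<dots> \<le> dualfun m nd f A b g \<Omega> p q y" by (rule kkt_objective_le_dualfun[OF assms])
  finally show "dualfun m nd f A b g \<Omega> p q y' \<le> dualfun m nd f A b g \<Omega> p q y" .
qed

theorem optimal_if_PhiZero:
  assumes zero: "\<xi> \<in> Phi0"
  shows "optimalP m nd f A b g \<Omega> p q (vec_first \<xi> N)"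
    "\<exists>y. vec_first (vec_last \<xi> (MY + RZ)) MY = stack m (\<lambda>_. y) \<and> optimalD m nd f A b g \<Omega> p q y"
proof -
  obtain x Y Z where c: "x \<in> carrier_vec N" "Y \<in> carrier_vec MY" "Z \<in> carrier_vec RZ" and eq: "\<xi> = x @\<^sub>v Y @\<^sub>v Z"
    using PhiZero_carrier[OF zero] by (rule append3_cases)
  obtain y where y: "Y = stack m (\<lambda>_. y)" "kkt x y" using zero unfolding eq by (rule kkt_if_PhiZero[OF c])
  then show "optimalP m nd f A b g \<Omega> p q (vec_first \<xi> N)"
    "\<exists>y. vec_first (vec_last \<xi> (MY + RZ)) MY = stack m (\<lambda>_. y) \<and> optimalD m nd f A b g \<Omega> p q y"
    using kkt_optimalP kkt_optimalD vec_first_last_append3[OF c] by (auto simp: eq)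
qed

lemma convex_program_if_optimalP:
  assumes "optimalP m nd f A b g \<Omega> p q x"
  shows "convex_program p q N (block_prod nd m \<Omega>) objective Gsum x"
proof
  show "vclosed N (block_prod nd m \<Omega>)" using \<Omega>_closed by (intro vclosed_block_prod) auto
  show "vconvex_set N (block_prod nd m \<Omega>)" using \<Omega>_cvx by (intro vconvex_set_block_prod) auto
  show "proper_closed_convex N objective"
    unfolding objective_def using f_cvx by (intro proper_closed_convex_sum proper_closed_convex_blk) auto
  show "K_convex p q N Gsum" unfolding Gsum_def by (rule K_convex_vsum_blk[OF G_K_convex])
qed (use assms in \<open>auto simp: optimalP_iff\<close>)

lemma Gsum_stack:
  assumes z: "\<And>i. i < m \<Longrightarrow> z i \<in> carrier_vec (nd i)"
  shows "c < p \<Longrightarrow> Gsum (stack m z) $ c = (\<Sum>i<m. (A i *\<^sub>v z i - b i) $ c)"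
    "p \<le> c \<Longrightarrow> c < pq \<Longrightarrow> Gsum (stack m z) $ c = (\<Sum>i<m. g i (z i) $ (c - p))"
proof -
  have blk: "blx i (stack m z) = z i" if "i < m" for i using z that by (rule blk_stack)
  have dims: "dim_vec (b i) = p" "dim_vec (g i (z i)) = q" if "i < m" for i
    using b_dim g_dim z that by auto
  show "Gsum (stack m z) $ c = (\<Sum>i<m. (A i *\<^sub>v z i - b i) $ c)" if "c < p"
    using that by (auto simp: Gsum_def blk Gfun_def dims trans_less_add1 simp del: index_minus_vec(1) intro!: sum.cong)
  show "Gsum (stack m z) $ c = (\<Sum>i<m. g i (z i) $ (c - p))" if "p \<le> c" "c < pq"
    using that by (auto simp: Gsum_def blk Gfun_def dims intro!: sum.cong)
qed

lemma kkt_exists: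
  assumes opt: "optimalP m nd f A b g \<Omega> p q x"
    and slater: "\<And>i. i < m \<Longrightarrow> z i \<in> vinterior (nd i) (\<Omega> i)" "vsum p m (\<lambda>i. A i *\<^sub>v z i - b i) = 0\<^sub>v p"
      "\<And>c. c < q \<Longrightarrow> (\<Sum>i<m. g i (z i) $ c) < 0"
  obtains y where "kkt x y"
proof -
  interpret convex_program p q N "block_prod nd m \<Omega>" objective Gsum x
    by (rule convex_program_if_optimalP[OF opt])
  have z: "z i \<in> carrier_vec (nd i)" if "i < m" for i using slater(1)[OF that] by (simp add: vinterior_def)
  obtain y where y: "y \<in> Kpol p q" and le: "\<And>w. w \<in> block_prod nd m \<Omega> \<Longrightarrow> objective x \<le> objective w + y \<bullet> Gsum w"
  proof (rule slater_multiplier)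
    show "stack m z \<in> vinterior N (block_prod nd m \<Omega>)" by (rule stack_in_vinterior_block_prod[OF slater(1)])
    show "Gsum (stack m z) $ c = 0" if "c < p" for c
      using that arg_cong[OF slater(2), of "\<lambda>v. v $ c"] by (simp add: Gsum_stack[OF z])
    show "Gsum (stack m z) $ c < 0" if "p \<le> c" "c < pq" for c
      using that slater(3)[of "c - p"] by (simp add: Gsum_stack[OF z])
  qed blast
  have compl: "y \<bullet> Gsum x = 0"
    using le[OF x_opt_mem] Kpol_Kcone_nonpos[OF y x_opt_feasible] by simp
  have "\<forall>w\<in>block_prod nd m \<Omega>. (\<Sum>i<m. f i (blx i x) + y \<bullet> G i (blx i x)) + 0\<^sub>v N \<bullet> (w - x)
      \<le> (\<Sum>i<m. f i (blx i w) + y \<bullet> G i (blx i w))"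
    using le compl x_opt_carrier block_prod_subset[of nd m \<Omega>]
    by (auto simp: sum.distrib sum_scalar_prod_G objective_def[symmetric])
  then have "\<forall>i<m. \<forall>x'\<in>\<Omega> i. f i (blx i x) + y \<bullet> G i (blx i x) \<le> f i x' + y \<bullet> G i x'"
    using \<Omega>_carrier x_opt_mem
    by (subst (asm) block_sum_subgradient_iff[where h = "\<lambda>i x. f i x + y \<bullet> G i x"]) (auto simp: blk_zero)
  then have "kkt x y" using y compl x_opt_mem x_opt_feasible by (simp add: kkt_def)
  then show ?thesis by (rule that)
qed

lemma PhiZero_nonempty:
  assumes "\<exists>x. optimalP m nd f A b g \<Omega> p q x"
    and "\<exists>z. (\<forall>i<m. z i \<in> vinterior (nd i) (\<Omega> i)) \<and> vsum p m (\<lambda>i. A i *\<^sub>v z i - b i) = 0\<^sub>v p \<and>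
      (\<forall>c<q. (\<Sum>i<m. g i (z i) $ c) < 0)"
  shows "Phi0 \<noteq> {}"
proof -
  obtain x z where "optimalP m nd f A b g \<Omega> p q x"
    and "\<And>i. i < m \<Longrightarrow> z i \<in> vinterior (nd i) (\<Omega> i)" "vsum p m (\<lambda>i. A i *\<^sub>v z i - b i) = 0\<^sub>v p"
      "\<And>c. c < q \<Longrightarrow> (\<Sum>i<m. g i (z i) $ c) < 0" using assms by blast
  then obtain y where "kkt x y" by (rule kkt_exists)
  then show ?thesis using PhiZero_if_kkt by blast
qed

end

section \<open>The metric matrices\<close>

locale dpmm_parameters = dpmm_problem +
  fixes \<theta> \<alpha> \<gamma> :: "nat \<Rightarrow> real" and \<beta> :: real
  assumes \<theta>_rng: "\<forall>i<m. 0 < \<theta> i \<and> \<theta> i < 2"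
    and \<alpha>_pos: "\<forall>i<m. 0 < \<alpha> i"
    and \<gamma>_pos: "\<forall>i<m. 0 < \<gamma> i"
    and \<beta>_pos: "0 < \<beta>"
    and \<gamma>\<beta>: "\<forall>i<m. 0 < \<gamma> i * \<beta> \<and> \<gamma> i * \<beta> < 1 / lam_max L"
begin

abbreviation "T \<equiv> N + (MY + RZ)"
abbreviation "x_diag \<equiv> bdiag m nd"
abbreviation "y_diag \<equiv> bdiag m (\<lambda>_. pq)"

definition Q :: "real mat" where
  "Q = block3_upper N MY RZ (minv (x_diag \<alpha>)) (minv (y_diag \<gamma>)) (- bU\<^sup>T) ((1 / \<beta>) \<cdot>\<^sub>m 1\<^sub>m RZ)"

definition M :: "real mat" where
  "M = block3_upper N MY RZ (x_diag \<theta>) (1\<^sub>m MY) (- (y_diag \<gamma> * bU\<^sup>T)) (1\<^sub>m RZ)"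

definition H :: "real mat" where
  "H = Q * minv M"

definition D :: "real mat" where
  "D = Q\<^sup>T + Q - M\<^sup>T * H * M"

definition M_inv :: "real mat" where
  "M_inv = block3_upper N MY RZ (x_diag (\<lambda>i. 1 / \<theta> i)) (1\<^sub>m MY) (y_diag \<gamma> * bUT) (1\<^sub>m RZ)"

lemma y_diag_carrier [simp]: "y_diag cs \<in> carrier_mat MY MY"
  using bdiag_carrier[of m "\<lambda>_. pq"] by simp

lemma y_diag_mult_carrier [simp]: "v \<in> carrier_vec MY \<Longrightarrow> y_diag cs *\<^sub>v v \<in> carrier_vec MY"
  using y_diag_carrier by (rule mult_mat_vec_carrier)

lemma y_diag_bUT_carrier [simp]: "y_diag cs * bUT \<in> carrier_mat MY RZ"
  using y_diag_carrier bUT_carrier by (rule mult_carrier_mat)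

lemma y_diag_bUT_mult: "c \<in> carrier_vec RZ \<Longrightarrow> (y_diag cs * bUT) *\<^sub>v c = y_diag cs *\<^sub>v (bUT *\<^sub>v c)"
  by (rule assoc_mult_mat_vec[OF y_diag_carrier bUT_carrier])

lemma minv_diag:
  "minv (x_diag \<alpha>) = x_diag (\<lambda>i. 1 / \<alpha> i)" "minv (y_diag \<gamma>) = y_diag (\<lambda>i. 1 / \<gamma> i)"
  using \<alpha>_pos \<gamma>_pos by (auto intro!: minv_bdiag)

lemma Q_carrier: "Q \<in> carrier_mat T T" and M_carrier: "M \<in> carrier_mat T T" and M_inv_carrier: "M_inv \<in> carrier_mat T T"
  unfolding Q_def M_def M_inv_def minv_diag by (intro block3_upper_carrier; simp)+

context
  fixes a u c :: "real vec"
  assumes auc: "a \<in> carrier_vec N" "u \<in> carrier_vec MY" "c \<in> carrier_vec RZ"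
begin

lemma Q_mult: "Q *\<^sub>v (a @\<^sub>v u @\<^sub>v c) =
  (x_diag (\<lambda>i. 1 / \<alpha> i) *\<^sub>v a) @\<^sub>v (y_diag (\<lambda>i. 1 / \<gamma> i) *\<^sub>v u - bUT *\<^sub>v c) @\<^sub>v ((1 / \<beta>) \<cdot>\<^sub>v c)"
proof -
  have "y_diag (\<lambda>i. 1 / \<gamma> i) *\<^sub>v u + (- bUT) *\<^sub>v c = y_diag (\<lambda>i. 1 / \<gamma> i) *\<^sub>v u - bUT *\<^sub>v c"
    using auc minus_add_uminus_vec[of "y_diag (\<lambda>i. 1 / \<gamma> i) *\<^sub>v u" MY "bUT *\<^sub>v c"] by simp
  then show ?thesis
    unfolding Q_def minv_diag transpose_kron_one using auc bUT_carrier
    by (subst block3_upper_mult_vec) (auto simp: smult_one_mult_vec)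
qed

lemma M_mult: "M *\<^sub>v (a @\<^sub>v u @\<^sub>v c) = (x_diag \<theta> *\<^sub>v a) @\<^sub>v (u - y_diag \<gamma> *\<^sub>v (bUT *\<^sub>v c)) @\<^sub>v c"
proof -
  have "u + (- (y_diag \<gamma> * bUT)) *\<^sub>v c = u - y_diag \<gamma> *\<^sub>v (bUT *\<^sub>v c)"
    using auc minus_add_uminus_vec[of u MY "y_diag \<gamma> *\<^sub>v (bUT *\<^sub>v c)"] by (simp add: y_diag_bUT_mult)
  then show ?thesis
    unfolding M_def transpose_kron_one using auc by (subst block3_upper_mult_vec) auto
qed

lemma M_inv_mult: "M_inv *\<^sub>v (a @\<^sub>v u @\<^sub>v c) =
  (x_diag (\<lambda>i. 1 / \<theta> i) *\<^sub>v a) @\<^sub>v (u + y_diag \<gamma> *\<^sub>v (bUT *\<^sub>v c)) @\<^sub>v c"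
  unfolding M_inv_def using auc by (subst block3_upper_mult_vec) (auto simp: y_diag_bUT_mult)

end

lemma M_mult_M_inv: "M * M_inv = 1\<^sub>m T"
proof (rule eq_mat_if_mult_vec_eq[OF mult_carrier_mat[OF M_carrier M_inv_carrier] one_carrier_mat])
  fix v :: "real vec" assume v: "v \<in> carrier_vec T"
  then obtain a u c where auc: "a \<in> carrier_vec N" "u \<in> carrier_vec MY" "c \<in> carrier_vec RZ" and v_eq: "v = a @\<^sub>v u @\<^sub>v c"
    by (rule append3_cases)
  define w where "w = y_diag \<gamma> *\<^sub>v (bUT *\<^sub>v c)"
  have w: "w \<in> carrier_vec MY" by (simp add: w_def)
  have "M * M_inv *\<^sub>v v = M *\<^sub>v (M_inv *\<^sub>v v)" by (rule assoc_mult_mat_vec[OF M_carrier M_inv_carrier v])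
  also have "\<dots> = (x_diag \<theta> *\<^sub>v (x_diag (\<lambda>i. 1 / \<theta> i) *\<^sub>v a)) @\<^sub>v (u + w - w) @\<^sub>v c"
    unfolding v_eq M_inv_mult[OF auc] w_def[symmetric] using auc w by (subst M_mult) (auto simp: w_def)
  also have "x_diag \<theta> *\<^sub>v (x_diag (\<lambda>i. 1 / \<theta> i) *\<^sub>v a) = a"
    using \<theta>_rng auc by (intro bdiag_inverse_mult) fastforce+
  also have "u + w - w = u" using auc w by auto
  finally show "M * M_inv *\<^sub>v v = 1\<^sub>m T *\<^sub>v v" using v v_eq by simp
qed

lemma minv_M: "minv M = M_inv"
  by (rule minv_eqI[OF M_carrier M_inv_carrier M_mult_M_inv])

lemma H_carrier: "H \<in> carrier_mat T T"
  unfolding H_def minv_M by (rule mult_carrier_mat[OF Q_carrier M_inv_carrier])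

lemma H_mult_M: "H * M = Q"
proof -
  have "M_inv * M = 1\<^sub>m T" by (rule mat_mult_left_right_inverse[OF M_carrier M_inv_carrier M_mult_M_inv])
  then show ?thesis
    unfolding H_def minv_M assoc_mult_mat[OF Q_carrier M_inv_carrier M_carrier] using Q_carrier by simp
qed

lemma H_mult:
  assumes auc: "a \<in> carrier_vec N" "u \<in> carrier_vec MY" "c \<in> carrier_vec RZ"
  shows "H *\<^sub>v (a @\<^sub>v u @\<^sub>v c) =
    (x_diag (\<lambda>i. 1 / (\<alpha> i * \<theta> i)) *\<^sub>v a) @\<^sub>v (y_diag (\<lambda>i. 1 / \<gamma> i) *\<^sub>v u) @\<^sub>v ((1 / \<beta>) \<cdot>\<^sub>v c)"
proof -
  define w where "w = bUT *\<^sub>v c"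
  have w: "w \<in> carrier_vec MY" by (simp add: w_def)
  have "H *\<^sub>v (a @\<^sub>v u @\<^sub>v c) = Q *\<^sub>v (M_inv *\<^sub>v (a @\<^sub>v u @\<^sub>v c))"
    unfolding H_def minv_M by (rule assoc_mult_mat_vec[OF Q_carrier M_inv_carrier append3_carrier[OF auc]])
  also have "\<dots> = (x_diag (\<lambda>i. 1 / \<alpha> i) *\<^sub>v (x_diag (\<lambda>i. 1 / \<theta> i) *\<^sub>v a)) @\<^sub>v
      (y_diag (\<lambda>i. 1 / \<gamma> i) *\<^sub>v (u + y_diag \<gamma> *\<^sub>v w) - w) @\<^sub>v ((1 / \<beta>) \<cdot>\<^sub>v c)"
    unfolding M_inv_mult[OF auc] w_def using auc by (intro Q_mult) auto
  also have "x_diag (\<lambda>i. 1 / \<alpha> i) *\<^sub>v (x_diag (\<lambda>i. 1 / \<theta> i) *\<^sub>v a) = x_diag (\<lambda>i. 1 / (\<alpha> i * \<theta> i)) *\<^sub>v a"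
    using auc by (simp add: bdiag_mult_bdiag)
  also have "y_diag (\<lambda>i. 1 / \<gamma> i) *\<^sub>v (u + y_diag \<gamma> *\<^sub>v w) = y_diag (\<lambda>i. 1 / \<gamma> i) *\<^sub>v u + w"
    using mult_add_distrib_mat_vec[OF y_diag_carrier auc(2) y_diag_mult_carrier[OF w]]
      bdiag_inverse_mult[of m "\<lambda>i. 1 / \<gamma> i" \<gamma> w "\<lambda>_. pq"] w \<gamma>_pos by (simp add: less_imp_neq[symmetric])
  also have "\<dots> - w = y_diag (\<lambda>i. 1 / \<gamma> i) *\<^sub>v u" using w auc by auto
  finally show ?thesis .
qed

lemma scalar_prod_H:
  assumes "a \<in> carrier_vec N" "u \<in> carrier_vec MY" "c \<in> carrier_vec RZ"
    and "a' \<in> carrier_vec N" "u' \<in> carrier_vec MY" "c' \<in> carrier_vec RZ"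
  shows "(a @\<^sub>v u @\<^sub>v c) \<bullet> (H *\<^sub>v (a' @\<^sub>v u' @\<^sub>v c')) =
    a \<bullet> (x_diag (\<lambda>i. 1 / (\<alpha> i * \<theta> i)) *\<^sub>v a') + u \<bullet> (y_diag (\<lambda>i. 1 / \<gamma> i) *\<^sub>v u') + 1 / \<beta> * (c \<bullet> c')"
  unfolding H_mult[OF assms(4-6)] using assms by (subst scalar_prod_append3) auto

lemma H_symmetric:
  assumes "v \<in> carrier_vec T" "w \<in> carrier_vec T"
  shows "v \<bullet> (H *\<^sub>v w) = w \<bullet> (H *\<^sub>v v)"
proof -
  obtain a u c where v: "a \<in> carrier_vec N" "u \<in> carrier_vec MY" "c \<in> carrier_vec RZ" "v = a @\<^sub>v u @\<^sub>v c"
    using assms(1) by (rule append3_cases)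
  obtain a' u' c' where w: "a' \<in> carrier_vec N" "u' \<in> carrier_vec MY" "c' \<in> carrier_vec RZ" "w = a' @\<^sub>v u' @\<^sub>v c'"
    using assms(2) by (rule append3_cases)
  have bdiag_sym: "x \<bullet> (bdiag m ds cs *\<^sub>v y) = y \<bullet> (bdiag m ds cs *\<^sub>v x)"
    if "x \<in> carrier_vec (offs ds m)" "y \<in> carrier_vec (offs ds m)" for x y ds cs
    using that by (simp add: scalar_prod_bdiag scalar_prod_commute[of "blk ds _ x"])
  show ?thesis
    unfolding v(4) w(4) scalar_prod_H[OF v(1-3) w(1-3)] scalar_prod_H[OF w(1-3) v(1-3)]
    using bdiag_sym[of a nd a'] bdiag_sym[of u "\<lambda>_. pq" u'] v w by (simp add: scalar_prod_commute[of c c'])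
qed

lemma positive_definite_H: "positive_definite T (qn H)"
proof (rule positive_definite_append3)
  show "positive_definite N (qn (x_diag (\<lambda>i. 1 / (\<alpha> i * \<theta> i))))"
    using \<alpha>_pos \<theta>_rng by (intro positive_definite_bdiag) auto
  show "positive_definite MY (qn (y_diag (\<lambda>i. 1 / \<gamma> i)))"
    using positive_definite_bdiag[of m "\<lambda>i. 1 / \<gamma> i" "\<lambda>_. pq"] \<gamma>_pos by simp
  show "positive_definite RZ (\<lambda>c. 1 / \<beta> * (c \<bullet> c))"
    using \<beta>_pos by (intro positive_definite_scalar_prod_self) simp
qed (simp add: qn_def scalar_prod_H)

lemma qn_D:
  assumes v: "v \<in> carrier_vec T"
  shows "qn D v = 2 * (v \<bullet> (Q *\<^sub>v v)) - (M *\<^sub>v v) \<bullet> (Q *\<^sub>v v)"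
proof -
  have MT: "M\<^sup>T \<in> carrier_mat T T" and QT: "Q\<^sup>T \<in> carrier_mat T T" using M_carrier Q_carrier by auto
  have "M\<^sup>T * H * M = M\<^sup>T * Q" unfolding assoc_mult_mat[OF MT H_carrier M_carrier] H_mult_M ..
  then have "D *\<^sub>v v = Q\<^sup>T *\<^sub>v v + Q *\<^sub>v v - M\<^sup>T *\<^sub>v (Q *\<^sub>v v)"
    unfolding D_def
    using minus_mult_distrib_mat_vec[OF add_carrier_mat[OF Q_carrier] mult_carrier_mat[OF MT Q_carrier] v]
      add_mult_distrib_mat_vec[OF QT Q_carrier v] assoc_mult_mat_vec[OF MT Q_carrier v] by simp
  moreover have "v \<bullet> (Q\<^sup>T *\<^sub>v v) = v \<bullet> (Q *\<^sub>v v)"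
    using transpose_vec_mult_scalar[OF Q_carrier v v] scalar_prod_commute[of v "Q\<^sup>T *\<^sub>v v"] Q_carrier v by simp
  moreover have "v \<bullet> (M\<^sup>T *\<^sub>v (Q *\<^sub>v v)) = (M *\<^sub>v v) \<bullet> (Q *\<^sub>v v)"
    using transpose_vec_mult_scalar[OF MT mult_mat_vec_carrier[OF Q_carrier v] v] by simp
  ultimately show ?thesis using Q_carrier M_carrier v unfolding qn_def by (simp add: scalar_prod_distribs)
qed

lemma relaxation_identity:
  assumes e: "e \<in> carrier_vec T" and d: "d \<in> carrier_vec T"
  shows "qn H (e - M *\<^sub>v d) = qn H e - qn D d - 2 * ((e - d) \<bullet> (Q *\<^sub>v d))"
proof -
  have Md: "M *\<^sub>v d \<in> carrier_vec T" using M_carrier d by simp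
  have HMd: "H *\<^sub>v (M *\<^sub>v d) = Q *\<^sub>v d" using assoc_mult_mat_vec[OF H_carrier M_carrier d] H_mult_M by simp
  have dims: "dim_vec (M *\<^sub>v d) = T" "dim_vec (Q *\<^sub>v d) = T" "dim_vec (H *\<^sub>v e) = T" "dim_vec e = T" "dim_vec d = T"
    using M_carrier Q_carrier H_carrier e d by auto
  have "qn H (e - M *\<^sub>v d) = (e - M *\<^sub>v d) \<bullet> (H *\<^sub>v e - Q *\<^sub>v d)"
    unfolding qn_def mult_minus_distrib_mat_vec[OF H_carrier e Md] HMd ..
  also have "\<dots> = e \<bullet> (H *\<^sub>v e) - e \<bullet> (Q *\<^sub>v d) - (M *\<^sub>v d) \<bullet> (H *\<^sub>v e) + (M *\<^sub>v d) \<bullet> (Q *\<^sub>v d)"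
    using dims by (simp add: scalar_prod_distribs del: dim_mult_mat_vec)
  also have "(M *\<^sub>v d) \<bullet> (H *\<^sub>v e) = e \<bullet> (Q *\<^sub>v d)" using H_symmetric[OF Md e] HMd by simp
  finally show ?thesis
    unfolding qn_D[OF d] using dims by (simp add: qn_def scalar_prod_diff_left del: dim_mult_mat_vec)
qed

lemma qn_D_append3:
  assumes auc: "a \<in> carrier_vec N" "u \<in> carrier_vec MY" "c \<in> carrier_vec RZ"
  shows "qn D (a @\<^sub>v u @\<^sub>v c) = qn (x_diag (\<lambda>i. (2 - \<theta> i) / \<alpha> i)) a + qn (y_diag (\<lambda>i. 1 / \<gamma> i)) u
    + (1 / \<beta> * (c \<bullet> c) - qn (y_diag \<gamma>) (bUT *\<^sub>v c))"
proof -
  define w where "w = bUT *\<^sub>v c"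
  define u' where "u' = y_diag (\<lambda>i. 1 / \<gamma> i) *\<^sub>v u"
  define a' where "a' = x_diag (\<lambda>i. 1 / \<alpha> i) *\<^sub>v a"
  have carrier: "w \<in> carrier_vec MY" "u' \<in> carrier_vec MY" "y_diag \<gamma> *\<^sub>v w \<in> carrier_vec MY"
    "a' \<in> carrier_vec N" "x_diag \<theta> *\<^sub>v a \<in> carrier_vec N"
    using auc by (simp_all add: w_def u'_def a'_def)
  note dims = auc[THEN carrier_vecD] carrier[THEN carrier_vecD]
  have Qv: "Q *\<^sub>v (a @\<^sub>v u @\<^sub>v c) = a' @\<^sub>v (u' - w) @\<^sub>v ((1 / \<beta>) \<cdot>\<^sub>v c)"
    and Mv: "M *\<^sub>v (a @\<^sub>v u @\<^sub>v c) = (x_diag \<theta> *\<^sub>v a) @\<^sub>v (u - y_diag \<gamma> *\<^sub>v w) @\<^sub>v c"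
    by (simp_all add: Q_mult[OF auc] M_mult[OF auc] a'_def u'_def w_def)
  have \<Gamma>u': "y_diag \<gamma> *\<^sub>v u' = u"
    using bdiag_inverse_mult[of m \<gamma> "\<lambda>i. 1 / \<gamma> i" u "\<lambda>_. pq"] auc \<gamma>_pos by (simp add: u'_def less_imp_neq[symmetric])
  have "(y_diag \<gamma> *\<^sub>v w) \<bullet> u' = u \<bullet> w"
    using scalar_prod_bdiag_left[of w "\<lambda>_. pq" m u' \<gamma>] dims scalar_prod_commute[of w u] by (simp add: \<Gamma>u' del: dim_mult_mat_vec)
  then have "(u - y_diag \<gamma> *\<^sub>v w) \<bullet> (u' - w) = u \<bullet> u' - 2 * (u \<bullet> w) + qn (y_diag \<gamma>) w"
    using dims scalar_prod_commute[of "y_diag \<gamma> *\<^sub>v w" w] by (simp add: scalar_prod_distribs qn_def del: dim_mult_mat_vec)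
  moreover have "2 * (a \<bullet> a') - (x_diag \<theta> *\<^sub>v a) \<bullet> a' = qn (x_diag (\<lambda>i. (2 - \<theta> i) / \<alpha> i)) a"
  proof -
    have "(x_diag \<theta> *\<^sub>v a) \<bullet> a' = a \<bullet> (x_diag (\<lambda>i. \<theta> i * (1 / \<alpha> i)) *\<^sub>v a)"
      unfolding a'_def using auc dims by (simp add: scalar_prod_bdiag_left bdiag_mult_bdiag)
    then show ?thesis
      unfolding a'_def qn_def using dims
      by (simp add: scalar_prod_bdiag diff_divide_distrib left_diff_distrib sum_subtractf sum_distrib_left)
  qed
  moreover have "u \<bullet> u' = qn (y_diag (\<lambda>i. 1 / \<gamma> i)) u" by (simp add: qn_def u'_def)
  ultimately show ?thesis
    unfolding qn_D[OF append3_carrier[OF auc]] Qv Mv w_def[symmetric] using dims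
    by (simp add: scalar_prod_append3 scalar_prod_diff_right del: dim_mult_mat_vec)
qed

lemma positive_definite_consensus_block: "positive_definite RZ (\<lambda>c. 1 / \<beta> * (c \<bullet> c) - qn (y_diag \<gamma>) (bUT *\<^sub>v c))"
  unfolding positive_definite_def
proof (intro conjI ballI impI)
  define \<kappa> where "\<kappa> = 1 / (\<beta> * lam_max L)"
  have "0 < 1 / lam_max L" using \<gamma>\<beta> m_pos by (meson less_trans)
  then have lam: "0 < lam_max L" by simp
  have \<gamma>_less: "\<gamma> i < \<kappa>" if "i < m" for i
    using \<gamma>\<beta> that lam \<beta>_pos by (auto simp: \<kappa>_def field_simps)
  have bUT_zero: "bUT *\<^sub>v 0\<^sub>v RZ = 0\<^sub>v MY" by (rule mult_mat_zero_vec[OF bUT_carrier])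
  show "1 / \<beta> * (0\<^sub>v RZ \<bullet> 0\<^sub>v RZ) - qn (y_diag \<gamma>) (bUT *\<^sub>v 0\<^sub>v RZ) = 0"
    using scalar_prod_left_zero[OF y_diag_mult_carrier[OF zero_carrier_vec]] by (simp add: bUT_zero qn_def)
  fix c :: "real vec" assume c: "c \<in> carrier_vec RZ" "c \<noteq> 0\<^sub>v RZ"
  define w where "w = bUT *\<^sub>v c"
  have w: "w \<in> carrier_vec MY" by (simp add: w_def)
  have "w \<noteq> 0\<^sub>v MY"
    using kron_transpose_inj[OF U_dim U_rank c(1) zero_carrier_vec] c(2) bUT_zero by (auto simp: w_def)
  then have "0 < qn (y_diag (\<lambda>i. \<kappa> - \<gamma> i)) w"
    using positive_definite_bdiag[of m "\<lambda>i. \<kappa> - \<gamma> i" "\<lambda>_. pq"] \<gamma>_less w by (simp add: positive_definite_def)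
  also have "\<dots> = \<kappa> * (w \<bullet> w) - qn (y_diag \<gamma>) w"
    using w by (simp add: qn_def scalar_prod_bdiag scalar_prod_blk[of w "\<lambda>_. pq" m] left_diff_distrib sum_subtractf sum_distrib_left)
  also have "\<kappa> * (w \<bullet> w) \<le> \<kappa> * (lam_max L * (c \<bullet> c))"
    unfolding w_def L_UU using kron_transpose_sq_le_lam_max[OF U_dim c(1)] lam \<beta>_pos
    by (intro mult_left_mono) (auto simp: \<kappa>_def L_UU)
  also have "\<kappa> * (lam_max L * (c \<bullet> c)) = 1 / \<beta> * (c \<bullet> c)" using lam by (simp add: \<kappa>_def)
  finally show "0 < 1 / \<beta> * (c \<bullet> c) - qn (y_diag \<gamma>) (bUT *\<^sub>v c)" by (simp add: w_def)
qed

lemma positive_definite_D: "positive_definite T (qn D)"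
proof (rule positive_definite_append3[OF _ _ positive_definite_consensus_block])
  show "positive_definite N (qn (x_diag (\<lambda>i. (2 - \<theta> i) / \<alpha> i)))"
    using \<alpha>_pos \<theta>_rng by (intro positive_definite_bdiag) auto
  show "positive_definite MY (qn (y_diag (\<lambda>i. 1 / \<gamma> i)))"
    using positive_definite_bdiag[of m "\<lambda>i. 1 / \<gamma> i" "\<lambda>_. pq"] \<gamma>_pos by simp
qed (rule qn_D_append3)

lemma D_carrier: "D \<in> carrier_mat T T"
  unfolding D_def using Q_carrier M_carrier H_carrier by auto

end

section \<open>Quasi-Fejer sequences\<close>

lemma quasi_Fejer_convergent:
  fixes a e :: "nat \<Rightarrow> real"
  assumes a: "\<And>k. 0 \<le> a k" "\<And>k. a (Suc k) \<le> a k + e k" and e: "\<And>k. 0 \<le> e k" "summable e"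
  shows "convergent a"
proof -
  define s where "s k = (\<Sum>j<k. e j)" for k
  have s: "convergent s" unfolding s_def using e(2) by (simp add: summable_iff_convergent)
  have "decseq (\<lambda>k. a k - s k)" unfolding decseq_Suc_iff using a(2) by (simp add: s_def algebra_simps)
  moreover have "\<forall>k. - suminf e \<le> a k - s k"
  proof
    fix k
    have "s k \<le> suminf e" unfolding s_def using e by (intro sum_le_suminf) auto
    then show "- suminf e \<le> a k - s k" using a(1)[of k] by linarith
  qed
  ultimately have "convergent (\<lambda>k. a k - s k)" using decseq_convergent convergent_def by blast
  then have "convergent (\<lambda>k. (a k - s k) + s k)" using s by (rule convergent_add)
  then show ?thesis by simp
qed

lemma quasi_Fejer_square:
  fixes h \<delta> e :: "nat \<Rightarrow> real"
  assumes nonneg: "\<And>k. 0 \<le> h k" "\<And>k. 0 \<le> \<delta> k" "\<And>k. 0 \<le> e k" and e: "summable e"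
    and step: "\<And>k. (h (Suc k))\<^sup>2 + \<delta> k \<le> (h k)\<^sup>2 + e k * (h (Suc k) + h k)"
  shows "convergent h" "\<delta> \<longlonglongrightarrow> 0"
proof -
  have "h (Suc k) \<le> h k + e k" for k
  proof (rule ccontr)
    assume "\<not> h (Suc k) \<le> h k + e k"
    then have "0 < (h (Suc k) - h k - e k) * (h (Suc k) + h k)"
      using nonneg(1)[of k] nonneg(3)[of k] by (intro mult_pos_pos) auto
    then show False using step[of k] nonneg(2)[of k] by (simp add: power2_eq_square algebra_simps)
  qed
  then show "convergent h" using nonneg e by (intro quasi_Fejer_convergent)
  then obtain l where l: "h \<longlonglongrightarrow> l" by (auto simp: convergent_def)
  have "(\<lambda>k. (h k)\<^sup>2 - (h (Suc k))\<^sup>2 + e k * (h (Suc k) + h k)) \<longlonglongrightarrow> l\<^sup>2 - l\<^sup>2 + 0 * (l + l)"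
    by (intro tendsto_intros l LIMSEQ_Suc[OF l] summable_LIMSEQ_zero[OF e])
  then have upper: "(\<lambda>k. (h k)\<^sup>2 - (h (Suc k))\<^sup>2 + e k * (h (Suc k) + h k)) \<longlonglongrightarrow> 0" by simp
  have bound: "\<delta> k \<le> (h k)\<^sup>2 - (h (Suc k))\<^sup>2 + e k * (h (Suc k) + h k)" for k using step[of k] by linarith
  show "\<delta> \<longlonglongrightarrow> 0"
    by (rule tendsto_sandwich[OF _ _ tendsto_const upper]) (intro always_eventually allI nonneg bound)+
qed

lemma vconv_if_qn_tendsto_0:
  assumes pd: "positive_definite n (qn H)" and H: "H \<in> carrier_mat n n"
    and s: "\<And>k. s k \<in> carrier_vec n" and l: "l \<in> carrier_vec n" and lim: "(\<lambda>k. qn H (s k - l)) \<longlonglongrightarrow> 0"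
  shows "vconv s l"
proof -
  obtain c where c: "\<And>v. v \<in> carrier_vec n \<Longrightarrow> vnorm v \<le> c * sqrt (qn H v)"
    using positive_definite_vnorm_le[OF pd H] by blast
  have "(\<lambda>k. c * sqrt (qn H (s k - l))) \<longlonglongrightarrow> c * sqrt 0" by (intro tendsto_intros lim)
  then have upper: "(\<lambda>k. c * sqrt (qn H (s k - l))) \<longlonglongrightarrow> 0" by simp
  have bound: "vnorm (s k - l) \<le> c * sqrt (qn H (s k - l))" for k using l by (intro c) simp
  have "(\<lambda>k. vnorm (s k - l)) \<longlonglongrightarrow> 0"
    by (rule tendsto_sandwich[OF _ _ tendsto_const upper]) (intro always_eventually allI vnorm_nonneg bound)+
  then show ?thesis using carrier_vecD[OF s] carrier_vecD[OF l] by (simp add: vconv_def)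
qed

lemma bounded_if_qn_convergent:
  assumes pd: "positive_definite n (qn H)" and H: "H \<in> carrier_mat n n"
    and s: "\<And>k. s k \<in> carrier_vec n" and l: "l \<in> carrier_vec n" and conv: "convergent (\<lambda>k. sqrt (qn H (s k - l)))"
  shows "\<exists>B. \<forall>k. vnorm (s k) \<le> B"
proof -
  obtain c where c: "0 < c" "\<And>v. v \<in> carrier_vec n \<Longrightarrow> vnorm v \<le> c * sqrt (qn H v)"
    using positive_definite_vnorm_le[OF pd H] by blast
  obtain C where C: "\<And>k. norm (sqrt (qn H (s k - l))) \<le> C"
    using convergent_imp_Bseq[OF conv] unfolding Bseq_def by blast
  show ?thesis
  proof (intro exI allI)
    fix k
    have "vnorm (s k - l) \<le> c * sqrt (qn H (s k - l))" using l by (intro c) simp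
    also have "\<dots> \<le> c * C" using C[of k] c(1) by (intro mult_left_mono) auto
    finally show "vnorm (s k) \<le> c * C + vnorm l"
      using vnorm_le_vnorm_diff_add[of "s k" l] s[of k] l by simp
  qed
qed

text \<open>Opial's argument: the distance to a cluster point converges, and tends to zero along a subsequence.\<close>

lemma vconv_if_cluster_points_attract:
  assumes pd: "positive_definite n (qn H)" and H: "H \<in> carrier_mat n n" and s: "\<And>k. s k \<in> carrier_vec n"
    and S: "S \<subseteq> carrier_vec n" "S \<noteq> {}"
    and conv: "\<And>l. l \<in> S \<Longrightarrow> convergent (\<lambda>k. sqrt (qn H (s k - l)))"
    and cluster: "\<And>\<rho> l. strict_mono \<rho> \<Longrightarrow> vconv (\<lambda>k. s (\<rho> k)) l \<Longrightarrow> l \<in> S"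
  obtains l where "l \<in> S" "vconv s l"
proof -
  obtain l' where l': "l' \<in> carrier_vec n" "l' \<in> S" using S by blast
  obtain B where B: "\<forall>k. vnorm (s k) \<le> B"
    using bounded_if_qn_convergent[OF pd H s l'(1) conv[OF l'(2)]] ..
  obtain \<rho> l where \<rho>: "strict_mono \<rho>" "l \<in> carrier_vec n" and lim: "vconv (\<lambda>k. s (\<rho> k)) l"
    using s spec[OF B] by (rule bounded_vec_convergent_subseq)
  have l: "l \<in> S" using \<rho>(1) lim by (rule cluster)
  obtain a where a: "(\<lambda>k. sqrt (qn H (s k - l))) \<longlonglongrightarrow> a" using conv[OF l] by (auto simp: convergent_def)
  have "(\<lambda>k. qn H (s (\<rho> k) - l)) \<longlonglongrightarrow> qn H (l - l)"
    using \<rho>(2) by (intro tendsto_qn[OF H] vconv_diff lim vconv_const) auto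
  also have "qn H (l - l) = 0" using pd \<rho>(2) by (simp add: diff_self_vec positive_definite_def)
  finally have "(\<lambda>k. sqrt (qn H (s (\<rho> k) - l))) \<longlonglongrightarrow> 0" using tendsto_real_sqrt by fastforce
  moreover have "(\<lambda>k. sqrt (qn H (s (\<rho> k) - l))) \<longlonglongrightarrow> a"
    using LIMSEQ_subseq_LIMSEQ[OF a \<rho>(1)] by (simp add: o_def)
  ultimately have "a = 0" by (rule LIMSEQ_unique[symmetric])
  have "(\<lambda>k. (sqrt (qn H (s k - l)))\<^sup>2) \<longlonglongrightarrow> 0\<^sup>2" using a unfolding \<open>a = 0\<close> by (intro tendsto_power)
  moreover have "0 \<le> qn H (s k - l)" for k using pd \<rho>(2) by (intro positive_definite_nonneg) auto
  ultimately have "(\<lambda>k. qn H (s k - l)) \<longlonglongrightarrow> 0" by simp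
  then have "vconv s l" by (rule vconv_if_qn_tendsto_0[OF pd H s \<rho>(2)])
  with l show ?thesis by (rule that)
qed

section \<open>The iteration\<close>

lemma esubdiff_add_ind:
  assumes "v \<in> esubdiff d (\<lambda>x. ereal (h x) + ind S x) x"
  shows "x \<in> S" "y \<in> S \<Longrightarrow> y \<in> carrier_vec d \<Longrightarrow> h x + v \<bullet> (y - x) \<le> h y"
proof -
  show x: "x \<in> S" using assms by (auto simp: esubdiff_def ind_def split: if_splits)
  assume "y \<in> S" "y \<in> carrier_vec d"
  then have "ereal (h x) + ind S x + ereal (v \<bullet> (y - x)) \<le> ereal (h y) + ind S y"
    using assms by (auto simp: esubdiff_def)
  then show "h x + v \<bullet> (y - x) \<le> h y" using x \<open>y \<in> S\<close> by (simp add: ind_def)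
qed

locale dpmm_iteration = dpmm_parameters +
  fixes eps :: "nat \<Rightarrow> nat \<Rightarrow> real"
    and xk yk lk xh yh vk :: "nat \<Rightarrow> nat \<Rightarrow> real vec"
  assumes eps_nn: "\<forall>i<m. \<forall>k. 0 \<le> eps i k"
    and eps_sum: "\<forall>i<m. summable (\<lambda>k. eps i k)"
    and init_x: "\<forall>i<m. xk 0 i \<in> \<Omega> i"
    and init_y: "\<forall>i<m. yk 0 i \<in> Kpol p q"
    and init_l: "\<forall>i<m. lk 0 i = 0\<^sub>v (p + q)"
    and step_v: "\<forall>k. \<forall>i<m. vk k i \<in> esubdiff (nd i) (\<lambda>x. ereal (prox_aug_lagrangian p q (\<gamma> i) (\<alpha> i) (f i)
        (Gfun A b g i) (yk k i - \<gamma> i \<cdot>\<^sub>v lk k i) (xk k i) x) + ind (\<Omega> i) x) (xh k i) \<and> vnorm (vk k i) \<le> eps i k"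
    and step_yh: "\<forall>k. \<forall>i<m. yh k i = projK p q (yk k i - \<gamma> i \<cdot>\<^sub>v lk k i + \<gamma> i \<cdot>\<^sub>v Gfun A b g i (xh k i))"
    and step_x: "\<forall>k. \<forall>i<m. xk (Suc k) i = (1 - \<theta> i) \<cdot>\<^sub>v xk k i + \<theta> i \<cdot>\<^sub>v xh k i"
    and step_l: "\<forall>k. \<forall>i<m. lk (Suc k) i = lk k i + \<beta> \<cdot>\<^sub>v vsum (p + q) m (\<lambda>j. L $$ (i, j) \<cdot>\<^sub>v yh k j)"
    and step_y: "\<forall>k. \<forall>i<m. yk (Suc k) i = yh k i + \<gamma> i \<cdot>\<^sub>v (lk k i - lk (Suc k) i)"
begin

lemma yh_Kpol: "i < m \<Longrightarrow> yh k i \<in> Kpol p q"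
  using step_yh by simp

lemma yh_carrier [simp]: "i < m \<Longrightarrow> yh k i \<in> carrier_vec pq"
  using yh_Kpol by (rule Kpol_carrier)

lemma vk_carrier [simp]: "i < m \<Longrightarrow> vk k i \<in> carrier_vec (nd i)"
  using step_v by (auto simp: esubdiff_def)

lemma xh_\<Omega>: "i < m \<Longrightarrow> xh k i \<in> \<Omega> i"
  using step_v esubdiff_add_ind(1) by blast

lemma xh_carrier [simp]: "i < m \<Longrightarrow> xh k i \<in> carrier_vec (nd i)"
  using xh_\<Omega> \<Omega>_carrier by blast

lemma xk_carrier [simp]: "i < m \<Longrightarrow> xk k i \<in> carrier_vec (nd i)"
  by (induction k) (use init_x \<Omega>_carrier step_x in auto)

lemma lk_carrier [simp]: "i < m \<Longrightarrow> lk k i \<in> carrier_vec pq"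
  by (induction k) (use init_l step_l in auto)

lemma yk_carrier [simp]: "i < m \<Longrightarrow> yk k i \<in> carrier_vec pq"
  by (cases k) (use init_y step_y Kpol_carrier in auto)

definition X :: "nat \<Rightarrow> real vec" where "X k = stack m (xk k)"
definition Xh :: "nat \<Rightarrow> real vec" where "Xh k = stack m (xh k)"
definition Y :: "nat \<Rightarrow> real vec" where "Y k = stack m (yk k)"
definition Yh :: "nat \<Rightarrow> real vec" where "Yh k = stack m (yh k)"
definition Vx :: "nat \<Rightarrow> real vec" where "Vx k = stack m (vk k)"

primrec Z :: "nat \<Rightarrow> real vec" where
  "Z 0 = 0\<^sub>v RZ"
| "Z (Suc k) = Z k + \<beta> \<cdot>\<^sub>v (bU *\<^sub>v Yh k)"

declare Z.simps(2) [simp del]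

lemma stack_x_carrier [simp]: "X k \<in> carrier_vec N" "Xh k \<in> carrier_vec N" "Vx k \<in> carrier_vec N"
  unfolding X_def Xh_def Vx_def by (simp_all add: stack_carrier)

lemma stack_y_carrier [simp]: "Y k \<in> carrier_vec MY" "Yh k \<in> carrier_vec MY"
  using stack_carrier[of m _ "\<lambda>_. pq"] by (simp_all add: Y_def Yh_def)

lemma Z_carrier [simp]: "Z k \<in> carrier_vec RZ"
  by (induction k) (simp_all add: Z.simps)

lemma blk_stacks [simp]:
  assumes "i < m"
  shows "blx i (X k) = xk k i" "blx i (Xh k) = xh k i" "blx i (Vx k) = vk k i"
    "bly i (Y k) = yk k i" "bly i (Yh k) = yh k i"
  using assms by (simp_all add: X_def Xh_def Vx_def Y_def Yh_def blk_stack)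

lemma stack_dim [simp]: "dim_vec (X k) = N" "dim_vec (Xh k) = N" "dim_vec (Vx k) = N"
  "dim_vec (Y k) = MY" "dim_vec (Yh k) = MY" "dim_vec (Z k) = RZ"
  by (simp_all add: carrier_vecD)

lemma bly_bUT_bU:
  assumes W: "W \<in> carrier_vec MY" and i: "i < m"
  shows "bly i (bUT *\<^sub>v (bU *\<^sub>v W)) = vsum pq m (\<lambda>j. L $$ (i, j) \<cdot>\<^sub>v bly j W)"
proof (rule eq_vecI)
  fix c assume "c < dim_vec (vsum pq m (\<lambda>j. L $$ (i, j) \<cdot>\<^sub>v bly j W))"
  then have c: "c < pq" by simp
  have L: "L \<in> carrier_mat m m" using L_UU U_dim UT_dim by simp
  have "comp_vec pq m (bUT *\<^sub>v (bU *\<^sub>v W)) c = U\<^sup>T *\<^sub>v (U *\<^sub>v comp_vec pq m W c)"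
    using comp_vec_kron_one[OF UT_dim _ c, of "bU *\<^sub>v W"] comp_vec_kron_one[OF U_dim carrier_vecD[OF W] c] by simp
  also have "\<dots> = L *\<^sub>v comp_vec pq m W c" unfolding L_UU assoc_mult_mat_vec[OF UT_dim U_dim comp_vec_carrier] ..
  finally have "bly i (bUT *\<^sub>v (bU *\<^sub>v W)) $ c = (L *\<^sub>v comp_vec pq m W c) $ i"
    using blk_eq_comp_vec[OF i c] by simp
  also have "\<dots> = vsum pq m (\<lambda>j. L $$ (i, j) \<cdot>\<^sub>v bly j W) $ c"
    using i c L by (simp add: comp_vec_def scalar_prod_lessThan)
  finally show "bly i (bUT *\<^sub>v (bU *\<^sub>v W)) $ c = vsum pq m (\<lambda>j. L $$ (i, j) \<cdot>\<^sub>v bly j W) $ c" .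
qed simp

lemma bly_bUT_Z [simp]: "i < m \<Longrightarrow> bly i (bUT *\<^sub>v Z k) = lk k i"
proof (induction k)
  case 0
  then show ?case using init_l mult_mat_zero_vec[OF bUT_carrier] blk_zero[of i m "\<lambda>_. pq"] by simp
next
  case (Suc k)
  have "bUT *\<^sub>v Z (Suc k) = bUT *\<^sub>v Z k + \<beta> \<cdot>\<^sub>v (bUT *\<^sub>v (bU *\<^sub>v Yh k))"
    using mult_add_distrib_mat_vec[OF bUT_carrier Z_carrier, of "\<beta> \<cdot>\<^sub>v (bU *\<^sub>v Yh k)" k]
      mult_mat_vec[OF bUT_carrier bU_mult_carrier] by (simp add: Z.simps)
  then have "bly i (bUT *\<^sub>v Z (Suc k)) = lk k i + \<beta> \<cdot>\<^sub>v vsum pq m (\<lambda>j. L $$ (i, j) \<cdot>\<^sub>v bly j (Yh k))"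
    using Suc by (simp add: blk_add[of _ _ m] blk_smult[of _ _ m] bly_bUT_bU)
  also have "vsum pq m (\<lambda>j. L $$ (i, j) \<cdot>\<^sub>v bly j (Yh k)) = vsum pq m (\<lambda>j. L $$ (i, j) \<cdot>\<^sub>v yh k j)"
    by (simp add: vsum_def cong: sum.cong_simp)
  finally show ?case using step_l Suc.prems by simp
qed

lemma stack_lk: "stack m (lk k) = bUT *\<^sub>v Z k"
  using stack_blk[of "bUT *\<^sub>v Z k" "\<lambda>_. pq" m] stack_cong[of m "\<lambda>i. bly i (bUT *\<^sub>v Z k)" "lk k"] by simp

lemma the_Z: "(THE z. z \<in> carrier_vec RZ \<and> stack m (lk k) = bUT *\<^sub>v z) = Z k"
  using stack_lk kron_transpose_inj[OF U_dim U_rank _ Z_carrier] by (intro the_equality) auto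

lemma X_Suc: "X (Suc k) = X k - x_diag \<theta> *\<^sub>v (X k - Xh k)"
proof (rule vec_eq_blkI[of _ nd m])
  fix i assume i: "i < m"
  have "blx i (X k - x_diag \<theta> *\<^sub>v (X k - Xh k)) = xk k i - \<theta> i \<cdot>\<^sub>v (xk k i - xh k i)"
    using i by (simp add: blk_diff[of _ _ m] blk_bdiag_mult)
  also have "\<dots> = xk (Suc k) i"
    unfolding step_x[rule_format, OF i] using carrier_vecD[OF xk_carrier[OF i]] carrier_vecD[OF xh_carrier[OF i]]
    by (auto simp: vec_eq_iff algebra_simps)
  finally show "blx i (X (Suc k)) = blx i (X k - x_diag \<theta> *\<^sub>v (X k - Xh k))" using i by simp
qed simp_all

lemma Y_Suc: "Y (Suc k) = Yh k + y_diag \<gamma> *\<^sub>v (bUT *\<^sub>v (Z k - Z (Suc k)))"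
proof (rule vec_eq_blkI[of _ "\<lambda>_. pq" m])
  fix i assume i: "i < m"
  have "bUT *\<^sub>v (Z k - Z (Suc k)) = bUT *\<^sub>v Z k - bUT *\<^sub>v Z (Suc k)"
    by (rule mult_minus_distrib_mat_vec[OF bUT_carrier]) simp_all
  then have "bly i (bUT *\<^sub>v (Z k - Z (Suc k))) = lk k i - lk (Suc k) i"
    using i by (simp add: blk_diff[of _ _ m])
  then show "bly i (Y (Suc k)) = bly i (Yh k + y_diag \<gamma> *\<^sub>v (bUT *\<^sub>v (Z k - Z (Suc k))))"
    using i step_y by (simp add: blk_add[of _ _ m] blk_bdiag_mult)
qed simp_all

definition \<xi> :: "nat \<Rightarrow> real vec" where "\<xi> k = X k @\<^sub>v Y k @\<^sub>v Z k"
definition \<xi>h :: "nat \<Rightarrow> real vec" where "\<xi>h k = Xh k @\<^sub>v Yh k @\<^sub>v Z (Suc k)"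
definition V :: "nat \<Rightarrow> real vec" where "V k = Vx k @\<^sub>v 0\<^sub>v MY @\<^sub>v 0\<^sub>v RZ"

lemma \<xi>_carrier [simp]: "\<xi> k \<in> carrier_vec T" "\<xi>h k \<in> carrier_vec T" "V k \<in> carrier_vec T"
  unfolding \<xi>_def \<xi>h_def V_def by (intro append3_carrier; simp)+

lemma \<xi>_diff: "\<xi> k - \<xi>h k = (X k - Xh k) @\<^sub>v (Y k - Yh k) @\<^sub>v (Z k - Z (Suc k))"
  by (simp add: \<xi>_def \<xi>h_def append_diff_vec)

lemma relaxation_step: "\<xi> (Suc k) = \<xi> k - M *\<^sub>v (\<xi> k - \<xi>h k)"
proof -
  define w where "w = y_diag \<gamma> *\<^sub>v (bUT *\<^sub>v (Z k - Z (Suc k)))"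
  have w: "w \<in> carrier_vec MY" by (simp add: w_def)
  have "\<xi> k - M *\<^sub>v (\<xi> k - \<xi>h k) =
      (X k - x_diag \<theta> *\<^sub>v (X k - Xh k)) @\<^sub>v (Y k - (Y k - Yh k - w)) @\<^sub>v (Z k - (Z k - Z (Suc k)))"
    unfolding \<xi>_diff by (subst M_mult) (use w in \<open>simp_all add: \<xi>_def append_diff_vec w_def\<close>)
  also have "Y k - (Y k - Yh k - w) = Y (Suc k)"
    using w carrier_vecD[OF w] unfolding Y_Suc w_def[symmetric] by (auto simp: vec_eq_iff)
  finally show ?thesis by (simp add: \<xi>_def X_Suc diff_diff_cancel_vec)
qed

text \<open>With these subgradients, \<open>Q (\<xi>\<^sup>k - \<xi>h\<^sup>k) + V\<^sup>k\<close> is an element of \<open>\<Phi>(\<xi>h\<^sup>k)\<close>.\<close>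

definition sub_x :: "nat \<Rightarrow> real vec" where
  "sub_x k = x_diag (\<lambda>i. 1 / \<alpha> i) *\<^sub>v (X k - Xh k) + Vx k"

definition sub_Y :: "nat \<Rightarrow> real vec" where
  "sub_Y k = bUT *\<^sub>v Z k - y_diag (\<lambda>i. 1 / \<gamma> i) *\<^sub>v (Y k - Yh k)"

lemma sub_x_carrier [simp]: "sub_x k \<in> carrier_vec N"
  by (simp add: sub_x_def)

lemma sub_Y_carrier [simp]: "sub_Y k \<in> carrier_vec MY"
  by (simp add: sub_Y_def)

lemma yh_variational:
  assumes i: "i < m" and y: "y \<in> Kpol p q"
  shows "(y - yh k i) \<bullet> (G i (xh k i) - (lk k i - (1 / \<gamma> i) \<cdot>\<^sub>v (yk k i - yh k i))) \<le> 0"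
proof -
  define u where "u = yk k i - \<gamma> i \<cdot>\<^sub>v lk k i + \<gamma> i \<cdot>\<^sub>v G i (xh k i)"
  have \<gamma>: "0 < \<gamma> i" using \<gamma>_pos i by simp
  have G: "G i (xh k i) \<in> carrier_vec pq" using i by (intro G_carrier) simp_all
  have u: "u \<in> carrier_vec pq" using G i by (simp add: u_def)
  have yh: "yh k i = projK p q u" using step_yh i by (simp add: u_def)
  have "G i (xh k i) - (lk k i - (1 / \<gamma> i) \<cdot>\<^sub>v (yk k i - yh k i)) = (1 / \<gamma> i) \<cdot>\<^sub>v (u - yh k i)"
    using \<gamma> carrier_vecD[OF G] carrier_vecD[OF lk_carrier[OF i]] carrier_vecD[OF yk_carrier[OF i]]
      carrier_vecD[OF yh_carrier[OF i]] by (auto simp: vec_eq_iff u_def field_simps)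
  moreover have "(y - yh k i) \<bullet> ((1 / \<gamma> i) \<cdot>\<^sub>v (u - yh k i)) = (1 / \<gamma> i) * ((y - yh k i) \<bullet> (u - yh k i))"
    by (simp add: yh)
  ultimately show ?thesis
    using projK_variational[OF u y] \<gamma> by (simp add: yh divide_nonpos_pos)
qed

lemma iterate_subgradient: "saddle_subgradient (Xh k) (Yh k) (sub_x k) (sub_Y k)"
  unfolding saddle_subgradient_def
proof (intro allI impI)
  fix i assume i: "i < m"
  have sub_x: "blx i (sub_x k) = vk k i + (1 / \<alpha> i) \<cdot>\<^sub>v (xk k i - xh k i)"
    using i comm_add_vec[of "(1 / \<alpha> i) \<cdot>\<^sub>v (xk k i - xh k i)" "nd i" "vk k i"]
    by (simp add: sub_x_def blk_add[of _ _ m] blk_diff[of _ _ m] blk_bdiag_mult)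
  have sub_Y: "bly i (sub_Y k) = lk k i - (1 / \<gamma> i) \<cdot>\<^sub>v (yk k i - yh k i)"
    using i by (simp add: sub_Y_def blk_diff[of _ _ m] blk_bdiag_mult)
  have yh: "yh k i = projK p q (yk k i - \<gamma> i \<cdot>\<^sub>v lk k i + \<gamma> i \<cdot>\<^sub>v G i (xh k i))" using step_yh i by simp
  have "f i (xh k i) + yh k i \<bullet> G i (xh k i) + (vk k i + (1 / \<alpha> i) \<cdot>\<^sub>v (xk k i - xh k i)) \<bullet> (x - xh k i)
      \<le> f i x + yh k i \<bullet> G i x" if x: "x \<in> \<Omega> i" for x
    unfolding yh
  proof (rule prox_aug_lagrangian_stationary[where \<Omega> = "\<Omega> i" and d = "nd i"])
    show "prox_aug_lagrangian p q (\<gamma> i) (\<alpha> i) (f i) (G i) (yk k i - \<gamma> i \<cdot>\<^sub>v lk k i) (xk k i) (xh k i) + vk k i \<bullet> (w - xh k i)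
        \<le> prox_aug_lagrangian p q (\<gamma> i) (\<alpha> i) (f i) (G i) (yk k i - \<gamma> i \<cdot>\<^sub>v lk k i) (xk k i) w" if "w \<in> \<Omega> i" for w
      using step_v i that \<Omega>_carrier[OF i that] by (intro esubdiff_add_ind(2)[of _ "nd i" _ "\<Omega> i"]) auto
  qed (use i x \<Omega>_cvx f_cvx G_K_convex \<alpha>_pos \<gamma>_pos xh_\<Omega> in \<open>auto simp: proper_closed_convex_def\<close>)
  then show "ell_subgradient i (blx i (Xh k)) (bly i (Yh k)) (blx i (sub_x k)) (bly i (sub_Y k))"
    unfolding sub_x sub_Y using i xh_\<Omega> yh_Kpol yh_variational[OF i] by (simp add: ell_subgradient_def)
qed

lemma Q_residual: "Q *\<^sub>v (\<xi> k - \<xi>h k) + V k = sub_x k @\<^sub>v (bUT *\<^sub>v Z (Suc k) - sub_Y k) @\<^sub>v (- (bU *\<^sub>v Yh k))"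
proof -
  define w where "w = y_diag (\<lambda>i. 1 / \<gamma> i) *\<^sub>v (Y k - Yh k)"
  have w: "w \<in> carrier_vec MY" by (simp add: w_def)
  have "bUT *\<^sub>v (Z k - Z (Suc k)) = bUT *\<^sub>v Z k - bUT *\<^sub>v Z (Suc k)"
    by (rule mult_minus_distrib_mat_vec[OF bUT_carrier]) simp_all
  then have mid: "w - bUT *\<^sub>v (Z k - Z (Suc k)) + 0\<^sub>v MY = bUT *\<^sub>v Z (Suc k) - sub_Y k"
    using carrier_vecD[OF w] unfolding sub_Y_def w_def[symmetric] by (auto simp: vec_eq_iff)
  have last: "(1 / \<beta>) \<cdot>\<^sub>v (Z k - Z (Suc k)) + 0\<^sub>v RZ = - (bU *\<^sub>v Yh k)"
    using \<beta>_pos by (auto simp: vec_eq_iff Z.simps simp del: index_mult_mat_vec)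
  have "Q *\<^sub>v (\<xi> k - \<xi>h k) + V k = (x_diag (\<lambda>i. 1 / \<alpha> i) *\<^sub>v (X k - Xh k) @\<^sub>v
      (w - bUT *\<^sub>v (Z k - Z (Suc k))) @\<^sub>v ((1 / \<beta>) \<cdot>\<^sub>v (Z k - Z (Suc k)))) + (Vx k @\<^sub>v 0\<^sub>v MY @\<^sub>v 0\<^sub>v RZ)"
    unfolding \<xi>_diff V_def w_def by (subst Q_mult) simp_all
  also have "\<dots> = (x_diag (\<lambda>i. 1 / \<alpha> i) *\<^sub>v (X k - Xh k) + Vx k) @\<^sub>v
      (w - bUT *\<^sub>v (Z k - Z (Suc k)) + 0\<^sub>v MY) @\<^sub>v ((1 / \<beta>) \<cdot>\<^sub>v (Z k - Z (Suc k)) + 0\<^sub>v RZ)"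
    by (subst append_vec_add[of _ N _ _ "MY + RZ"], simp_all add: append_vec_add[of _ MY _ _ RZ])
  finally show ?thesis unfolding mid last sub_x_def .
qed

lemma residual_monotone:
  assumes zero: "\<xi>s \<in> Phi0"
  shows "0 \<le> (\<xi>h k - \<xi>s) \<bullet> (Q *\<^sub>v (\<xi> k - \<xi>h k) + V k)"
proof -
  obtain x W z where c: "x \<in> carrier_vec N" "W \<in> carrier_vec MY" "z \<in> carrier_vec RZ" and eq: "\<xi>s = x @\<^sub>v W @\<^sub>v z"
    using PhiZero_carrier[OF zero] by (rule append3_cases)
  have s: "saddle_subgradient x W (0\<^sub>v N) (bUT *\<^sub>v z)" and UW: "bU *\<^sub>v W = 0\<^sub>v RZ"
    using zero unfolding eq PhiZero_iff[OF c] by auto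
  have mono: "0 \<le> (Xh k - x) \<bullet> (sub_x k - 0\<^sub>v N) + (Yh k - W) \<bullet> (bUT *\<^sub>v z - sub_Y k)"
    by (rule saddle_subgradient_monotone[OF iterate_subgradient s]) (use c in auto)
  have "(z - Z (Suc k)) \<bullet> (bU *\<^sub>v Yh k) = (Yh k - W) \<bullet> (bUT *\<^sub>v z - bUT *\<^sub>v Z (Suc k))"
  proof -
    have "bU *\<^sub>v (Yh k - W) = bU *\<^sub>v Yh k"
      using mult_minus_distrib_mat_vec[OF bU_carrier stack_y_carrier(2) c(2)] UW by simp
    then have "(z - Z (Suc k)) \<bullet> (bU *\<^sub>v Yh k) = (bUT *\<^sub>v (z - Z (Suc k))) \<bullet> (Yh k - W)"
      using transpose_vec_mult_scalar[OF bU_carrier, of "Yh k - W" "z - Z (Suc k)"] c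
      by (simp add: transpose_kron_one)
    also have "\<dots> = (Yh k - W) \<bullet> (bUT *\<^sub>v (z - Z (Suc k)))" using c by (intro scalar_prod_commute) simp
    finally show ?thesis by (simp add: mult_minus_distrib_mat_vec[OF bUT_carrier c(3) Z_carrier])
  qed
  moreover have "\<xi>h k - \<xi>s = (Xh k - x) @\<^sub>v (Yh k - W) @\<^sub>v (Z (Suc k) - z)"
    using c by (simp add: \<xi>h_def eq append_diff_vec)
  ultimately have "(\<xi>h k - \<xi>s) \<bullet> (Q *\<^sub>v (\<xi> k - \<xi>h k) + V k) = (Xh k - x) \<bullet> sub_x k + (Yh k - W) \<bullet> (bUT *\<^sub>v z - sub_Y k)"
    unfolding Q_residual using c[THEN carrier_vecD]
    by (simp add: scalar_prod_append3 scalar_prod_distribs carrier_vecD[OF sub_x_carrier] carrier_vecD[OF sub_Y_carrier])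
  then show ?thesis using mono by simp
qed

theorem descent:
  assumes zero: "\<xi>s \<in> Phi0"
  shows "qn H (\<xi> (Suc k) - \<xi>s) \<le> qn H (\<xi> k - \<xi>s) - qn D (\<xi> k - \<xi>h k) + 2 * ((\<xi>h k - \<xi>s) \<bullet> V k)"
proof -
  define e d where "e = \<xi> k - \<xi>s" and "d = \<xi> k - \<xi>h k"
  have \<xi>s: "\<xi>s \<in> carrier_vec T" using zero by (rule PhiZero_carrier)
  have e: "e \<in> carrier_vec T" and d: "d \<in> carrier_vec T" using \<xi>s by (simp_all add: e_def d_def)
  have dims: "dim_vec (M *\<^sub>v d) = T" "dim_vec (Q *\<^sub>v d) = T" using M_carrier Q_carrier by auto
  have "\<xi> (Suc k) - \<xi>s = e - M *\<^sub>v d"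
    unfolding relaxation_step[of k] d_def[symmetric] e_def using carrier_vecD[OF \<xi>s] dims
    by (auto simp: vec_eq_iff carrier_vecD[OF \<xi>_carrier(1)] simp del: dim_mult_mat_vec index_mult_mat_vec)
  moreover have "e - d = \<xi>h k - \<xi>s"
    unfolding e_def d_def using carrier_vecD[OF \<xi>s]
    by (auto simp: vec_eq_iff carrier_vecD[OF \<xi>_carrier(1)] carrier_vecD[OF \<xi>_carrier(2)])
  moreover have "(\<xi>h k - \<xi>s) \<bullet> (Q *\<^sub>v d + V k) = (\<xi>h k - \<xi>s) \<bullet> (Q *\<^sub>v d) + (\<xi>h k - \<xi>s) \<bullet> V k"
    using dims by (intro scalar_prod_add_right) (simp add: carrier_vecD[OF \<xi>_carrier(3)])
  ultimately show ?thesis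
    using relaxation_identity[OF e d] residual_monotone[OF zero, of k]
    unfolding d_def[symmetric] e_def[symmetric] by simp
qed

lemma vnorm_xh_le:
  assumes i: "i < m" and c: "x \<in> carrier_vec N" "W \<in> carrier_vec MY" "z \<in> carrier_vec RZ"
  shows "vnorm (xh k i - blx i x) \<le>
    1 / \<theta> i * (vnorm (\<xi> (Suc k) - (x @\<^sub>v W @\<^sub>v z)) + vnorm (\<xi> k - (x @\<^sub>v W @\<^sub>v z)))"
proof -
  have \<theta>: "0 < \<theta> i" "\<theta> i < 2" using \<theta>_rng i by auto
  have xk_le: "vnorm (xk k i - blx i x) \<le> vnorm (\<xi> k - (x @\<^sub>v W @\<^sub>v z))" for k
  proof -
    have "xk k i - blx i x = blx i (X k - x)" using i c by (simp add: blk_diff[of _ _ m])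
    also have "vnorm \<dots> \<le> vnorm (X k - x)" using i c by (intro vnorm_blk_le) simp_all
    also have "\<dots> \<le> vnorm (\<xi> k - (x @\<^sub>v W @\<^sub>v z))"
      using c by (simp add: \<xi>_def append_diff_vec vnorm_le_vnorm_append3)
    finally show ?thesis .
  qed
  have "xh k i - blx i x = (1 / \<theta> i) \<cdot>\<^sub>v ((xk (Suc k) i - blx i x) + (\<theta> i - 1) \<cdot>\<^sub>v (xk k i - blx i x))"
    unfolding step_x[rule_format, OF i] using \<theta> carrier_vecD[OF xk_carrier[OF i]] carrier_vecD[OF xh_carrier[OF i]]
    by (auto simp: vec_eq_iff field_simps simp del: index_blk)
  then have "vnorm (xh k i - blx i x) = 1 / \<theta> i * vnorm ((xk (Suc k) i - blx i x) + (\<theta> i - 1) \<cdot>\<^sub>v (xk k i - blx i x))"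
    using \<theta> by (simp add: vnorm_smult)
  also have "\<dots> \<le> 1 / \<theta> i * (vnorm (xk (Suc k) i - blx i x) + \<bar>\<theta> i - 1\<bar> * vnorm (xk k i - blx i x))"
    using \<theta> vnorm_triangle_ineq[of "xk (Suc k) i - blx i x" "(\<theta> i - 1) \<cdot>\<^sub>v (xk k i - blx i x)"]
    by (intro mult_left_mono) (simp_all add: vnorm_smult)
  also have "\<dots> \<le> 1 / \<theta> i * (vnorm (\<xi> (Suc k) - (x @\<^sub>v W @\<^sub>v z)) + 1 * vnorm (\<xi> k - (x @\<^sub>v W @\<^sub>v z)))"
    using \<theta> by (intro mult_left_mono add_mono mult_mono xk_le) auto
  finally show ?thesis by simp
qed

lemma perturbation_le:
  assumes \<xi>s: "\<xi>s \<in> carrier_vec T"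
  shows "(\<xi>h k - \<xi>s) \<bullet> V k \<le> (\<Sum>i<m. 1 / \<theta> i * eps i k) * (vnorm (\<xi> (Suc k) - \<xi>s) + vnorm (\<xi> k - \<xi>s))"
proof -
  obtain x W z where c: "x \<in> carrier_vec N" "W \<in> carrier_vec MY" "z \<in> carrier_vec RZ" and eq: "\<xi>s = x @\<^sub>v W @\<^sub>v z"
    using \<xi>s by (rule append3_cases)
  have "(\<xi>h k - \<xi>s) \<bullet> V k = (Xh k - x) \<bullet> Vx k"
    using c scalar_prod_right_zero[of "Yh k - W" MY] scalar_prod_right_zero[of "Z (Suc k) - z" RZ]
    by (simp add: \<xi>h_def eq V_def append_diff_vec scalar_prod_append3)
  also have "\<dots> = (\<Sum>i<m. (xh k i - blx i x) \<bullet> vk k i)"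
    using c by (subst scalar_prod_blk[of _ nd m]) (auto simp: blk_diff[of _ _ m])
  also have "\<dots> \<le> (\<Sum>i<m. 1 / \<theta> i * (vnorm (\<xi> (Suc k) - \<xi>s) + vnorm (\<xi> k - \<xi>s)) * eps i k)"
  proof (rule sum_mono)
    fix i assume "i \<in> {..<m}"
    then have i: "i < m" by simp
    have "(xh k i - blx i x) \<bullet> vk k i \<le> vnorm (xh k i - blx i x) * vnorm (vk k i)"
      using carrier_vecD[OF vk_carrier[OF i]] by (intro scalar_prod_le_vnorm) simp
    also have "\<dots> \<le> 1 / \<theta> i * (vnorm (\<xi> (Suc k) - \<xi>s) + vnorm (\<xi> k - \<xi>s)) * eps i k"
      unfolding eq using step_v i \<theta>_rng by (intro mult_mono vnorm_xh_le c) (auto simp: less_imp_le)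
    finally show "(xh k i - blx i x) \<bullet> vk k i \<le> 1 / \<theta> i * (vnorm (\<xi> (Suc k) - \<xi>s) + vnorm (\<xi> k - \<xi>s)) * eps i k" .
  qed
  also have "\<dots> = (\<Sum>i<m. 1 / \<theta> i * eps i k) * (vnorm (\<xi> (Suc k) - \<xi>s) + vnorm (\<xi> k - \<xi>s))"
    unfolding sum_distrib_right by (intro sum.cong) auto
  finally show ?thesis .
qed

lemma quasi_Fejer_iterates:
  assumes zero: "\<xi>s \<in> Phi0"
  shows "convergent (\<lambda>k. sqrt (qn H (\<xi> k - \<xi>s)))" "(\<lambda>k. qn D (\<xi> k - \<xi>h k)) \<longlonglongrightarrow> 0"
proof -
  have \<xi>s: "\<xi>s \<in> carrier_vec T" using zero by (rule PhiZero_carrier)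
  obtain c where c: "0 < c" "\<And>v. v \<in> carrier_vec T \<Longrightarrow> vnorm v \<le> c * sqrt (qn H v)"
    using positive_definite_vnorm_le[OF positive_definite_H H_carrier] by blast
  define h where "h k = sqrt (qn H (\<xi> k - \<xi>s))" for k
  define e where "e k = 2 * c * (\<Sum>i<m. 1 / \<theta> i * eps i k)" for k
  have sum_nonneg: "0 \<le> (\<Sum>i<m. 1 / \<theta> i * eps i k)" for k
    using eps_nn \<theta>_rng by (intro sum_nonneg) (auto simp: less_imp_le)
  have h_sq: "(h k)\<^sup>2 = qn H (\<xi> k - \<xi>s)" and h_nonneg: "0 \<le> h k" for k
    using positive_definite_nonneg[OF positive_definite_H, of "\<xi> k - \<xi>s"] \<xi>s by (simp_all add: h_def)
  have D_nonneg: "0 \<le> qn D (\<xi> k - \<xi>h k)" for k by (rule positive_definite_nonneg[OF positive_definite_D]) simp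
  have e_nonneg: "0 \<le> e k" for k using c(1) sum_nonneg[of k] by (simp add: e_def)
  have e_summable: "summable e" unfolding e_def using eps_sum by (intro summable_mult summable_sum) auto
  have step: "(h (Suc k))\<^sup>2 + qn D (\<xi> k - \<xi>h k) \<le> (h k)\<^sup>2 + e k * (h (Suc k) + h k)" for k
  proof -
    have "vnorm (\<xi> (Suc k) - \<xi>s) + vnorm (\<xi> k - \<xi>s) \<le> c * (h (Suc k) + h k)"
      unfolding h_def distrib_left using \<xi>s by (intro add_mono c) simp_all
    then have "(\<Sum>i<m. 1 / \<theta> i * eps i k) * (vnorm (\<xi> (Suc k) - \<xi>s) + vnorm (\<xi> k - \<xi>s))
        \<le> (\<Sum>i<m. 1 / \<theta> i * eps i k) * (c * (h (Suc k) + h k))"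
      using sum_nonneg by (rule mult_left_mono)
    then have "2 * ((\<xi>h k - \<xi>s) \<bullet> V k) \<le> e k * (h (Suc k) + h k)"
      using perturbation_le[OF \<xi>s, of k] by (simp add: e_def mult_ac)
    then show ?thesis using descent[OF zero, of k] by (simp add: h_sq)
  qed
  show "convergent (\<lambda>k. sqrt (qn H (\<xi> k - \<xi>s)))" "(\<lambda>k. qn D (\<xi> k - \<xi>h k)) \<longlonglongrightarrow> 0"
    using quasi_Fejer_square[OF h_nonneg D_nonneg e_nonneg e_summable step] by (simp_all add: h_def[abs_def])
qed

lemma vconv_Vx: "vconv Vx (0\<^sub>v N)"
proof -
  have bound: "vnorm (Vx k) \<le> (\<Sum>i<m. eps i k)" for k
  proof -
    have "vnorm (Vx k) \<le> (\<Sum>i<m. vnorm (blx i (Vx k)))" by (rule vnorm_le_sum_blk) simp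
    also have "\<dots> \<le> (\<Sum>i<m. eps i k)" using step_v by (intro sum_mono) simp
    finally show ?thesis .
  qed
  have "(\<lambda>k. \<Sum>i<m. eps i k) \<longlonglongrightarrow> (\<Sum>i<m. 0)"
    using eps_sum by (intro tendsto_sum summable_LIMSEQ_zero) auto
  then have upper: "(\<lambda>k. \<Sum>i<m. eps i k) \<longlonglongrightarrow> 0" by simp
  have "(\<lambda>k. vnorm (Vx k)) \<longlonglongrightarrow> 0"
    by (rule tendsto_sandwich[OF _ _ tendsto_const upper]) (intro always_eventually allI vnorm_nonneg bound)+
  then show ?thesis by (simp add: vconv_zero_iff)
qed

lemma consensus_in_the_limit:
  assumes Yh: "vconv (\<lambda>k. Yh (\<rho> k)) W" "W \<in> carrier_vec MY"
    and gap: "vconv (\<lambda>k. Z (\<rho> k) - Z (Suc (\<rho> k))) (0\<^sub>v RZ)"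
  shows "bU *\<^sub>v W = 0\<^sub>v RZ"
proof -
  have "bU *\<^sub>v Yh k = (- (1 / \<beta>)) \<cdot>\<^sub>v (Z k - Z (Suc k))" for k
    using \<beta>_pos by (auto simp: vec_eq_iff Z.simps simp del: index_mult_mat_vec)
  then have "vconv (\<lambda>k. bU *\<^sub>v Yh (\<rho> k)) ((- (1 / \<beta>)) \<cdot>\<^sub>v 0\<^sub>v RZ)" using vconv_smult[OF gap] by simp
  then have "bU *\<^sub>v W = (- (1 / \<beta>)) \<cdot>\<^sub>v 0\<^sub>v RZ"
    by (rule vconv_unique[OF vconv_mult_mat_vec[OF bU_carrier Yh]])
  also have "\<dots> = 0\<^sub>v RZ" by (intro eq_vecI) simp_all
  finally show ?thesis .
qed

lemma cluster_point_PhiZero: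
  assumes \<rho>: "strict_mono \<rho>" and lim: "vconv (\<lambda>k. \<xi> (\<rho> k)) \<xi>s" and gap: "vconv (\<lambda>k. \<xi> k - \<xi>h k) (0\<^sub>v T)"
  shows "\<xi>s \<in> Phi0"
proof -
  have \<xi>s: "\<xi>s \<in> carrier_vec T" using vconv_carrier[OF lim] by simp
  then obtain x W z where c: "x \<in> carrier_vec N" "W \<in> carrier_vec MY" "z \<in> carrier_vec RZ" and eq: "\<xi>s = x @\<^sub>v W @\<^sub>v z"
    by (rule append3_cases)
  note dims = c[THEN carrier_vecD]
  have "vconv (\<lambda>k. X (\<rho> k) @\<^sub>v Y (\<rho> k) @\<^sub>v Z (\<rho> k)) (x @\<^sub>v W @\<^sub>v z)" using lim by (simp add: eq \<xi>_def)
  note limits = vconv_append3D[OF this]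
  have X: "vconv (\<lambda>k. X (\<rho> k)) x" and Y: "vconv (\<lambda>k. Y (\<rho> k)) W" and Z: "vconv (\<lambda>k. Z (\<rho> k)) z"
    by (rule limits; simp add: dims)+
  have "vconv (\<lambda>k. (X (\<rho> k) - Xh (\<rho> k)) @\<^sub>v (Y (\<rho> k) - Yh (\<rho> k)) @\<^sub>v (Z (\<rho> k) - Z (Suc (\<rho> k))))
      (0\<^sub>v N @\<^sub>v 0\<^sub>v MY @\<^sub>v 0\<^sub>v RZ)"
    using vconv_subseq[OF gap \<rho>] by (simp add: \<xi>_diff zero_vec_append3)
  note gaps = vconv_append3D[OF this]
  have dX: "vconv (\<lambda>k. X (\<rho> k) - Xh (\<rho> k)) (0\<^sub>v N)" and dY: "vconv (\<lambda>k. Y (\<rho> k) - Yh (\<rho> k)) (0\<^sub>v MY)"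
    and dZ: "vconv (\<lambda>k. Z (\<rho> k) - Z (Suc (\<rho> k))) (0\<^sub>v RZ)"
    by (rule gaps; simp)+
  have Xh: "vconv (\<lambda>k. Xh (\<rho> k)) x" using vconv_diff[OF X dX] c by (simp add: diff_diff_cancel_vec)
  have Yh: "vconv (\<lambda>k. Yh (\<rho> k)) W" using vconv_diff[OF Y dY] c by (simp add: diff_diff_cancel_vec)
  have "vconv (\<lambda>k. sub_x (\<rho> k)) (x_diag (\<lambda>i. 1 / \<alpha> i) *\<^sub>v 0\<^sub>v N + 0\<^sub>v N)"
    unfolding sub_x_def by (intro vconv_add vconv_mult_mat_vec[OF bdiag_carrier] dX vconv_subseq[OF vconv_Vx \<rho>]) auto
  moreover have "vconv (\<lambda>k. sub_Y (\<rho> k)) (bUT *\<^sub>v z - y_diag (\<lambda>i. 1 / \<gamma> i) *\<^sub>v 0\<^sub>v MY)"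
    unfolding sub_Y_def
    by (intro vconv_diff vconv_mult_mat_vec[OF bUT_carrier Z c(3)] vconv_mult_mat_vec[OF y_diag_carrier dY]) auto
  moreover have "x_diag (\<lambda>i. 1 / \<alpha> i) *\<^sub>v 0\<^sub>v N + 0\<^sub>v N = 0\<^sub>v N" "bUT *\<^sub>v z - y_diag (\<lambda>i. 1 / \<gamma> i) *\<^sub>v 0\<^sub>v MY = bUT *\<^sub>v z"
    using c by (simp_all add: mult_mat_zero_vec[OF bdiag_carrier] mult_mat_zero_vec[OF y_diag_carrier])
  ultimately have "saddle_subgradient x W (0\<^sub>v N) (bUT *\<^sub>v z)"
    using saddle_subgradient_closed[OF iterate_subgradient Xh Yh] c by simp
  moreover have "bU *\<^sub>v W = 0\<^sub>v RZ" by (rule consensus_in_the_limit[OF Yh c(2) dZ])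
  ultimately show ?thesis unfolding eq PhiZero_iff[OF c] by simp
qed

theorem iterates_bounded:
  assumes "Phi0 \<noteq> {}"
  shows "\<exists>B. \<forall>k. vnorm (\<xi> k) \<le> B"
proof -
  obtain \<xi>s where zero: "\<xi>s \<in> Phi0" using assms by blast
  show ?thesis
    by (rule bounded_if_qn_convergent[OF positive_definite_H H_carrier \<xi>_carrier(1) PhiZero_carrier[OF zero]
          quasi_Fejer_iterates(1)[OF zero]])
qed

theorem iterates_converge:
  assumes nonempty: "Phi0 \<noteq> {}"
  obtains \<xi>s where "\<xi>s \<in> Phi0" "vconv \<xi> \<xi>s"
proof (rule vconv_if_cluster_points_attract[OF positive_definite_H H_carrier \<xi>_carrier(1) _ nonempty quasi_Fejer_iterates(1)])
  show "Phi0 \<subseteq> carrier_vec T" using PhiZero_carrier by blast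
  obtain \<xi>0 where "\<xi>0 \<in> Phi0" using nonempty by blast
  then have "(\<lambda>k. qn D (\<xi> k - \<xi>h k)) \<longlonglongrightarrow> 0" by (rule quasi_Fejer_iterates(2))
  then have "vconv (\<lambda>k. \<xi> k - \<xi>h k) (0\<^sub>v T)"
    by (intro vconv_if_qn_tendsto_0[OF positive_definite_D D_carrier]) auto
  then show "\<xi>s \<in> Phi0" if "strict_mono \<rho>" "vconv (\<lambda>k. \<xi> (\<rho> k)) \<xi>s" for \<rho> \<xi>s
    using that by (intro cluster_point_PhiZero)
qed (assumption, rule that)

end

theorem theorem1:
  fixes m p q r :: nat
    and nd :: "nat \<Rightarrow> nat"
    and f :: "nat \<Rightarrow> real vec \<Rightarrow> real"
    and A :: "nat \<Rightarrow> real mat" and b :: "nat \<Rightarrow> real vec"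
    and g :: "nat \<Rightarrow> real vec \<Rightarrow> real vec"
    and \<Omega> :: "nat \<Rightarrow> real vec set"
    and E :: "(nat \<times> nat) set"
    and L U :: "real mat"
    and \<theta> \<alpha> \<gamma> :: "nat \<Rightarrow> real" and \<beta> :: real
    and eps :: "nat \<Rightarrow> nat \<Rightarrow> real"
    and xk yk lk xh yh vk :: "nat \<Rightarrow> nat \<Rightarrow> real vec"
    and N MY RZ :: nat
    and bU Theta Ups Gam Q M H D :: "real mat"
    and X Y Lam Xh Yh Zk Zh \<xi> \<xi>h V :: "nat \<Rightarrow> real vec"
    and phik :: "nat \<Rightarrow> nat \<Rightarrow> real vec \<Rightarrow> real vec \<Rightarrow> ereal"
  assumes m2: "m \<ge> 2"
    and nd_pos: "\<forall>i<m. nd i \<ge> 1"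
    \<comment> \<open>problem data\<close>
    and A_dim: "\<forall>i<m. A i \<in> carrier_mat p (nd i)"
    and b_dim: "\<forall>i<m. b i \<in> carrier_vec p"
    and g_dim: "\<forall>i<m. \<forall>x\<in>carrier_vec (nd i). g i x \<in> carrier_vec q"
    \<comment> \<open>(A1)\<close>
    and E_sub: "E \<subseteq> {0..<m} \<times> {0..<m}"
    and E_sym: "sym E"
    and E_conn: "\<forall>i<m. \<forall>j<m. (i, j) \<in> E\<^sup>*"
    and L_dim: "L \<in> carrier_mat m m"
    and L_sym: "L\<^sup>T = L"
    and L_comp: "\<forall>i<m. \<forall>j<m. i \<noteq> j \<and> (i, j) \<notin> E \<longrightarrow> L $$ (i, j) = 0"
    and L_null: "{v \<in> carrier_vec m. L *\<^sub>v v = 0\<^sub>v m} = {c \<cdot>\<^sub>v vec m (\<lambda>_. 1) | c. True}"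
    and U_dim: "U \<in> carrier_mat r m"
    and L_UU: "L = U\<^sup>T * U"
    and U_rank: "full_row_rank U"
    and U_one: "U *\<^sub>v vec m (\<lambda>_. 1) = 0\<^sub>v r"
    \<comment> \<open>(A2)\<close>
    and f_cvx: "\<forall>i<m. proper_closed_convex (nd i) (f i)"
    and g_cvx: "\<forall>i<m. \<forall>c<q. proper_closed_convex (nd i) (\<lambda>x. g i x $ c)"
    and \<Omega>_ne: "\<forall>i<m. \<Omega> i \<noteq> {}"
    and \<Omega>_closed: "\<forall>i<m. vclosed (nd i) (\<Omega> i)"
    and \<Omega>_cvx: "\<forall>i<m. vconvex_set (nd i) (\<Omega> i)"
    and P_solvable: "\<exists>x. optimalP m nd f A b g \<Omega> p q x"
    \<comment> \<open>(A3) Slater\<close>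
    and slater: "\<exists>xb. (\<forall>i<m. xb i \<in> vinterior (nd i) (\<Omega> i)) \<and>
                   vsum p m (\<lambda>i. A i *\<^sub>v xb i - b i) = 0\<^sub>v p \<and>
                   (\<forall>c<q. (\<Sum>i<m. g i (xb i) $ c) < 0)"
    \<comment> \<open>parameters\<close>
    and \<theta>_rng: "\<forall>i<m. 0 < \<theta> i \<and> \<theta> i < 2"
    and \<alpha>_pos: "\<forall>i<m. 0 < \<alpha> i"
    and \<gamma>_pos: "\<forall>i<m. 0 < \<gamma> i"
    and \<beta>_pos: "0 < \<beta>"
    and \<gamma>\<beta>: "\<forall>i<m. 0 < \<gamma> i * \<beta> \<and> \<gamma> i * \<beta> < 1 / lam_max L"
    and eps_nn: "\<forall>i<m. \<forall>k. 0 \<le> eps i k"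
    and eps_sum: "\<forall>i<m. summable (\<lambda>k. eps i k)"
    \<comment> \<open>inexact DPMM\<close>
    and phik_def: "\<And>k i x y. phik k i x y =
         ereal (f i x + 1 / (2 * \<gamma> i) *
                  (projK p q (y + \<gamma> i \<cdot>\<^sub>v Gfun A b g i x) \<bullet> projK p q (y + \<gamma> i \<cdot>\<^sub>v Gfun A b g i x) - y \<bullet> y)
                + 1 / (2 * \<alpha> i) * ((x - xk k i) \<bullet> (x - xk k i)))
         + ind (\<Omega> i) x"
    and init_x: "\<forall>i<m. xk 0 i \<in> \<Omega> i"
    and init_y: "\<forall>i<m. yk 0 i \<in> Kpol p q"
    and init_l: "\<forall>i<m. lk 0 i = 0\<^sub>v (p + q)"
    and step_v: "\<forall>k. \<forall>i<m. vk k i \<in> esubdiff (nd i) (\<lambda>x. phik k i x (yk k i - \<gamma> i \<cdot>\<^sub>v lk k i)) (xh k i)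
                          \<and> vnorm (vk k i) \<le> eps i k"
    and step_yh: "\<forall>k. \<forall>i<m. yh k i = projK p q (yk k i - \<gamma> i \<cdot>\<^sub>v lk k i + \<gamma> i \<cdot>\<^sub>v Gfun A b g i (xh k i))"
    and step_x: "\<forall>k. \<forall>i<m. xk (Suc k) i = (1 - \<theta> i) \<cdot>\<^sub>v xk k i + \<theta> i \<cdot>\<^sub>v xh k i"
    and step_l: "\<forall>k. \<forall>i<m. lk (Suc k) i = lk k i + \<beta> \<cdot>\<^sub>v vsum (p + q) m (\<lambda>j. L $$ (i, j) \<cdot>\<^sub>v yh k j)"
    and step_y: "\<forall>k. \<forall>i<m. yk (Suc k) i = yh k i + \<gamma> i \<cdot>\<^sub>v (lk k i - lk (Suc k) i)"
    \<comment> \<open>stacked quantities\<close>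
    and N_def: "N = (\<Sum>i<m. nd i)"
    and MY_def: "MY = m * (p + q)"
    and RZ_def: "RZ = r * (p + q)"
    and bU_def: "bU = kron U (1\<^sub>m (p + q))"
    and X_def: "\<And>k. X k = stack m (xk k)"
    and Y_def: "\<And>k. Y k = stack m (yk k)"
    and Lam_def: "\<And>k. Lam k = stack m (lk k)"
    and Xh_def: "\<And>k. Xh k = stack m (xh k)"
    and Yh_def: "\<And>k. Yh k = stack m (yh k)"
    and Zk_def: "\<And>k. Zk k = (THE Z. Z \<in> carrier_vec RZ \<and> Lam k = bU\<^sup>T *\<^sub>v Z)"
    and Zh_def: "\<And>k. Zh k = (THE Z. Z \<in> carrier_vec RZ \<and> Lam (Suc k) = bU\<^sup>T *\<^sub>v Z)"
    and xi_def: "\<And>k. \<xi> k = X k @\<^sub>v Y k @\<^sub>v Zk k"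
    and xih_def: "\<And>k. \<xi>h k = Xh k @\<^sub>v Yh k @\<^sub>v Zh k"
    and V_def: "\<And>k. V k = stack m (vk k) @\<^sub>v 0\<^sub>v MY @\<^sub>v 0\<^sub>v RZ"
    \<comment> \<open>matrices\<close>
    and Theta_def: "Theta = bdiag m nd \<theta>"
    and Ups_def: "Ups = bdiag m nd \<alpha>"
    and Gam_def: "Gam = bdiag m (\<lambda>_. p + q) \<gamma>"
    and Q_def: "Q = four_block_mat (minv Ups) (0\<^sub>m N (MY + RZ)) (0\<^sub>m (MY + RZ) N)
                     (four_block_mat (minv Gam) (- bU\<^sup>T) (0\<^sub>m RZ MY) ((1 / \<beta>) \<cdot>\<^sub>m 1\<^sub>m RZ))"
    and M_def: "M = four_block_mat Theta (0\<^sub>m N (MY + RZ)) (0\<^sub>m (MY + RZ) N)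
                     (four_block_mat (1\<^sub>m MY) (- (Gam * bU\<^sup>T)) (0\<^sub>m RZ MY) (1\<^sub>m RZ))"
    and H_def: "H = Q * minv M"
    and D_def: "D = Q\<^sup>T + Q - M\<^sup>T * H * M"
  shows
    "(\<forall>\<xi>s\<in>PhiZero m nd f A b g \<Omega> p q U. \<forall>k.
        qn H (\<xi> (Suc k) - \<xi>s) \<le> qn H (\<xi> k - \<xi>s) - qn D (\<xi> k - \<xi>h k) + 2 * ((\<xi>h k - \<xi>s) \<bullet> V k))
     \<and> (\<exists>B. \<forall>k. vnorm (\<xi> k) \<le> B)
     \<and> (\<exists>\<xi>inf\<in>PhiZero m nd f A b g \<Omega> p q U.
          vconv \<xi> \<xi>inf
          \<and> optimalP m nd f A b g \<Omega> p q (vec_first \<xi>inf N)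
          \<and> (\<exists>yinf. vec_first (vec_last \<xi>inf (MY + RZ)) MY = stack m (\<lambda>_. yinf)
                    \<and> optimalD m nd f A b g \<Omega> p q yinf))"
proof -
  have prox_step: "\<forall>k. \<forall>i<m. vk k i \<in> esubdiff (nd i) (\<lambda>x. ereal (prox_aug_lagrangian p q (\<gamma> i) (\<alpha> i) (f i)
      (Gfun A b g i) (yk k i - \<gamma> i \<cdot>\<^sub>v lk k i) (xk k i) x) + ind (\<Omega> i) x) (xh k i) \<and> vnorm (vk k i) \<le> eps i k"
    using step_v unfolding phik_def prox_aug_lagrangian_def .
  interpret I: dpmm_iteration m p q r nd f A b g \<Omega> L U \<theta> \<alpha> \<gamma> \<beta> eps xk yk lk xh yh vk
    by unfold_locales (fact assms prox_step | use m2 in simp)+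
  have N: "N = offs nd m" by (simp add: N_def offs_def)
  have multipliers: "Zk k = I.Z k" "Zh k = I.Z (Suc k)" for k
    unfolding Zk_def Zh_def Lam_def bU_def RZ_def transpose_kron_one by (rule I.the_Z)+
  have Q: "Q = I.Q" and M: "M = I.M"
    by (simp_all add: Q_def M_def I.Q_def I.M_def block3_upper_def N MY_def RZ_def bU_def Theta_def Ups_def Gam_def)
  have H: "H = I.H" and D: "D = I.D" by (simp_all add: H_def D_def I.H_def I.D_def Q M)
  have iterates: "\<xi> = I.\<xi>" "\<xi>h = I.\<xi>h" "V = I.V"
    by (simp_all add: fun_eq_iff xi_def xih_def V_def I.\<xi>_def I.\<xi>h_def I.V_def X_def Y_def Xh_def Yh_def
        I.X_def I.Y_def I.Xh_def I.Yh_def I.Vx_def MY_def RZ_def multipliers)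
  have zero: "PhiZero m nd f A b g \<Omega> p q U \<noteq> {}" using P_solvable slater by (rule I.PhiZero_nonempty)
  obtain \<xi>inf where lim: "\<xi>inf \<in> PhiZero m nd f A b g \<Omega> p q U" "vconv I.\<xi> \<xi>inf"
    using zero by (rule I.iterates_converge)
  show ?thesis
    unfolding iterates H D N MY_def RZ_def
    by (intro conjI ballI allI bexI[OF _ lim(1)] I.descent I.iterates_bounded[OF zero] lim I.optimal_if_PhiZero)
qed

end
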